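(* Let $f(x)=a+bx+\int_0^\infty(1-e^{-sx})\,\bar\nu(ds)$ be a Bernstein function, let ${}^f\sigma(t)$, $t\ge0$, be a subordinator with Laplace exponent $f$ and let ${}^fL(t)$, $t\ge0$, be its inverse. Assume that $\bar\nu(0,\infty)=\infty$ and that $s\mapsto\nu(s)=a+\bar\nu(s,\infty)$ is absolutely continuous on $(0,\infty)$. 1. The probability density $\mu_t(x)$ of ${}^f\sigma(t)$ is the solution to the problem $$\begin{cases}\frac{\partial}{\partial t}\mu_t(x)=-\,{}^f\mathcal D_x^{(bt,+\infty)}\mu_t(x), & x>bt,\ 0<t<\infty,\ b\ge0,\\ \mu_t(bt)=0, & 0<t<\infty,\\ \mu_0(x)=\delta(x).\end{cases}$$ 2. The probability density $l_t(x)$ of ${}^fL(t)$ is the solution to the equation $${}^f\mathcal D_t^{(0,\infty)}l_t(x)=-\frac{\partial}{\partial x}l_t(x),\qquad t>0,\ \text{ and }\ \begin{cases}0<x<\frac tb<\infty,&\text{if }b>0,\\0<x<\infty,&\text{if }b=0,\end{cases}$$ subject to $$l_t(t/b)=0\ \ (\text{if } b>0),\qquad l_t(0)=\nu(t),\qquad l_0(x)=\delta(x).$$ Here ${}^f\mathcal D_x^{(bt,+\infty)}u(x)=\frac{d}{dx}\Bigl[b\,u(x)+\int_0^{x-bt}u(x-s)\,\nu(s)\,ds\Bigr]$ and ${}^f\mathcal D_t^{(0,\infty)}u(t)=\frac{d}{dt}\Bigl[b\,u(t)+\int_0^{t}u(t-s)\,\nu(s)\,ds\Bigr]$.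
   Context: A Bernstein function is one of the form $f(x)=a+bx+\int_0^\infty(1-e^{-sx})\bar\nu(ds)$, $x>0$, with $a,b\ge0$ and $\bar\nu$ a non-negative measure on $(0,\infty)$ (the Lévy measure) satisfying $\int_0^\infty(z\wedge1)\,\bar\nu(dz)<\infty$. The function $\nu(s)=a+\bar\nu(s,\infty)$ is its tail. Absolute continuity of $\nu$ on $(0,\infty)$ is understood as absolute continuity on compact subintervals of $(0,\infty)$. A subordinator ${}^f\sigma(t)$, $t\ge0$, with Laplace exponent $f$ is a process with values in $[0,\infty]$ ($\infty$ absorbing), non-decreasing right-continuous paths started at $0$, and independent and homogeneous increments up to its lifetime $\zeta=\inf\{t\ge 0:{}^f\sigma(t)=\infty\}$, with $\mathbb E e^{-\lambda\,{}^f\sigma(t)}=e^{-tf(\lambda)}$ (convention $e^{-\infty}=0$). Its inverse is ${}^fL(t)=\inf\{s>0:{}^f\sigma(s)>t\}$. Write $\mu_t(B)=\Pr\{{}^f\sigma(t)\in B\}$ for Borel $B\subset[0,\infty)$ and $l_t(B)=\Pr\{{}^fL(t)\in B\}$. Under the stated assumptions $\mu_t$ ($t>0$) and $l_t$ have densities, denoted (with abuse of notation) $\mu_t(x)$ and $l_t(x)$; $\mu_0(x)=\delta(x)$ and $l_0(x)=\delta(x)$ mean that the initial distribution is the Dirac mass at $0$. The density of ${}^fL(t)$ is $l_t(x)=b\mu_x(t)+\int_0^t\mu_x(t-z)\nu(z)\,dz$, whose value at $x=0$ is taken using $\mu_0=\delta_0$.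
   Formalization: The two equations need not hold at every point; they are proved weakly (tested in the variable of the operator D, classical derivative in the other, no boundary flux) and pointwise on open sets where both sides exist and are continuous; zero boundary values hold for a chosen version. *)

theory Defs
  imports "HOL-Probability.Probability"
begin

section \<open>Bernstein functions\<close>

text \<open>The Levy measure is a Borel measure on the whole line that does not charge \<open>{..0}\<close>.\<close>

definition levy_triple :: "real \<Rightarrow> real \<Rightarrow> real measure \<Rightarrow> bool" where
  "levy_triple a b N \<longleftrightarrow> 0 \<le> a \<and> 0 \<le> b \<and> sets N = sets borel \<and> emeasure N {..0} = 0 \<and>
     (\<integral>\<^sup>+ z. ennreal (min z 1) \<partial>N) < \<infinity>"

definition bernstein :: "real \<Rightarrow> real \<Rightarrow> real measure \<Rightarrow> real \<Rightarrow> real" where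
  "bernstein a b N x = a + b * x + (LINT s|N. 1 - exp (- s * x))"

text \<open>Only the values of the tail at \<open>s > 0\<close> are meaningful: \<open>N {0<..}\<close> may be infinite.\<close>

definition levy_tail :: "real \<Rightarrow> real measure \<Rightarrow> real \<Rightarrow> real" where
  "levy_tail a N s = a + measure N {s<..}"

definition abs_cont_on_interval :: "real \<Rightarrow> real \<Rightarrow> (real \<Rightarrow> real) \<Rightarrow> bool" where
  "abs_cont_on_interval c d g \<longleftrightarrow>
     (\<forall>\<epsilon>>0. \<exists>\<delta>>0. \<forall>n (x :: nat \<Rightarrow> real) y.
        (\<forall>i<n. c \<le> x i \<and> x i \<le> y i \<and> y i \<le> d) \<and>
        (\<forall>i<n. \<forall>j<n. i \<noteq> j \<longrightarrow> {x i<..<y i} \<inter> {x j<..<y j} = {}) \<and>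
        (\<Sum>i<n. y i - x i) < \<delta>
        \<longrightarrow> (\<Sum>i<n. \<bar>g (y i) - g (x i)\<bar>) < \<epsilon>)"


section \<open>Subordinators and their inverses\<close>

text \<open>The natural filtration at time \<open>t\<close>.\<close>

definition past :: "'w measure \<Rightarrow> (real \<Rightarrow> 'w \<Rightarrow> ennreal) \<Rightarrow> real \<Rightarrow> 'w set set" where
  "past M \<sigma> t = sigma_sets (space M)
     {\<sigma> u -` C \<inter> space M | u C. 0 \<le> u \<and> u \<le> t \<and> C \<in> sets borel}"

text \<open>
  Only the times \<open>t \<ge> 0\<close> matter. Since paths are non-decreasing and right-continuous,
  \<open>\<infinity>\<close> is absorbing and \<open>t\<close> precedes the lifetime iff \<open>\<sigma> t \<omega> < \<infinity>\<close>; so the last but one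
  condition says that, given survival up to \<open>t\<close>, the increment \<open>\<sigma> (t + s) - \<sigma> t\<close> is
  independent of the past and distributed as \<open>\<sigma> s\<close>. The last one uses \<open>exp (-\<infinity>) = 0\<close>.
\<close>

definition subordinator :: "'w measure \<Rightarrow> (real \<Rightarrow> real) \<Rightarrow> (real \<Rightarrow> 'w \<Rightarrow> ennreal) \<Rightarrow> bool" where
  "subordinator M f \<sigma> \<longleftrightarrow>
     prob_space M \<and>
     (\<forall>t\<ge>0. \<sigma> t \<in> borel_measurable M) \<and>
     (\<forall>\<omega>\<in>space M. \<sigma> 0 \<omega> = 0) \<and>
     (\<forall>\<omega>\<in>space M. \<forall>s t. 0 \<le> s \<and> s \<le> t \<longrightarrow> \<sigma> s \<omega> \<le> \<sigma> t \<omega>) \<and>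
     (\<forall>\<omega>\<in>space M. \<forall>t\<ge>0. continuous (at_right t) (\<lambda>r. \<sigma> r \<omega>)) \<and>
     (\<forall>s\<ge>0. \<forall>t\<ge>0. \<forall>A\<in>past M \<sigma> t. \<forall>B\<in>sets borel.
        measure M {\<omega>\<in>A. \<sigma> t \<omega> < \<infinity> \<and> \<sigma> (t + s) \<omega> - \<sigma> t \<omega> \<in> B} =
        measure M {\<omega>\<in>A. \<sigma> t \<omega> < \<infinity>} * measure M {\<omega>\<in>space M. \<sigma> s \<omega> \<in> B}) \<and>
     (\<forall>t\<ge>0. \<forall>z>0.
        (LINT \<omega>|M. (if \<sigma> t \<omega> = \<infinity> then 0 else exp (- z * enn2real (\<sigma> t \<omega>)))) =
        exp (- t * f z))"

definition inverse_subordinator ::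
    "(real \<Rightarrow> 'w \<Rightarrow> ennreal) \<Rightarrow> real \<Rightarrow> 'w \<Rightarrow> ennreal" where
  "inverse_subordinator \<sigma> t \<omega> = Inf {ennreal s | s. 0 < s \<and> ennreal t < \<sigma> s \<omega>}"

text \<open>
  \<open>u\<close> is a density of the restriction to \<open>[0,\<infinity>)\<close> of the law of the \<open>[0,\<infinity>]\<close>-valued random
  variable \<open>X\<close>; for a killed subordinator this is a defective law.
\<close>

definition finite_part_density :: "'w measure \<Rightarrow> ('w \<Rightarrow> ennreal) \<Rightarrow> (real \<Rightarrow> real) \<Rightarrow> bool" where
  "finite_part_density M X u \<longleftrightarrow>
     (\<forall>x. 0 \<le> u x) \<and>
     distributed (restrict_space M {\<omega>\<in>space M. X \<omega> < \<infinity>}) lborel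
       (\<lambda>\<omega>. enn2real (X \<omega>)) (\<lambda>x. ennreal (u x))"

text \<open>
  The density \<open>l t x\<close> of the inverse subordinator in terms of densities \<open>\<mu> t\<close>, \<open>t > 0\<close>, of the
  subordinator. At \<open>x = 0\<close> the formula is evaluated with the Dirac mass \<open>\<mu> 0 = \<delta>\<close>: for \<open>t > 0\<close>
  the term \<open>b * \<mu> 0 t\<close> vanishes and the convolution is an integral against \<open>\<delta>\<close>.
\<close>

definition inverse_density ::
    "real \<Rightarrow> (real \<Rightarrow> real) \<Rightarrow> (real \<Rightarrow> real \<Rightarrow> real) \<Rightarrow> real \<Rightarrow> real \<Rightarrow> real" where
  "inverse_density b \<nu> \<mu> t x =
     (if x < 0 then 0
      else if x = 0 then (LINT y:{0..<t}|return borel 0. \<nu> (t - y))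
      else b * \<mu> x t + (LBINT z:{0<..<t}. \<mu> x (t - z) * \<nu> z))"


section \<open>The convolution-type derivative and the evolution equation\<close>

definition conv_primitive ::
    "real \<Rightarrow> (real \<Rightarrow> real) \<Rightarrow> real \<Rightarrow> (real \<Rightarrow> real) \<Rightarrow> real \<Rightarrow> real" where
  "conv_primitive b \<nu> c u x = b * u x + (LBINT s:{0<..<x - c}. u (x - s) * \<nu> s)"

text \<open>The operator \<open>D\<close> on the half-line \<open>(c,\<infinity>)\<close>.\<close>

definition conv_deriv ::
    "real \<Rightarrow> (real \<Rightarrow> real) \<Rightarrow> real \<Rightarrow> (real \<Rightarrow> real) \<Rightarrow> real \<Rightarrow> real" where
  "conv_deriv b \<nu> c u x = deriv (conv_primitive b \<nu> c u) x"

text \<open>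
  The equation \<open>\<partial>\<^sub>r u r x = - D u r x\<close> (with \<open>D\<close> acting on \<open>x\<close>, on the half-line \<open>(c r, \<infinity>)\<close>)
  in the region \<open>r > 0\<close>, \<open>x > b r\<close>.

  Under the assumptions made here densities need not have versions for which both sides exist
  pointwise. The equation is therefore understood as follows. The derivative
  with respect to \<open>r\<close> is classical, for every \<open>r > 0\<close>, once the equation is tested in \<open>x\<close> with
  \<open>C\<^sup>1\<close> functions of bounded support, and the derivative \<open>d/dx\<close> in \<open>D\<close> is carried over to the
  test function. Test functions need not vanish at \<open>x = b r\<close>: with the homogeneous boundary
  condition at \<open>x = b r\<close> no boundary terms arise, so this condition is part of the weak
  formulation.
\<close>

definition weak_evolution ::
    "real \<Rightarrow> (real \<Rightarrow> real) \<Rightarrow> (real \<Rightarrow> real) \<Rightarrow> (real \<Rightarrow> real \<Rightarrow> real) \<Rightarrow> bool" where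
  "weak_evolution b \<nu> c u \<longleftrightarrow>
     (\<forall>\<phi> :: real \<Rightarrow> real. \<phi> C1_differentiable_on UNIV \<and> bounded {x. \<phi> x \<noteq> 0} \<longrightarrow>
        (\<forall>r>0. ((\<lambda>r. LBINT x:{b * r<..}. \<phi> x * u r x) has_real_derivative
           (LBINT x:{b * r<..}. deriv \<phi> x * conv_primitive b \<nu> (c r) (u r) x)) (at r)))"

text \<open>The equation holds pointwise in every open part of the region in which both sides exist
  and are continuous.\<close>

definition classical_evolution ::
    "real \<Rightarrow> (real \<Rightarrow> real) \<Rightarrow> (real \<Rightarrow> real) \<Rightarrow> (real \<Rightarrow> real \<Rightarrow> real) \<Rightarrow> bool" where
  "classical_evolution b \<nu> c u \<longleftrightarrow>
     (\<forall>U :: (real \<times> real) set.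
        open U \<and> U \<subseteq> {(r, x). 0 < r \<and> b * r < x} \<and>
        (\<forall>(r, x)\<in>U. (\<lambda>r. u r x) differentiable (at r)) \<and>
        (\<forall>(r, x)\<in>U. conv_primitive b \<nu> (c r) (u r) differentiable (at x)) \<and>
        continuous_on U (\<lambda>(r, x). deriv (\<lambda>r. u r x) r) \<and>
        continuous_on U (\<lambda>(r, x). conv_deriv b \<nu> (c r) (u r) x)
        \<longrightarrow> (\<forall>(r, x)\<in>U. deriv (\<lambda>r. u r x) r = - conv_deriv b \<nu> (c r) (u r) x))"

definition evolution ::
    "real \<Rightarrow> (real \<Rightarrow> real) \<Rightarrow> (real \<Rightarrow> real) \<Rightarrow> (real \<Rightarrow> real \<Rightarrow> real) \<Rightarrow> bool" where
  "evolution b \<nu> c u \<longleftrightarrow> weak_evolution b \<nu> c u \<and> classical_evolution b \<nu> c u"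

definition density_equation ::
    "real \<Rightarrow> (real \<Rightarrow> real) \<Rightarrow> (real \<Rightarrow> real \<Rightarrow> real) \<Rightarrow> bool" where
  "density_equation b \<nu> \<mu> \<longleftrightarrow> evolution b \<nu> (\<lambda>t. b * t) \<mu>"

text \<open>Here \<open>x\<close> is the evolution variable and \<open>D\<close> acts on \<open>t\<close>, on the half-line \<open>(0,\<infinity>)\<close>.\<close>

definition inverse_equation ::
    "real \<Rightarrow> (real \<Rightarrow> real) \<Rightarrow> (real \<Rightarrow> real \<Rightarrow> real) \<Rightarrow> bool" where
  "inverse_equation b \<nu> l \<longleftrightarrow> evolution b \<nu> (\<lambda>x. 0) (\<lambda>x t. l t x)"


text \<open>
  The initial data, and the value \<open>l t 0 = \<nu> t\<close>, are also required to be attained as weak limits.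
\<close>

definition density_problem ::
    "real \<Rightarrow> (real \<Rightarrow> real) \<Rightarrow> (real \<Rightarrow> real \<Rightarrow> real) \<Rightarrow> bool" where
  "density_problem b \<nu> \<mu> \<longleftrightarrow>
     density_equation b \<nu> \<mu> \<and>
     (\<forall>t>0. \<mu> t (b * t) = 0) \<and>
     (\<forall>\<phi> :: real \<Rightarrow> real. continuous_on UNIV \<phi> \<and> bounded (range \<phi>) \<longrightarrow>
        ((\<lambda>t. LBINT x:{b * t<..}. \<phi> x * \<mu> t x) \<longlongrightarrow> \<phi> 0) (at_right 0))"

definition inverse_problem ::
    "real \<Rightarrow> (real \<Rightarrow> real) \<Rightarrow> (real \<Rightarrow> real \<Rightarrow> real) \<Rightarrow> bool" where
  "inverse_problem b \<nu> l \<longleftrightarrow>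
     inverse_equation b \<nu> l \<and>
     (b > 0 \<longrightarrow> (\<forall>t>0. l t (t / b) = 0)) \<and>
     (\<forall>t>0. l t 0 = \<nu> t) \<and>
     (\<forall>\<psi> :: real \<Rightarrow> real.
        continuous_on UNIV \<psi> \<and> (\<exists>K. compact K \<and> K \<subseteq> {0<..} \<and> (\<forall>t. t \<notin> K \<longrightarrow> \<psi> t = 0)) \<longrightarrow>
        ((\<lambda>x. LBINT t:{b * x<..}. \<psi> t * l t x) \<longlongrightarrow> (LBINT t:{0<..}. \<psi> t * \<nu> t)) (at_right 0)) \<and>
     (\<forall>\<phi> :: real \<Rightarrow> real. continuous_on UNIV \<phi> \<and> bounded (range \<phi>) \<longrightarrow>
        ((\<lambda>t. LBINT x:{0<..}. \<phi> x * l t x) \<longlongrightarrow> \<phi> 0) (at_right 0))"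

end

(*
  Only the one-dimensional Laplace transforms exp (- t f) and the monotone right-continuous paths
  are used. Weierstrass approximation by polynomials in exp (- x) gives uniqueness of Laplace
  transforms, and reduces the weak equations to test functions exp (- z x), for which they are the
  identities (d/dr) F(z) exp (- r f(z)) = - z (f(z) / z) F(z) exp (- r f(z)): convolution with
  b delta + nu multiplies a Laplace transform by f(z) / z.

  Differentiating exp (- t f(z)) in z gives (x - b t) mu_t(dx) = t (s N(ds) * mu_t)(dx). Since N has a
  density, so has mu_t, and the formula singles out a version of mu_t(x) that is jointly measurable.
  With this version l_t(x) is a density of the inverse for almost every t, by a comparison of double
  Laplace transforms. To reach every t > 0, multiply by t - b x: the identity above turns
  (t - b x) l_t(x) into a sum of convolutions in t whose integral against exp (- q x) dx is
  right-continuous in t, as is the corresponding expectation. The value x = t / b has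
  probability 0 by a Chernoff bound.
*)
theory Submission
  imports Defs
begin

text \<open>Two obstacles shape the proof. First, for fixed t the function x -> l_t(x) reads
  \<open>b * \<mu> x t\<close> at one point t for all x, while a density is determined only up to
  null sets for each x separately. A version given by a formula at every point is therefore needed
  for the law of the inverse. The evolution equations integrate at a fixed value of the evolution
  variable and hold for every version. Second, right-continuity in law of the inverse gives no
  convergence of densities, and the chosen version carries the factor 1 / (t - b x), so an identity
  for almost every t does not pass to a given t. The weight t - b x cancels exactly this factor.
  Dividing by it afterwards loses nothing because its zero has probability 0. This is where the
  infinite mass of the Levy measure enters: it makes f(z) - b z unbounded, so that Chernoff bounds
  along the drift line become arbitrarily small. All approximation errors are kept proportional to
  exp (- x), since the measures on the Laplace side may have infinite mass while their transforms at
  1 are finite.\<close>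

section \<open>Laplace transforms\<close>

lemma exp_neg_tendsto_0: "0 < c \<Longrightarrow> ((\<lambda>y. exp (- c * y)) \<longlongrightarrow> 0) at_top" for c :: real
  by (intro filterlim_compose[OF exp_at_bot]
    filterlim_tendsto_neg_mult_at_bot[OF tendsto_const _ filterlim_ident]) auto

text \<open>Substituting x = exp (- y) turns \<open>h\<close> into a function on (0,1] that vanishes
  near 0. The quotient \<open>h (- ln x) / x\<close> then extends continuously by 0, and a
  polynomial approximation of it, multiplied back by x, has exponents starting at 1 and an error
  proportional to \<open>exp (- y)\<close>.\<close>

lemma exp_poly_approx:
  fixes h :: "real \<Rightarrow> real"
  assumes cont: "continuous_on {0..} h" and zero: "\<And>y. K \<le> y \<Longrightarrow> h y = 0" and e: "0 < e"
  obtains c :: "nat \<Rightarrow> real" and n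
  where "\<And>y. 0 \<le> y \<Longrightarrow> \<bar>h y - (\<Sum>j<n. c j * exp (- (real j + 1) * y))\<bar> \<le> e * exp (- y)"
proof -
  \<comment> \<open>A nonnegative cut-off puts \<open>exp (- K')\<close> inside [0,1], so the two
    pieces of \<open>g\<close> cover exactly that interval.\<close>
  define K' where "K' = max K 0"
  define g where "g x = (if x \<le> exp (- K') then 0 else h (- ln x) / x)" for x
  have "continuous_on ({0..exp (- K')} \<union> {exp (- K')..1}) g"
    unfolding g_def
  proof (rule continuous_on_If)
    show "continuous_on {exp (- K')..1} (\<lambda>x. h (- ln x) / x)"
      by (intro continuous_intros continuous_on_compose2[OF cont])
         (auto simp: not_le intro: order_less_le_trans[OF exp_gt_zero] dest!: order_less_le_trans[OF exp_gt_zero])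
    show "0 = h (- ln x) / x" if "x \<in> {exp (- K')..1}" "x \<le> exp (- K')" for x
    proof -
      have "x = exp (- K')" using that by auto
      then show ?thesis using zero[of K'] by (simp add: K'_def)
    qed
  qed auto
  also have "{0..exp (- K')} \<union> {exp (- K')..1} = {0..1}"
  proof -
    have "exp (- K') \<le> 1" "0 \<le> exp (- K')" by (simp_all add: K'_def)
    then show ?thesis by (intro ivl_disj_un_two_touch) auto
  qed
  finally obtain p where p: "real_polynomial_function p" "\<And>x. x \<in> {0..1} \<Longrightarrow> \<bar>g x - p x\<bar> < e"
    using Stone_Weierstrass_real_polynomial_function[of "{0..1::real}" g e] e by auto
  then obtain c n where c: "p = (\<lambda>x. \<Sum>i\<le>n. c i * x ^ i)"
    unfolding real_polynomial_function_iff_sum by blast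
  show thesis
  proof (rule that[of c "Suc n"])
    fix y :: real assume y: "0 \<le> y"
    have g: "g (exp (- y)) * exp (- y) = h y"
      using zero[of y] by (auto simp: g_def K'_def)
    have ex: "exp (- (real j + 1) * y) = exp (- y) ^ j * exp (- y)" for j
    proof -
      have "exp (- (real j + 1) * y) = exp (real j * (- y) + - y)" by (simp add: algebra_simps)
      then show ?thesis by (simp only: exp_add exp_of_nat_mult)
    qed
    have "(\<Sum>j<Suc n. c j * exp (- (real j + 1) * y)) = (\<Sum>j\<le>n. c j * exp (- y) ^ j * exp (- y))"
      unfolding lessThan_Suc_atMost ex by (simp only: mult.assoc)
    also have "\<dots> = p (exp (- y)) * exp (- y)"
      by (simp add: c sum_distrib_right)
    finally have "\<bar>h y - (\<Sum>j<Suc n. c j * exp (- (real j + 1) * y))\<bar> = \<bar>g (exp (- y)) - p (exp (- y))\<bar> * exp (- y)"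
      by (simp only: g[symmetric] left_diff_distrib[symmetric] abs_mult abs_exp_cancel)
    also have "\<dots> \<le> e * exp (- y)"
      using p(2)[of "exp (- y)"] y by (intro mult_right_mono) auto
    finally show "\<bar>h y - (\<Sum>j<Suc n. c j * exp (- (real j + 1) * y))\<bar> \<le> e * exp (- y)" .
  qed
qed

text \<open>Supplies the dominating function \<open>C * exp (- y)\<close>, which is integrable as
  soon as the Laplace transform at 1 is finite.\<close>

lemma compact_support_exp_bound:
  fixes h :: "real \<Rightarrow> real"
  assumes cont: "continuous_on {0..} h" and zero: "\<And>y. K \<le> y \<Longrightarrow> h y = 0"
  obtains C where "0 \<le> C" "\<And>y. 0 \<le> y \<Longrightarrow> \<bar>h y\<bar> \<le> C * exp (- y)"
proof -
  have "compact (h ` {0..K})"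
    by (intro compact_continuous_image continuous_on_subset[OF cont]) auto
  then obtain C where C: "\<And>y. y \<in> {0..K} \<Longrightarrow> \<bar>h y\<bar> \<le> C"
    using compact_imp_bounded[THEN bounded_iff[THEN iffD1]] by (metis imageI real_norm_def)
  show thesis
  proof (rule that[of "\<bar>C\<bar> * exp K"])
    fix y :: real assume y: "0 \<le> y"
    show "\<bar>h y\<bar> \<le> \<bar>C\<bar> * exp K * exp (- y)"
    proof (cases "y \<le> K")
      case True
      have "\<bar>h y\<bar> \<le> \<bar>C\<bar> * 1" using C[of y] True y by auto
      also have "\<dots> \<le> \<bar>C\<bar> * exp (K - y)"
        using True by (intro mult_left_mono) auto
      finally show ?thesis by (simp add: exp_diff exp_minus field_simps)
    qed (use zero[of y] in auto)
  qed auto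
qed

text \<open>The Laplace transform at \<open>1, 2, 3, \<dots>\<close> consists of the moments of the image under
  \<open>x \<mapsto> exp (- x)\<close>, a measure on \<open>[0, 1]\<close>.\<close>

lemma laplace_unique:
  fixes A B :: "real measure"
  assumes sets [measurable_cong]: "sets A = sets borel" "sets B = sets borel"
    and pos: "AE x in A. 0 \<le> x" "AE x in B. 0 \<le> x"
    and eq: "\<And>j::nat. (\<integral>\<^sup>+x. ennreal (exp (- (real j + 1) * x)) \<partial>A) = (\<integral>\<^sup>+x. ennreal (exp (- (real j + 1) * x)) \<partial>B)"
    and fin: "(\<integral>\<^sup>+x. ennreal (exp (- x)) \<partial>A) < \<infinity>"
  shows "A = B"
proof -
  have finB: "(\<integral>\<^sup>+x. ennreal (exp (- x)) \<partial>B) < \<infinity>"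
    using eq[of 0] fin by simp
  define m where "m j = (LINT x|A. exp (- (real j + 1) * x))" for j
  \<comment> \<open>Stated for a generic \<open>Q\<close> so that it applies to both measures: the
    integral of \<open>h\<close> differs by at most \<open>e * m 0\<close> from one and the same
    combination of the common values \<open>m j\<close>.\<close>
  have aux: "integrable Q h \<and> \<bar>(LINT x|Q. h x) - (\<Sum>j<n. c j * m j)\<bar> \<le> e * m 0"
    if Q: "sets Q = sets borel" "AE x in Q. 0 \<le> x" "(\<integral>\<^sup>+x. ennreal (exp (- x)) \<partial>Q) < \<infinity>"
        "\<And>j. (LINT x|Q. exp (- (real j + 1) * x)) = m j"
      and h: "h \<in> borel_measurable borel" "continuous_on {0..} h" "\<And>y. K \<le> y \<Longrightarrow> h y = 0"
      and c: "\<And>y. 0 \<le> y \<Longrightarrow> \<bar>h y - (\<Sum>j<n. c j * exp (- (real j + 1) * y))\<bar> \<le> e * exp (- y)"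
    for Q :: "real measure" and h K c n e
  proof -
    note [measurable_cong] = Q(1)
    note [measurable] = h(1)
    have i0: "integrable Q (\<lambda>x. exp (- x))"
      using Q(3) by (intro integrableI_nonneg) auto
    have i: "integrable Q (\<lambda>x. exp (- (real j + 1) * x))" for j
    proof (rule Bochner_Integration.integrable_bound[OF i0])
      show "AE x in Q. norm (exp (- (real j + 1) * x)) \<le> norm (exp (- x))"
        using Q(2) by eventually_elim (simp add: field_simps)
    qed simp
    obtain C where C: "\<And>y. 0 \<le> y \<Longrightarrow> \<bar>h y\<bar> \<le> C * exp (- y)"
      using compact_support_exp_bound[OF h(2,3)] by metis
    have ih: "integrable Q h"
    proof (rule Bochner_Integration.integrable_bound[OF integrable_mult_right[OF i0, of C]])
      show "AE x in Q. norm (h x) \<le> norm (C * exp (- x))"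
        using Q(2) by eventually_elim (use C in \<open>auto intro: order_trans[OF _ abs_ge_self]\<close>)
    qed simp
    have "(LINT x|Q. h x) - (\<Sum>j<n. c j * m j) = (LINT x|Q. h x - (\<Sum>j<n. c j * exp (- (real j + 1) * x)))"
      using ih i by (subst Bochner_Integration.integral_diff) (simp_all add: Q(4)[symmetric] Bochner_Integration.integral_sum)
    also have "\<bar>\<dots>\<bar> \<le> (LINT x|Q. \<bar>h x - (\<Sum>j<n. c j * exp (- (real j + 1) * x))\<bar>)"
      by (rule integral_abs_bound)
    also have "\<dots> \<le> (LINT x|Q. e * exp (- x))"
    proof (rule integral_mono_AE)
      show "AE x in Q. \<bar>h x - (\<Sum>j<n. c j * exp (- (real j + 1) * x))\<bar> \<le> e * exp (- x)"
        using Q(2) by eventually_elim (rule c)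
    qed (use ih i i0 in simp_all)
    also have "\<dots> = e * m 0"
      using Q(4)[of 0] by simp
    finally show ?thesis using ih by simp
  qed
  have mB: "(LINT x|B. exp (- (real j + 1) * x)) = m j" for j
  proof -
    have "(LINT x|Q. exp (- (real j + 1) * x)) = enn2real (\<integral>\<^sup>+x. ennreal (exp (- (real j + 1) * x)) \<partial>Q)"
      if "sets Q = sets borel" for Q
    proof -
      note [measurable_cong] = that
      show ?thesis by (intro integral_eq_nn_integral) auto
    qed
    with sets eq[of j] show ?thesis by (simp only: m_def)
  qed
  have int_eq: "integrable A h \<and> integrable B h \<and> (LINT x|A. h x) = (LINT x|B. h x)"
    if h: "h \<in> borel_measurable borel" "continuous_on {0..} h" "\<And>y. K \<le> y \<Longrightarrow> h y = 0" for h :: "real \<Rightarrow> real" and K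
  proof -
    have m0: "0 \<le> m 0" unfolding m_def by simp
    have *: "integrable A h \<and> integrable B h \<and> \<bar>(LINT x|A. h x) - (LINT x|B. h x)\<bar> \<le> e * (2 * m 0)" if e: "0 < e" for e
    proof -
      obtain c n where "\<And>y. 0 \<le> y \<Longrightarrow> \<bar>h y - (\<Sum>j<n. c j * exp (- (real j + 1) * y))\<bar> \<le> e * exp (- y)"
        using exp_poly_approx[OF h(2,3) e] by metis
      from aux[where K=K, OF sets(1) pos(1) fin m_def[symmetric] h this] aux[where K=K, OF sets(2) pos(2) finB mB h this]
      show ?thesis by auto
    qed
    have "\<bar>(LINT x|A. h x) - (LINT x|B. h x)\<bar> \<le> 0 + d" if d: "0 < d" for d
    proof -
      have "\<bar>(LINT x|A. h x) - (LINT x|B. h x)\<bar> \<le> d / (2 * m 0 + 1) * (2 * m 0)"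
        using *[of "d / (2 * m 0 + 1)"] d m0 by auto
      also have "\<dots> \<le> d" using d m0 by (simp add: field_simps)
      finally show ?thesis by simp
    qed
    then have "\<bar>(LINT x|A. h x) - (LINT x|B. h x)\<bar> \<le> 0"
      using field_le_epsilon by blast
    with *[of 1] show ?thesis by simp
  qed
  have meq: "emeasure A {..s} = emeasure B {..s} \<and> emeasure A {..s} < \<infinity>" for s
  proof -
    \<comment> \<open>Continuous cut-offs decreasing to the indicator of \<open>{..s}\<close>. Only
      positive indices are used below, because \<open>h 0\<close> is constantly 1; from index 1 on
      the support ends at \<open>s + 1\<close> and \<open>h 1\<close> dominates.\<close>
    define h where "h i x = max 0 (1 - real i * max 0 (x - s))" for i :: nat and x :: real
    have hc: "continuous_on S (h i)" for S i unfolding h_def by (intro continuous_intros)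
    have hm [measurable]: "h i \<in> borel_measurable borel" for i
      by (rule borel_measurable_continuous_onI[OF hc])
    have hz: "h (Suc i) y = 0" if "s + 1 \<le> y" for i y
    proof -
      have "1 * 1 \<le> real (Suc i) * max 0 (y - s)" using that by (intro mult_mono) auto
      then show ?thesis by (simp add: h_def)
    qed
    have hl: "(\<lambda>i. h (Suc i) x) \<longlonglongrightarrow> indicator {..s} x" for x
    proof (cases "x \<le> s")
      case True then show ?thesis by (simp add: h_def)
    next
      case False
      then obtain k where k: "1 < real k * (x - s)"
        using reals_Archimedean3[of "x - s"] by auto
      have "h (Suc i) x = 0" if "k \<le> i" for i
      proof -
        have "1 \<le> real k * (x - s)" using k by simp
        also have "\<dots> \<le> real (Suc i) * (x - s)" using that False by (intro mult_right_mono) auto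
        finally show ?thesis using False by (simp add: h_def)
      qed
      then show ?thesis using False by (auto intro!: tendsto_eventually eventually_sequentiallyI)
    qed
    have bd: "norm (h (Suc i) x) \<le> h 1 x" for i x
    proof -
      have "1 * max 0 (x - s) \<le> real (Suc i) * max 0 (x - s)" by (intro mult_right_mono) auto
      then show ?thesis by (simp add: h_def)
    qed
    have *: "(\<lambda>i. LINT x|Q. h (Suc i) x) \<longlonglongrightarrow> (LINT x|Q. indicator {..s} x) \<and> integrable Q (indicator {..s} :: real \<Rightarrow> real)"
      if "sets Q = sets borel" "integrable Q (h 1)" for Q
    proof -
      note [measurable_cong] = that(1)
      have m: "(indicator {..s} :: real \<Rightarrow> real) \<in> borel_measurable Q" "\<And>i. h (Suc i) \<in> borel_measurable Q"
        by measurable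
      note dc = m that(2) AE_I2[OF hl] AE_I2[OF bd]
      show ?thesis
        by (rule conjI[OF integral_dominated_convergence[OF dc] integrable_dominated_convergence[OF dc]])
    qed
    have "integrable A (h 1)" "integrable B (h 1)"
      using int_eq[OF hm hc, of "s + 1" 1] hz[of _ 0] by auto
    note l = *[OF sets(1) this(1)] *[OF sets(2) this(2)]
    have "(LINT x|A. h (Suc i) x) = (LINT x|B. h (Suc i) x)" for i
      using int_eq[OF hm hc hz] by auto
    with l have "(LINT x|A. indicator {..s} x) = (LINT x|B. indicator {..s} x :: real)"
      using LIMSEQ_unique by auto
    moreover from l have "emeasure A {..s} < \<infinity>" "emeasure B {..s} < \<infinity>"
      by (simp_all add: integrable_indicator_iff sets)
    ultimately show ?thesis
      using sets sets_eq_imp_space_eq[OF sets(1)] sets_eq_imp_space_eq[OF sets(2)]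
      by (simp add: emeasure_eq_ennreal_measure)
  qed
  show ?thesis
  proof (rule measure_eqI_generator_eq_countable[where E="range (\<lambda>s::real. {..s})" and \<Omega>=UNIV and A="range (\<lambda>n::nat. {..real n})"])
    show "Int_stable (range (\<lambda>s::real. {..s}))"
      by (auto simp: Int_stable_def intro: range_eqI[of _ _ "min _ _"])
    show "\<Union> (range (\<lambda>n::nat. {..real n})) = UNIV"
      using real_arch_simple by auto
    show "sets A = sigma_sets UNIV (range (\<lambda>s::real. {..s}))" "sets B = sigma_sets UNIV (range (\<lambda>s::real. {..s}))"
      unfolding sets by (subst borel_eq_atMost, simp)+
    show "\<And>X. X \<in> range (\<lambda>s::real. {..s}) \<Longrightarrow> emeasure A X = emeasure B X"
      using meq by auto
    show "\<And>X. X \<in> range (\<lambda>n::nat. {..real n}) \<Longrightarrow> emeasure A X \<noteq> \<infinity>"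
      using meq by (metis imageE less_irrefl)
  qed auto
qed

text \<open>The mean value inequality bounds the difference quotients by \<open>w\<close>, so
  dominated convergence applies along every sequence tending to \<open>z0\<close>.\<close>

lemma has_real_derivative_integral:
  fixes g g' :: "real \<Rightarrow> 'a \<Rightarrow> real"
  assumes e: "0 < e"
    and int: "\<And>z. \<bar>z - z0\<bar> < e \<Longrightarrow> integrable Q (g z)"
    and meas: "g' z0 \<in> borel_measurable Q"
    and der: "AE y in Q. \<forall>z. \<bar>z - z0\<bar> < e \<longrightarrow> ((\<lambda>z. g z y) has_real_derivative g' z y) (at z) \<and> \<bar>g' z y\<bar> \<le> w y"
    and w: "integrable Q w"
  shows "((\<lambda>z. LINT y|Q. g z y) has_real_derivative (LINT y|Q. g' z0 y)) (at z0)"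
proof -
  have "((\<lambda>z. ((LINT y|Q. g z y) - (LINT y|Q. g z0 y)) / (z - z0)) \<longlongrightarrow> (LINT y|Q. g' z0 y)) (at z0)"
  proof (subst tendsto_at_iff_sequentially, intro allI impI, unfold comp_def)
    fix X :: "nat \<Rightarrow> real" assume X: "\<forall>i. X i \<in> UNIV - {z0}" "X \<longlonglongrightarrow> z0"
    have ev: "\<forall>\<^sub>F i in sequentially. \<bar>X i - z0\<bar> < e"
      using X(2) e by (auto simp: tendsto_iff dist_real_def)
    then obtain i0 where i0: "\<And>i. i0 \<le> i \<Longrightarrow> \<bar>X i - z0\<bar> < e"
      by (auto simp: eventually_sequentially)
    \<comment> \<open>Dropping an initial segment puts every term into the interval where the bound
      by \<open>w\<close> is available.\<close>
    define Y where "Y i = X (i + i0)" for i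
    have Y: "\<bar>Y i - z0\<bar> < e" "Y i \<noteq> z0" for i using i0 X(1) by (auto simp: Y_def)
    have Yl: "Y \<longlonglongrightarrow> z0" unfolding Y_def using X(2) by (rule LIMSEQ_ignore_initial_segment)
    have "(\<lambda>i. LINT y|Q. (g (Y i) y - g z0 y) / (Y i - z0)) \<longlonglongrightarrow> (LINT y|Q. g' z0 y)"
    proof (rule integral_dominated_convergence[OF meas _ w])
      show "(\<lambda>y. (g (Y i) y - g z0 y) / (Y i - z0)) \<in> borel_measurable Q" for i
        using borel_measurable_integrable[OF int[OF Y(1)[of i]]] borel_measurable_integrable[OF int[of z0]] e
        by (intro borel_measurable_divide borel_measurable_diff) auto
      show "AE y in Q. (\<lambda>i. (g (Y i) y - g z0 y) / (Y i - z0)) \<longlonglongrightarrow> g' z0 y"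
        using der
      proof eventually_elim
        case (elim y)
        then have "((\<lambda>z. (g z y - g z0 y) / (z - z0)) \<longlongrightarrow> g' z0 y) (at z0)"
          using e by (auto simp: has_field_derivative_iff)
        then show ?case
          using Y Yl by (auto simp: tendsto_at_iff_sequentially comp_def)
      qed
      show "AE y in Q. norm ((g (Y i) y - g z0 y) / (Y i - z0)) \<le> w y" for i
        using der
      proof eventually_elim
        case (elim y)
        have seg: "\<bar>z - z0\<bar> < e" if "z \<in> closed_segment z0 (Y i)" for z
          using that Y(1)[of i] by (auto simp: closed_segment_eq_real_ivl split: if_splits)
        have "norm (g (Y i) y - g z0 y) \<le> w y * norm (Y i - z0)"
          by (rule field_differentiable_bound[of "closed_segment z0 (Y i)" "\<lambda>z. g z y" "\<lambda>z. g' z y"])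
             (use elim seg in \<open>auto intro: DERIV_subset\<close>)
        then show ?case using Y(2)[of i] by (simp add: field_simps)
      qed
    qed
    also have "(\<lambda>i. LINT y|Q. (g (Y i) y - g z0 y) / (Y i - z0)) = (\<lambda>i. ((LINT y|Q. g (Y i) y) - (LINT y|Q. g z0 y)) / (Y i - z0))"
      using int Y e by (intro ext) (simp add: Bochner_Integration.integral_diff)
    finally show "(\<lambda>i. ((LINT y|Q. g (X i) y) - (LINT y|Q. g z0 y)) / (X i - z0)) \<longlonglongrightarrow> (LINT y|Q. g' z0 y)"
      unfolding Y_def by (rule LIMSEQ_offset)
  qed
  then show ?thesis by (simp add: has_field_derivative_iff)
qed

section \<open>Absolute continuity of the Levy measure\<close>

lemma abs_cont_on_intervalE:
  assumes "abs_cont_on_interval c d g" "0 < \<epsilon>"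
  obtains \<delta> where "0 < \<delta>"
    "\<And>n (x :: nat \<Rightarrow> real) y. (\<forall>i<n. c \<le> x i \<and> x i \<le> y i \<and> y i \<le> d) \<Longrightarrow>
        (\<forall>i<n. \<forall>j<n. i \<noteq> j \<longrightarrow> {x i<..<y i} \<inter> {x j<..<y j} = {}) \<Longrightarrow>
        (\<Sum>i<n. y i - x i) < \<delta> \<Longrightarrow> (\<Sum>i<n. \<bar>g (y i) - g (x i)\<bar>) < \<epsilon>"
proof -
  from assms(1)[unfolded abs_cont_on_interval_def, THEN spec, THEN mp, OF assms(2)]
  obtain \<delta> where d: "0 < \<delta>" and *: "\<forall>n (x :: nat \<Rightarrow> real) y.
        (\<forall>i<n. c \<le> x i \<and> x i \<le> y i \<and> y i \<le> d) \<and>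
        (\<forall>i<n. \<forall>j<n. i \<noteq> j \<longrightarrow> {x i<..<y i} \<inter> {x j<..<y j} = {}) \<and>
        (\<Sum>i<n. y i - x i) < \<delta>
        \<longrightarrow> (\<Sum>i<n. \<bar>g (y i) - g (x i)\<bar>) < \<epsilon>"
    by (elim exE conjE) (rule that)
  show thesis
  proof (rule that[OF d])
    fix n and x y :: "nat \<Rightarrow> real"
    assume "\<forall>i<n. c \<le> x i \<and> x i \<le> y i \<and> y i \<le> d"
      "\<forall>i<n. \<forall>j<n. i \<noteq> j \<longrightarrow> {x i<..<y i} \<inter> {x j<..<y j} = {}" "(\<Sum>i<n. y i - x i) < \<delta>"
    then show "(\<Sum>i<n. \<bar>g (y i) - g (x i)\<bar>) < \<epsilon>"
      by (intro *[THEN spec[of _ n], THEN spec[of _ x], THEN spec[of _ y], THEN mp] conjI)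
  qed
qed

lemma emeasure_Ioc_tail:
  fixes N :: "real measure"
  assumes N: "sets N = sets borel" and fin: "emeasure N {u<..} < \<infinity>" and uv: "u \<le> v"
  shows "emeasure N {u<..v} = ennreal (levy_tail a N u - levy_tail a N v)"
proof -
  have eq: "{u<..v} = {u<..} - {v<..}" by auto
  have "emeasure N {v<..} \<le> emeasure N {u<..}"
    using uv by (intro emeasure_mono) (auto simp: N)
  then have "emeasure N {v<..} < \<infinity>" using fin by (rule le_less_trans)
  moreover have "measure N {u<..v} = measure N {u<..} - measure N {v<..}"
    unfolding eq using fin uv N by (intro measure_Diff) auto
  moreover have "emeasure N {u<..v} \<le> emeasure N {u<..}"
    using uv by (intro emeasure_mono) (auto simp: N)
  then have "emeasure N {u<..v} < \<infinity>" using fin by (rule le_less_trans)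
  ultimately show ?thesis
    by (simp add: levy_tail_def emeasure_eq_ennreal_measure)
qed

text \<open>Inside a compact interval, a Lebesgue null set is covered by countably many
  non-overlapping intervals of small total length. For finitely many of them the sum of the drops of
  the tail, which is their \<open>N\<close>-measure, is small by absolute continuity, and continuity
  from below passes to the whole cover.\<close>

lemma absolutely_continuous_tail:
  fixes N :: "real measure"
  assumes N: "sets N = sets borel" and N0: "emeasure N {..0} = 0"
    and fin: "\<And>s. 0 < s \<Longrightarrow> emeasure N {s<..} < \<infinity>"
    and ac: "\<And>c d. 0 < c \<Longrightarrow> c \<le> d \<Longrightarrow> abs_cont_on_interval c d (levy_tail a N)"
  shows "absolutely_continuous lborel N"
proof -
  note [measurable_cong] = N
  have Ioc: "emeasure N {u<..v} = ennreal (levy_tail a N u - levy_tail a N v)" if "0 < u" "u \<le> v" for u v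
    using emeasure_Ioc_tail[OF N fin[OF that(1)] that(2)] .
  \<comment> \<open>The drop of the tail measures half-open intervals whereas the cover consists of
    closed ones; \<open>null\<close> disposes of the left end points.\<close>
  have small: "emeasure N (\<Union>F) \<le> ennreal \<epsilon>"
    if cd: "0 < c" "c \<le> d" and eps: "0 < \<epsilon>" and del: "0 < \<delta>"
      and F: "finite F" "\<And>K. K \<in> F \<Longrightarrow> K \<subseteq> {c..d} \<and> K \<noteq> {} \<and> (\<exists>u v. K = {u..v})"
        "pairwise (\<lambda>A B. interior A \<inter> interior B = {}) F"
      and m: "(\<Sum>K\<in>F. measure lborel (interior K)) < \<delta>"
      and null: "\<And>u. c \<le> u \<Longrightarrow> emeasure N {u} = 0"
      and H: "\<And>n (x :: nat \<Rightarrow> real) y.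
        (\<forall>i<n. c \<le> x i \<and> x i \<le> y i \<and> y i \<le> d) \<Longrightarrow>
        (\<forall>i<n. \<forall>j<n. i \<noteq> j \<longrightarrow> {x i<..<y i} \<inter> {x j<..<y j} = {}) \<Longrightarrow>
        (\<Sum>i<n. y i - x i) < \<delta>
        \<Longrightarrow> (\<Sum>i<n. \<bar>levy_tail a N (y i) - levy_tail a N (x i)\<bar>) < \<epsilon>"
    for c d \<epsilon> \<delta> F
  proof -
    obtain D where D: "bij_betw D {..<card F} F"
      using ex_bij_betw_nat_finite[OF F(1)] by (auto simp: atLeast0LessThan)
    have DF: "D i \<in> F" if "i < card F" for i using D that by (auto simp: bij_betw_def)
    have "\<forall>K\<in>F. \<exists>u v. K = {u..v} \<and> c \<le> u \<and> u \<le> v \<and> v \<le> d"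
    proof
      fix K assume "K \<in> F"
      with F(2) obtain u v where "K = {u..v}" "K \<noteq> {}" "K \<subseteq> {c..d}" by blast
      then show "\<exists>u v. K = {u..v} \<and> c \<le> u \<and> u \<le> v \<and> v \<le> d"
        by (intro exI[of _ u] exI[of _ v]) auto
    qed
    then obtain x y where xyle: "\<forall>K\<in>F. K = {x K..y K} \<and> c \<le> x K \<and> x K \<le> y K \<and> y K \<le> d"
      by (auto dest!: bchoice)
    have xy: "K = {x K..y K}" and le: "c \<le> x K" "x K \<le> y K" "y K \<le> d" if "K \<in> F" for K
      using bspec[OF xyle that] by blast+
    have int: "interior K = {x K<..<y K}" if "K \<in> F" for K
      by (subst xy[OF that]) (rule interior_atLeastAtMost_real)
    have "(\<Sum>i<card F. \<bar>levy_tail a N (y (D i)) - levy_tail a N (x (D i))\<bar>) < \<epsilon>"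
    proof (rule H)
      have "(\<Sum>i<card F. y (D i) - x (D i)) = (\<Sum>K\<in>F. y K - x K)"
        by (rule sum.reindex_bij_betw[OF D])
      also have "\<dots> = (\<Sum>K\<in>F. measure lborel (interior K))"
        using int le by (intro sum.cong) auto
      finally show "(\<Sum>i<card F. y (D i) - x (D i)) < \<delta>" using m by simp
      show "\<forall>i<card F. \<forall>j<card F. i \<noteq> j \<longrightarrow> {x (D i)<..<y (D i)} \<inter> {x (D j)<..<y (D j)} = {}"
      proof (intro allI impI)
        fix i j assume ij: "i < card F" "j < card F" "i \<noteq> j"
        then have "D i \<noteq> D j" using D by (auto simp: bij_betw_def inj_on_def)
        then show "{x (D i)<..<y (D i)} \<inter> {x (D j)<..<y (D j)} = {}"
          using F(3) DF ij int unfolding pairwise_def by metis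
      qed
    qed (use le DF in auto)
    also have "(\<Sum>i<card F. \<bar>levy_tail a N (y (D i)) - levy_tail a N (x (D i))\<bar>) = (\<Sum>K\<in>F. \<bar>levy_tail a N (y K) - levy_tail a N (x K)\<bar>)"
      by (rule sum.reindex_bij_betw[OF D])
    finally have s: "(\<Sum>K\<in>F. \<bar>levy_tail a N (y K) - levy_tail a N (x K)\<bar>) < \<epsilon>" .
    have "emeasure N (\<Union>F) \<le> (\<Sum>K\<in>F. emeasure N K)"
    proof -
      have "(\<lambda>K. K) ` F \<subseteq> sets N"
      proof
        fix K assume "K \<in> (\<lambda>K. K) ` F"
        with F(2) obtain u v where "K = {u..v}" by blast
        then show "K \<in> sets N" by (simp add: N)
      qed
      from emeasure_subadditive_finite[OF F(1) this] show ?thesis by simp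
    qed
    also have "\<dots> \<le> (\<Sum>K\<in>F. ennreal \<bar>levy_tail a N (y K) - levy_tail a N (x K)\<bar>)"
    proof (rule sum_mono)
      fix K assume K: "K \<in> F"
      have "emeasure N K = emeasure N ({x K} \<union> {x K<..y K})"
        using le(2)[OF K] by (subst (1) xy[OF K], intro arg_cong[of _ _ "emeasure N"]) auto
      also have "\<dots> \<le> emeasure N {x K} + emeasure N {x K<..y K}"
        by (intro emeasure_subadditive) (auto simp: N)
      also have "\<dots> = ennreal (levy_tail a N (x K) - levy_tail a N (y K))"
        using null[OF le(1)[OF K]] Ioc[of "x K" "y K"] le[OF K] cd by simp
      also have "\<dots> \<le> ennreal \<bar>levy_tail a N (y K) - levy_tail a N (x K)\<bar>"
        by (intro ennreal_leI) auto
      finally show "emeasure N K \<le> \<dots>" .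
    qed
    also have "\<dots> = ennreal (\<Sum>K\<in>F. \<bar>levy_tail a N (y K) - levy_tail a N (x K)\<bar>)"
      by (rule sum_ennreal) auto
    also have "\<dots> \<le> ennreal \<epsilon>" using s by (intro ennreal_leI) auto
    finally show ?thesis .
  qed
  \<comment> \<open>A point is contained in half-open intervals of arbitrarily small length, so
    absolute continuity with a single interval already excludes atoms.\<close>
  have pt: "emeasure N {u} = 0" if u: "0 < u" for u
  proof -
    have "emeasure N {u} \<le> 0 + ennreal \<epsilon>" if eps: "0 < \<epsilon>" for \<epsilon>
    proof -
      have "abs_cont_on_interval (u / 2) u (levy_tail a N)" using ac[of "u/2" u] u by auto
      from this eps obtain \<delta> where d: "0 < \<delta>"
        and *: "\<And>n (x :: nat \<Rightarrow> real) y. (\<forall>i<n. u / 2 \<le> x i \<and> x i \<le> y i \<and> y i \<le> u) \<Longrightarrow>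
        (\<forall>i<n. \<forall>j<n. i \<noteq> j \<longrightarrow> {x i<..<y i} \<inter> {x j<..<y j} = {}) \<Longrightarrow>
        (\<Sum>i<n. y i - x i) < \<delta>
        \<Longrightarrow> (\<Sum>i<n. \<bar>levy_tail a N (y i) - levy_tail a N (x i)\<bar>) < \<epsilon>"
        by (rule abs_cont_on_intervalE) blast
      \<comment> \<open>\<open>u / 2\<close> keeps \<open>v\<close> in the interval for which
        \<open>\<delta>\<close> was chosen, and \<open>\<delta> / 2\<close> makes the length
        strictly smaller than \<open>\<delta>\<close>.\<close>
      define v where "v = max (u / 2) (u - \<delta> / 2)"
      have v: "0 < v" "v < u" using u d by (auto simp: v_def)
      have "\<bar>levy_tail a N u - levy_tail a N v\<bar> < \<epsilon>"
      proof -
        have "(\<Sum>i<1::nat. \<bar>levy_tail a N u - levy_tail a N v\<bar>) < \<epsilon>"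
          by (rule *[of 1 "\<lambda>_. v" "\<lambda>_. u"]) (use u d v in \<open>auto simp: v_def\<close>)
        then show ?thesis by simp
      qed
      then have "levy_tail a N v - levy_tail a N u \<le> \<epsilon>" by auto
      moreover have "emeasure N {u} \<le> emeasure N {v<..u}"
        using v by (intro emeasure_mono) (auto simp: N)
      ultimately show ?thesis using Ioc[of v u] v by (auto intro: order_trans ennreal_leI)
    qed
    then have "emeasure N {u} \<le> 0" by (rule ennreal_le_epsilon) auto
    then show ?thesis by simp
  qed
  have loc: "emeasure N (B \<inter> {c..d}) = 0" if B: "B \<in> null_sets lborel" and cd: "0 < c" "c \<le> d" for B c d
  proof -
    have [measurable]: "B \<in> sets borel" using null_setsD2[OF B] by simp
    have "emeasure N (B \<inter> {c..d}) \<le> 0 + ennreal \<epsilon>" if eps: "0 < \<epsilon>" for \<epsilon>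
    proof -
      from ac[OF cd] eps obtain \<delta> where d: "0 < \<delta>"
        and *: "\<And>n (x :: nat \<Rightarrow> real) y. (\<forall>i<n. c \<le> x i \<and> x i \<le> y i \<and> y i \<le> d) \<Longrightarrow>
        (\<forall>i<n. \<forall>j<n. i \<noteq> j \<longrightarrow> {x i<..<y i} \<inter> {x j<..<y j} = {}) \<Longrightarrow>
        (\<Sum>i<n. y i - x i) < \<delta>
        \<Longrightarrow> (\<Sum>i<n. \<bar>levy_tail a N (y i) - levy_tail a N (x i)\<bar>) < \<epsilon>"
        by (rule abs_cont_on_intervalE) blast
      have S0: "B \<inter> {c..d} \<in> null_sets lebesgue"
        by (rule null_sets_completionI, rule null_set_Int2[OF B]) simp
      have S: "B \<inter> {c..d} \<in> lmeasurable" "measure lebesgue (B \<inter> {c..d}) = 0"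
        using S0 by (auto simp: fmeasurable_def measure_eq_0_null_sets)
      \<comment> \<open>The covering intervals have to stay inside \<open>{c..d}\<close>, since
        \<open>\<delta>\<close> controls increments of the tail only there; half of
        \<open>\<delta>\<close> leaves room for the strict inequality.\<close>
      obtain \<D> where D: "countable \<D>"
        "\<And>K. K \<in> \<D> \<Longrightarrow> K \<subseteq> cbox c d \<and> K \<noteq> {} \<and> (\<exists>u v. K = cbox u v)"
        "pairwise (\<lambda>A B. interior A \<inter> interior B = {}) \<D>"
        "B \<inter> {c..d} \<subseteq> \<Union>\<D>" "\<Union>\<D> \<in> lmeasurable" "measure lebesgue (\<Union>\<D>) \<le> measure lebesgue (B \<inter> {c..d}) + \<delta> / 2"
      proof (rule measurable_outer_intervals_bounded[OF S(1), of c d "\<delta> / 2"])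
        show "B \<inter> {c..d} \<subseteq> cbox c d" "0 < \<delta> / 2" using d by auto
      next
        fix \<D> :: "real set set"
        assume "countable \<D>"
          "\<And>K. K \<in> \<D> \<Longrightarrow> K \<subseteq> cbox c d \<and> K \<noteq> {} \<and> (\<exists>u v. K = cbox u v)"
          "pairwise (\<lambda>A B. interior A \<inter> interior B = {}) \<D>"
          "B \<inter> {c..d} \<subseteq> \<Union>\<D>" "\<Union>\<D> \<in> lmeasurable" "measure lebesgue (\<Union>\<D>) \<le> measure lebesgue (B \<inter> {c..d}) + \<delta> / 2"
        then show thesis by (rule that)
      qed
      have fin_bd: "emeasure N (\<Union>F) \<le> ennreal \<epsilon>" if F: "finite F" "F \<subseteq> \<D>" for F
      proof (rule small[OF cd eps d F(1)])
        have dis: "disjoint_family_on interior F"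
          using D(3) F(2) by (auto simp: disjoint_family_on_def pairwise_def)
        have fm: "interior K \<in> fmeasurable lborel" if "K \<in> F" for K
        proof -
          have "bounded (interior K)"
            using D(2)[of K] that F(2) by (meson bounded_cbox bounded_subset interior_subset subset_eq)
          then show ?thesis
            using emeasure_bounded_finite by (auto simp: fmeasurable_def)
        qed
        have "(\<Sum>K\<in>F. measure lborel (interior K)) = measure lborel (\<Union>K\<in>F. interior K)"
          using fm by (intro measure_finite_Union[symmetric] F dis) (auto simp: fmeasurable_def less_top)
        also have "\<dots> = measure lebesgue (\<Union>K\<in>F. interior K)"
          using F(1) by (intro measure_completion[symmetric]) auto
        also have "\<dots> \<le> measure lebesgue (\<Union>\<D>)"
        proof (rule measure_mono_fmeasurable[OF _ _ D(5)])
          show "(\<Union>K\<in>F. interior K) \<subseteq> \<Union>\<D>" using F(2) interior_subset by blast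
          have "(\<Union>K\<in>F. interior K) \<in> sets borel" by (intro borel_open open_UN) auto
          then show "(\<Union>K\<in>F. interior K) \<in> sets lebesgue" by auto
        qed
        also have "\<dots> < \<delta>" using D(6) S(2) d by auto
        finally show "(\<Sum>K\<in>F. measure lborel (interior K)) < \<delta>" .
        show "pairwise (\<lambda>A B. interior A \<inter> interior B = {}) F"
          using D(3) F(2) by (rule pairwise_subset)
        show "K \<subseteq> {c..d} \<and> K \<noteq> {} \<and> (\<exists>u v. K = {u..v})" if "K \<in> F" for K
          using D(2)[of K] that F(2) by (auto simp: subset_eq)
        show "emeasure N {u} = 0" if "c \<le> u" for u using pt[of u] that cd by auto
      qed (fact *)
      have "emeasure N (\<Union>\<D>) \<le> ennreal \<epsilon>"
      proof (cases "\<D> = {}")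
        case False
        \<comment> \<open>Partial unions of an enumeration. If \<open>\<D>\<close> is finite the
          enumeration repeats, but the unions are still increasing and finite.\<close>
        define D' where "D' n = \<Union>(from_nat_into \<D> ` {..n})" for n
        have m: "K \<in> sets N" if "K \<in> \<D>" for K using D(2)[OF that] by (auto simp: N)
        have "\<Union>\<D> = (\<Union>n. D' n)"
        proof -
          have "\<Union>(range f) = (\<Union>n::nat. \<Union>(f ` {..n}))" for f :: "nat \<Rightarrow> real set" by blast
          from this[of "from_nat_into \<D>"] show ?thesis
            unfolding D'_def range_from_nat_into[OF False D(1)] .
        qed
        moreover have "emeasure N (\<Union>n. D' n) = (SUP n. emeasure N (D' n))"
        proof (rule SUP_emeasure_incseq[symmetric])
          show "range D' \<subseteq> sets N"
            unfolding D'_def using m from_nat_into[OF False] by (auto intro!: sets.finite_UN)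
          show "incseq D'" unfolding D'_def by (intro monoI Union_mono image_mono) auto
        qed
        moreover have "emeasure N (D' n) \<le> ennreal \<epsilon>" for n
          unfolding D'_def using from_nat_into[OF False] by (intro fin_bd) auto
        ultimately show ?thesis by (auto intro!: SUP_least)
      qed auto
      moreover have "emeasure N (B \<inter> {c..d}) \<le> emeasure N (\<Union>\<D>)"
      proof (rule emeasure_mono[OF D(4)])
        show "\<Union>\<D> \<in> sets N"
        proof (intro sets.countable_Union D(1) subsetI)
          fix K assume "K \<in> \<D>"
          with D(2) obtain u v where "K = cbox u v" by blast
          then show "K \<in> sets N" by (simp add: N)
        qed
      qed
      ultimately show ?thesis by (auto intro: order_trans)
    qed
    then have "emeasure N (B \<inter> {c..d}) \<le> 0" by (rule ennreal_le_epsilon) auto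
    then show ?thesis by simp
  qed
  show ?thesis
    unfolding absolutely_continuous_def
  proof
    fix B :: "real set" assume B: "B \<in> null_sets lborel"
    then have [measurable]: "B \<in> sets borel" by auto
    have "B \<subseteq> {..0} \<union> (\<Union>n::nat. B \<inter> {1 / (real n + 1)..real n + 1})"
    proof
      fix x assume x: "x \<in> B"
      show "x \<in> {..0} \<union> (\<Union>n::nat. B \<inter> {1 / (real n + 1)..real n + 1})"
      proof (cases "x \<le> 0")
        case False
        obtain n where n: "max x (1 / x) \<le> real n" using real_arch_simple by blast
        then have "x \<le> real n + 1" "1 / x \<le> real n + 1" by auto
        moreover from this(2) have "1 / (real n + 1) \<le> x" using False by (simp add: field_simps)
        ultimately show ?thesis using x by auto
      qed simp
    qed
    moreover have "{..0} \<union> (\<Union>n::nat. B \<inter> {1 / (real n + 1)..real n + 1}) \<in> null_sets N"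
    proof (intro null_sets.Un null_sets_UN)
      show "{..0} \<in> null_sets N" using N0 by (auto simp: N)
      fix n :: nat
      have "1 / (real n + 1) \<le> real n + 1" by (simp add: field_simps)
      then show "B \<inter> {1 / (real n + 1)..real n + 1} \<in> null_sets N"
        using loc[OF B, of "1 / (real n + 1)" "real n + 1"] by (auto simp: N)
    qed
    ultimately show "B \<in> null_sets N"
      by (rule null_sets_subset[rotated 2]) (auto simp: N)
  qed
qed

section \<open>The Levy triple\<close>

lemma nn_integral_exp_Ioi:
  fixes z x :: real
  assumes z: "0 < z"
  shows "(\<integral>\<^sup>+s. ennreal (exp (- z * s)) * indicator {x<..} s \<partial>lborel) = ennreal (exp (- z * x) / z)"
proof -
  have "(\<integral>\<^sup>+s. ennreal (exp (- z * s)) * indicator {x<..} s \<partial>lborel) = (\<integral>\<^sup>+s. ennreal (exp (- z * s)) * indicator {x..} s \<partial>lborel)"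
    using AE_lborel_singleton[of x] by (intro nn_integral_cong_AE) (auto split: split_indicator)
  also have "\<dots> = ennreal (0 - (- exp (- z * x) / z))"
  proof (rule nn_integral_FTC_atLeast)
    show "((\<lambda>s. - exp (- z * s) / z) has_real_derivative exp (- z * s)) (at s)" for s
      using z by (auto intro!: derivative_eq_intros)
    show "((\<lambda>s. - exp (- z * s) / z) \<longlongrightarrow> 0) at_top"
    proof -
      from tendsto_divide[OF tendsto_minus[OF exp_neg_tendsto_0[OF z]] tendsto_const[of z]] z show ?thesis by simp
    qed
  qed auto
  finally show ?thesis by simp
qed

lemma nn_integral_exp_Ioo:
  fixes z x :: real
  assumes z: "0 < z" and x: "0 \<le> x"
  shows "(\<integral>\<^sup>+s. ennreal (exp (- z * s)) * indicator {0<..<x} s \<partial>lborel) = ennreal ((1 - exp (- z * x)) / z)"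
proof -
  have "(\<integral>\<^sup>+s. ennreal (exp (- z * s)) * indicator {0<..<x} s \<partial>lborel) = (\<integral>\<^sup>+s. ennreal (exp (- z * s)) * indicator {0..x} s \<partial>lborel)"
  proof (rule nn_integral_cong_AE)
    show "AE s in lborel. ennreal (exp (- z * s)) * indicator {0<..<x} s = ennreal (exp (- z * s)) * indicator {0..x} s"
      using AE_lborel_singleton[of x] AE_lborel_singleton[of 0]
      by eventually_elim (auto split: split_indicator)
  qed
  also have "\<dots> = ennreal (- exp (- z * x) / z - (- exp (- z * 0) / z))"
  proof (rule nn_integral_FTC_Icc)
    show "((\<lambda>s. - exp (- z * s) / z) has_real_derivative exp (- z * s)) (at s within S)" for s S
      using z by (auto intro!: derivative_eq_intros)
  qed (use x in auto)
  finally show ?thesis by (simp add: diff_divide_distrib)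
qed

lemma nn_integral_conv_commute:
  fixes g h :: "real \<Rightarrow> ennreal"
  assumes [measurable]: "g \<in> borel_measurable borel" "h \<in> borel_measurable borel"
  shows "(\<integral>\<^sup>+s. g s * h (x - s) \<partial>lborel) = (\<integral>\<^sup>+y. g (x - y) * h y \<partial>lborel)"
  using nn_integral_real_affine[of "\<lambda>s. g s * h (x - s)" "-1" x] by simp

text \<open>Tonelli and a translation. One factor is a measure rather than a function because this
  is applied to the law of the subordinator before that law is known to have a density.\<close>

lemma nn_integral_conv_exp:
  fixes g :: "real \<Rightarrow> ennreal" and Q :: "real measure"
  assumes [measurable]: "g \<in> borel_measurable borel" and Q [measurable_cong]: "sets Q = sets borel"
    and sf: "sigma_finite_measure Q"
  shows "(\<integral>\<^sup>+x. ennreal (exp (- z * x)) * (\<integral>\<^sup>+y. g (x - y) \<partial>Q) \<partial>lborel) =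
    (\<integral>\<^sup>+s. ennreal (exp (- z * s)) * g s \<partial>lborel) * (\<integral>\<^sup>+y. ennreal (exp (- z * y)) \<partial>Q)"
proof -
  interpret Q: sigma_finite_measure Q by fact
  interpret pair_sigma_finite lborel Q by standard
  have "(\<integral>\<^sup>+x. ennreal (exp (- z * x)) * (\<integral>\<^sup>+y. g (x - y) \<partial>Q) \<partial>lborel) =
    (\<integral>\<^sup>+x. \<integral>\<^sup>+y. ennreal (exp (- z * x)) * g (x - y) \<partial>Q \<partial>lborel)"
    by (intro nn_integral_cong nn_integral_cmult[symmetric]) measurable
  also have "\<dots> = (\<integral>\<^sup>+y. \<integral>\<^sup>+x. ennreal (exp (- z * x)) * g (x - y) \<partial>lborel \<partial>Q)"
    by (rule Fubini'[symmetric]) measurable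
  also have "\<dots> = (\<integral>\<^sup>+y. (\<integral>\<^sup>+s. ennreal (exp (- z * s)) * g s \<partial>lborel) * ennreal (exp (- z * y)) \<partial>Q)"
  proof (intro nn_integral_cong)
    fix y
    have "(\<integral>\<^sup>+x. ennreal (exp (- z * x)) * g (x - y) \<partial>lborel) = (\<integral>\<^sup>+x. ennreal (exp (- z * (y + x))) * g x \<partial>lborel)"
      using nn_integral_real_affine[of "\<lambda>x. ennreal (exp (- z * x)) * g (x - y)" 1 y] by simp
    also have "\<dots> = (\<integral>\<^sup>+x. ennreal (exp (- z * y)) * (ennreal (exp (- z * x)) * g x) \<partial>lborel)"
      by (intro nn_integral_cong) (simp only: distrib_left exp_add ennreal_mult exp_ge_zero mult.assoc)
    also have "\<dots> = (\<integral>\<^sup>+x. ennreal (exp (- z * x)) * g x \<partial>lborel) * ennreal (exp (- z * y))"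
      by (subst nn_integral_cmult) (auto simp: mult.commute)
    finally show "(\<integral>\<^sup>+x. ennreal (exp (- z * x)) * g (x - y) \<partial>lborel) = \<dots>" .
  qed
  also have "\<dots> = (\<integral>\<^sup>+s. ennreal (exp (- z * s)) * g s \<partial>lborel) * (\<integral>\<^sup>+y. ennreal (exp (- z * y)) \<partial>Q)"
    by (rule nn_integral_cmult) measurable
  finally show ?thesis .
qed

section \<open>The Bernstein function, its derivative and the tail\<close>

locale levy =
  fixes a b :: real and N :: "real measure"
  assumes triple: "levy_triple a b N" and infinite: "emeasure N {0<..} = \<infinity>"
    and abs_cont: "\<And>c d. 0 < c \<Longrightarrow> c \<le> d \<Longrightarrow> abs_cont_on_interval c d (levy_tail a N)"
begin

abbreviation f :: "real \<Rightarrow> real" where "f \<equiv> bernstein a b N"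
abbreviation \<nu> :: "real \<Rightarrow> real" where "\<nu> \<equiv> levy_tail a N"

definition f' :: "real \<Rightarrow> real" where "f' z = b + (LINT s|N. s * exp (- z * s))"
text \<open>\<open>tail_ext\<close> is \<open>\<nu>\<close> extended by \<open>0\<close>, and \<open>sb_levy\<close> is a density of \<open>s N(ds)\<close>.\<close>

definition tail_ext :: "real \<Rightarrow> ennreal" where "tail_ext s = (if 0 < s then ennreal (\<nu> s) else 0)"
definition sb_levy :: "real \<Rightarrow> ennreal" where "sb_levy s = ennreal s * RN_deriv lborel N s"

lemma a_nonneg: "0 \<le> a" and b_nonneg: "0 \<le> b" and sets_N [measurable_cong, simp]: "sets N = sets borel"
  and N_Iic: "emeasure N {..0} = 0" and nn_integral_min: "(\<integral>\<^sup>+z. ennreal (min z 1) \<partial>N) < \<infinity>"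
  using triple by (auto simp: levy_triple_def)

lemma space_N [simp]: "space N = UNIV"
  using sets_eq_imp_space_eq[OF sets_N] by simp

lemma AE_N_pos: "AE s in N. 0 < s"
proof (rule AE_I)
  show "{s \<in> space N. \<not> 0 < s} \<subseteq> {..0}" by auto
qed (use N_Iic in auto)

lemma integrable_min: "integrable N (\<lambda>s. min s 1)"
  by (rule integrableI_nonneg) (use nn_integral_min AE_N_pos in auto)

lemma N_tail_finite: assumes s: "0 < s" shows "emeasure N {s<..} < \<infinity>"
proof -
  have "ennreal (min s 1) * emeasure N {s<..} = (\<integral>\<^sup>+z. ennreal (min s 1) * indicator {s<..} z \<partial>N)"
    by (simp add: nn_integral_cmult_indicator)
  also have "\<dots> \<le> (\<integral>\<^sup>+z. ennreal (min z 1) \<partial>N)"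
    by (intro nn_integral_mono) (auto intro: ennreal_leI split: split_indicator)
  also note nn_integral_min
  finally show ?thesis using s by (auto simp: ennreal_mult_less_top)
qed

sublocale sigma_finite_measure N
proof
  have "{..0} \<union> (\<Union>n::nat. {1 / (real n + 1)<..}) = UNIV"
  proof (intro set_eqI iffI UNIV_I)
    fix x :: real
    show "x \<in> {..0} \<union> (\<Union>n::nat. {1 / (real n + 1)<..})"
    proof (cases "x \<le> 0")
      case False
      obtain n where n: "1 / x \<le> real n" using real_arch_simple by blast
      then have "1 / x < real n + 1" by simp
      then have "1 / (real n + 1) < x" using False by (simp add: field_simps)
      then show ?thesis by auto
    qed simp
  qed
  then show "\<exists>A. countable A \<and> A \<subseteq> sets N \<and> \<Union> A = space N \<and> (\<forall>a\<in>A. emeasure N a \<noteq> \<infinity>)"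
    using N_Iic N_tail_finite
    by (intro exI[of _ "insert {..0} (range (\<lambda>n::nat. {1 / (real n + 1)<..}))"]) (auto simp: less_top[symmetric])
qed

lemma absolutely_continuous_N: "absolutely_continuous lborel N"
  by (rule absolutely_continuous_tail[OF sets_N N_Iic N_tail_finite abs_cont])

lemma density_N: "density lborel (RN_deriv lborel N) = N"
  by (rule sigma_finite_measure.density_RN_deriv[OF sigma_finite_lborel]) (simp_all add: absolutely_continuous_N)

text \<open>The absence of atoms gives continuity of the tail and lets later limits ignore the
  single point \<open>s = t\<close>.\<close>

lemma AE_N_neq: "AE s in N. s \<noteq> c"
proof (rule AE_I)
  show "{s \<in> space N. \<not> s \<noteq> c} \<subseteq> {c}" by auto
  have "{c} \<in> null_sets lborel" by (auto simp: null_sets_def)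
  then have "{c} \<in> null_sets N" using absolutely_continuous_N by (auto simp: absolutely_continuous_def)
  then show "emeasure N {c} = 0" by auto
qed simp

lemma sb_levy_measurable [measurable]: "sb_levy \<in> borel_measurable borel"
  unfolding sb_levy_def by measurable

lemma sb_levy_nonpos: "s \<le> 0 \<Longrightarrow> sb_levy s = 0"
  by (simp add: sb_levy_def ennreal_neg)

lemma nn_integral_sb_levy:
  assumes [measurable]: "g \<in> borel_measurable borel"
  shows "(\<integral>\<^sup>+s. g s * sb_levy s \<partial>lborel) = (\<integral>\<^sup>+s. g s * ennreal s \<partial>N)"
proof -
  have "(\<integral>\<^sup>+s. g s * ennreal s \<partial>N) = (\<integral>\<^sup>+s. g s * ennreal s \<partial>density lborel (RN_deriv lborel N))"
    by (simp add: density_N)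
  also have "\<dots> = (\<integral>\<^sup>+s. RN_deriv lborel N s * (g s * ennreal s) \<partial>lborel)"
    by (rule nn_integral_density) measurable
  finally show ?thesis by (simp add: sb_levy_def mult_ac)
qed

text \<open>Reduces bounds by \<open>min s c\<close>, with \<open>c\<close> depending on z or on a
  time horizon, to the one integrability condition on \<open>min s 1\<close>.\<close>

lemma min_scale: "0 < s \<Longrightarrow> 0 < c \<Longrightarrow> min s c \<le> max 1 c * min s 1" for s c :: real
proof -
  assume s: "0 < s" "0 < c"
  show ?thesis
  proof (cases "s \<le> 1")
    case True
    then have "1 * s \<le> max 1 c * s" using s by (intro mult_right_mono) auto
    then show ?thesis using True by auto
  qed auto
qed

lemma integrable_one_minus_exp: assumes z: "0 < z" shows "integrable N (\<lambda>s. 1 - exp (- s * z))"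
proof (rule Bochner_Integration.integrable_bound[OF integrable_mult_right[OF integrable_min, of "z * max 1 (1/z)"]])
  show "AE s in N. norm (1 - exp (- s * z)) \<le> norm (z * max 1 (1/z) * min s 1)"
    using AE_N_pos
  proof eventually_elim
    case (elim s)
    have "norm (1 - exp (- s * z)) = 1 - exp (- s * z)" using elim z by simp
    also have "\<dots> \<le> z * min s (1/z)"
      using exp_ge_add_one_self[of "- s * z"] z by (auto simp: min_def field_simps)
    also have "\<dots> \<le> z * (max 1 (1/z) * min s 1)"
      using min_scale[of s "1/z"] elim z by (intro mult_left_mono) auto
    also have "\<dots> = z * max 1 (1/z) * min s 1" by simp
    finally show ?case unfolding real_norm_def by (rule order_trans[OF _ abs_ge_self])
  qed
qed simp

lemma integrable_times_exp: assumes z: "0 < z" shows "integrable N (\<lambda>s. s * exp (- z * s))"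
proof (rule Bochner_Integration.integrable_bound[OF integrable_mult_right[OF integrable_min, of "max 1 (1/z)"]])
  show "AE s in N. norm (s * exp (- z * s)) \<le> norm (max 1 (1/z) * min s 1)"
    using AE_N_pos
  proof eventually_elim
    case (elim s)
    have "z * s \<le> exp (z * s)" using exp_ge_add_one_self[of "z * s"] by linarith
    then have "s * exp (- z * s) \<le> 1 / z" using z by (simp add: exp_minus field_simps)
    moreover have "s * exp (- z * s) \<le> s * 1" using elim z by (intro mult_left_mono) auto
    ultimately have "norm (s * exp (- z * s)) \<le> min s (1/z)" using elim by auto
    also have "\<dots> \<le> max 1 (1/z) * min s 1"
      using min_scale[of s "1/z"] elim z by auto
    finally show ?case unfolding real_norm_def by (rule order_trans[OF _ abs_ge_self])
  qed
qed simp

lemma f_deriv: assumes z: "0 < z" shows "(f has_real_derivative f' z) (at z)"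
proof -
  have "((\<lambda>z. LINT s|N. 1 - exp (- s * z)) has_real_derivative (LINT s|N. s * exp (- s * z))) (at z)"
  \<comment> \<open>Within distance \<open>z / 2\<close> of \<open>z\<close> all parameters stay
    above \<open>z / 2\<close>, so the derivative of the integrand is dominated by its value at the
    parameter \<open>z / 2\<close>.\<close>
  proof (rule has_real_derivative_integral[where e="z/2" and w="\<lambda>s. s * exp (- (z/2) * s)"])
    show "integrable N (\<lambda>s. 1 - exp (- s * w))" if "\<bar>w - z\<bar> < z / 2" for w
      using that by (intro integrable_one_minus_exp) linarith
    show "AE s in N. \<forall>w. \<bar>w - z\<bar> < z / 2 \<longrightarrow>
        ((\<lambda>z. 1 - exp (- s * z)) has_real_derivative s * exp (- s * w)) (at w) \<and>
        \<bar>s * exp (- s * w)\<bar> \<le> s * exp (- (z / 2) * s)"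
      using AE_N_pos
    proof eventually_elim
      case (elim s)
      have "s * (z / 2) \<le> s * w" if "\<bar>w - z\<bar> < z / 2" for w
        using that elim by (intro mult_left_mono) linarith+
      with elim show ?case by (auto intro!: derivative_eq_intros simp: mult.commute)
    qed
    show "integrable N (\<lambda>s. s * exp (- (z / 2) * s))"
      using z by (intro integrable_times_exp) auto
  qed (use z in auto)
  then have "((\<lambda>z. a + b * z + (LINT s|N. 1 - exp (- s * z))) has_real_derivative f' z) (at z)"
    by (auto intro!: derivative_eq_intros simp: f'_def mult.commute)
  then show ?thesis by (simp add: bernstein_def[abs_def])
qed

lemma f_integral_nonneg: assumes z: "0 < z" shows "0 \<le> (LINT s|N. 1 - exp (- s * z))"
  by (rule integral_nonneg_AE) (use AE_N_pos z in auto)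

lemma nn_integral_one_minus_exp: assumes z: "0 < z"
  shows "(\<integral>\<^sup>+s. ennreal (1 - exp (- s * z)) \<partial>N) = ennreal (f z - a - b * z)"
proof -
  have "AE s in N. 0 \<le> 1 - exp (- s * z)"
    using AE_N_pos by eventually_elim (use z in simp)
  from nn_integral_eq_integral[OF integrable_one_minus_exp[OF z] this]
  show ?thesis by (simp add: bernstein_def)
qed

lemma f_ge: "0 < z \<Longrightarrow> b * z \<le> f z"
  using f_integral_nonneg[of z] a_nonneg by (simp add: bernstein_def)

lemma f_nonneg: "0 < z \<Longrightarrow> 0 \<le> f z"
  using f_ge[of z] b_nonneg by (meson mult_nonneg_nonneg less_imp_le order_trans)

lemma f'_ge: "0 < z \<Longrightarrow> b \<le> f' z"
  unfolding f'_def using AE_N_pos by (auto intro!: integral_nonneg_AE)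

text \<open>This is where the infinite mass is used. For \<open>z = n + 1\<close> the integrand
  \<open>1 - exp (- s * z)\<close> is at least 1/2 on \<open>s > 1 / (n + 1)\<close>, so
  \<open>f z - b * z\<close> is at least half the mass of that half-line. Hence the search for a
  mass above \<open>2 * \<bar>C\<bar>\<close>.\<close>

lemma f_unbounded: "\<exists>z>0. C \<le> f z - b * z"
proof -
  define A where "A n = {1 / (real n + 1)<..}" for n :: nat
  have "incseq A"
    by (auto simp: A_def incseq_def frac_le intro: le_less_trans[rotated])
  moreover have "(\<Union>n. A n) = {0<..}"
  proof (intro set_eqI iffI)
    fix x :: real assume x: "x \<in> {0<..}"
    obtain n where n: "1 / x \<le> real n" using real_arch_simple by blast
    then have "1 / x < real n + 1" by simp
    then have "1 / (real n + 1) < x" using x by (simp add: field_simps)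
    then show "x \<in> (\<Union>n. A n)" by (auto simp: A_def)
  qed (auto simp: A_def intro: less_trans[rotated])
  ultimately have S: "(SUP n. emeasure N (A n)) = \<infinity>"
    using infinite by (subst SUP_emeasure_incseq) (auto simp: A_def)
  have "ennreal (2 * \<bar>C\<bar>) < (SUP n. emeasure N (A n))"
    unfolding S infinity_ennreal_def by (rule ennreal_less_top)
  then obtain n where n: "ennreal (2 * \<bar>C\<bar>) < emeasure N (A n)" by (auto simp: less_SUP_iff)
  define z where "z = real n + 1"
  have z: "0 < z" by (simp add: z_def)
  have "ennreal \<bar>C\<bar> = ennreal (1/2 * (2 * \<bar>C\<bar>))" by simp
  also have "\<dots> = ennreal (1/2) * ennreal (2 * \<bar>C\<bar>)" by (rule ennreal_mult) auto
  also have "\<dots> \<le> ennreal (1/2) * emeasure N (A n)"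
    using n by (intro mult_left_mono) auto
  also have "\<dots> = (\<integral>\<^sup>+s. ennreal (1/2) * indicator (A n) s \<partial>N)"
    by (simp add: nn_integral_cmult_indicator A_def)
  also have "\<dots> \<le> (\<integral>\<^sup>+s. ennreal (1 - exp (- s * z)) \<partial>N)"
  proof (intro nn_integral_mono)
    fix s
    show "ennreal (1/2) * indicator (A n) s \<le> ennreal (1 - exp (- s * z))"
    proof (cases "s \<in> A n")
      case True
      then have "1 \<le> s * z" by (simp add: A_def z_def field_simps)
      moreover have "2 \<le> exp (1::real)" using exp_ge_add_one_self[of 1] by simp
      ultimately have "2 \<le> exp (s * z)" using exp_le_cancel_iff[of 1 "s * z"] by linarith
      then have "exp (- s * z) \<le> 1 / 2" by (simp add: exp_minus field_simps)
      then have "ennreal (1/2) \<le> ennreal (1 - exp (- s * z))" by (intro ennreal_leI) simp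
      then show ?thesis using True by (simp only: indicator_simps mult_1_right)
    qed simp
  qed
  also have "\<dots> = ennreal (f z - a - b * z)" by (rule nn_integral_one_minus_exp[OF z])
  finally have "\<bar>C\<bar> \<le> f z - a - b * z"
    using f_integral_nonneg[OF z] by (subst (asm) ennreal_le_iff) (auto simp: bernstein_def)
  then show ?thesis using z a_nonneg by (intro exI[of _ z]) auto
qed

lemma sb_levy_laplace: assumes z: "0 < z"
  shows "(\<integral>\<^sup>+s. ennreal (exp (- z * s)) * sb_levy s \<partial>lborel) = ennreal (f' z - b)"
proof -
  have "(\<integral>\<^sup>+s. ennreal (exp (- z * s)) * sb_levy s \<partial>lborel) = (\<integral>\<^sup>+s. ennreal (s * exp (- z * s)) \<partial>N)"
    by (subst nn_integral_sb_levy, measurable, intro nn_integral_cong)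
       (simp add: ennreal_mult''[symmetric] mult.commute)
  also have "\<dots> = ennreal (f' z - b)"
    unfolding f'_def using AE_N_pos
    by (subst nn_integral_eq_integral[OF integrable_times_exp[OF z]]) auto
  finally show ?thesis .
qed

lemma tail_ext_eq: "tail_ext s = (if 0 < s then ennreal a + emeasure N {s<..} else 0)"
proof (cases "0 < s")
  case True
  then have "emeasure N {s<..} = ennreal (measure N {s<..})"
    using N_tail_finite[of s] by (intro emeasure_eq_ennreal_measure) auto
  then show ?thesis using a_nonneg by (simp add: tail_ext_def levy_tail_def)
qed (simp add: tail_ext_def)

lemma tail_nonneg: "0 \<le> \<nu> s"
  using a_nonneg by (simp add: levy_tail_def)

lemma emeasure_Ioi_eq: "emeasure N {s<..} = (\<integral>\<^sup>+x. (if s < x then 1 else 0) \<partial>N)"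
proof -
  have "emeasure N {s<..} = (\<integral>\<^sup>+x. indicator {s<..} x \<partial>N)" by simp
  also have "\<dots> = (\<integral>\<^sup>+x. (if s < x then 1 else 0) \<partial>N)"
    by (intro nn_integral_cong) (auto split: split_indicator)
  finally show ?thesis .
qed

lemma tail_ext_measurable [measurable]: "tail_ext \<in> borel_measurable borel"
  unfolding tail_ext_eq[abs_def] emeasure_Ioi_eq by measurable

text \<open>The mass of \<open>{s<..}\<close> is the \<open>N\<close>-integral of the indicator of s
  < x. By Tonelli each x contributes \<open>(1 - exp (- z * x)) / z\<close>, and the constant
  \<open>a\<close> contributes \<open>a / z\<close>. Subtracting b accounts for the drift, which the
  tail does not contain.\<close>

lemma tail_ext_laplace: assumes z: "0 < z"
  shows "(\<integral>\<^sup>+s. ennreal (exp (- z * s)) * tail_ext s \<partial>lborel) = ennreal (f z / z - b)"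
proof -
  interpret P: pair_sigma_finite lborel N by standard
  have "(\<integral>\<^sup>+s. ennreal (exp (- z * s)) * tail_ext s \<partial>lborel) =
    (\<integral>\<^sup>+s. ennreal a * (ennreal (exp (- z * s)) * indicator {0<..} s) +
       (\<integral>\<^sup>+x. ennreal (exp (- z * s)) * (if 0 < s \<and> s < x then 1 else 0) \<partial>N) \<partial>lborel)"
    by (intro nn_integral_cong)
       (auto simp: tail_ext_eq emeasure_Ioi_eq distrib_left nn_integral_cmult[symmetric] mult.commute split: split_indicator)
  also have "\<dots> = ennreal a * (\<integral>\<^sup>+s. ennreal (exp (- z * s)) * indicator {0<..} s \<partial>lborel) +
     (\<integral>\<^sup>+s. \<integral>\<^sup>+x. ennreal (exp (- z * s)) * (if 0 < s \<and> s < x then 1 else 0) \<partial>N \<partial>lborel)"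
    by (subst nn_integral_add, measurable, subst nn_integral_cmult) auto
  also have "(\<integral>\<^sup>+s. \<integral>\<^sup>+x. ennreal (exp (- z * s)) * (if 0 < s \<and> s < x then 1 else 0) \<partial>N \<partial>lborel) =
     (\<integral>\<^sup>+x. \<integral>\<^sup>+s. ennreal (exp (- z * s)) * (if 0 < s \<and> s < x then 1 else 0) \<partial>lborel \<partial>N)"
    by (rule P.Fubini'[symmetric]) measurable
  also have "\<dots> = (\<integral>\<^sup>+x. ennreal (1/z) * ennreal (1 - exp (- x * z)) \<partial>N)"
  proof (rule nn_integral_cong_AE)
    show "AE x in N. (\<integral>\<^sup>+s. ennreal (exp (- z * s)) * (if 0 < s \<and> s < x then 1 else 0) \<partial>lborel) = ennreal (1/z) * ennreal (1 - exp (- x * z))"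
      using AE_N_pos
    proof eventually_elim
      case (elim x)
      have "(\<integral>\<^sup>+s. ennreal (exp (- z * s)) * (if 0 < s \<and> s < x then 1 else 0) \<partial>lborel) =
        (\<integral>\<^sup>+s. ennreal (exp (- z * s)) * indicator {0<..<x} s \<partial>lborel)"
        by (intro nn_integral_cong) (auto split: split_indicator)
      also have "\<dots> = ennreal ((1 - exp (- z * x)) / z)"
        using elim z by (intro nn_integral_exp_Ioo) auto
      finally show ?case using z elim by (simp add: ennreal_mult[symmetric] mult.commute)
    qed
  qed
  also have "\<dots> = ennreal (1/z) * ennreal (f z - a - b * z)"
    by (subst nn_integral_cmult, measurable) (simp only: nn_integral_one_minus_exp[OF z])
  also have "ennreal a * (\<integral>\<^sup>+s. ennreal (exp (- z * s)) * indicator {0<..} s \<partial>lborel) = ennreal (a / z)"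
    using nn_integral_exp_Ioi[OF z, of 0] z a_nonneg by (simp add: ennreal_mult[symmetric])
  also have "ennreal (a / z) + ennreal (1/z) * ennreal (f z - a - b * z) = ennreal (f z / z - b)"
    using z a_nonneg f_integral_nonneg[OF z]
    by (simp add: bernstein_def ennreal_mult[symmetric] ennreal_plus[symmetric] field_simps del: ennreal_plus)
  finally show ?thesis .
qed

text \<open>The tail may blow up at 0, but s times the mass beyond s is at most the integral of
  \<open>min x s\<close>. The bound later dominates convolutions with
  \<open>s * \<nu> s\<close>.\<close>

lemma s_tail_ext_bound: "\<exists>C::real. 0 \<le> C \<and> (\<forall>s\<le>T. ennreal s * tail_ext s \<le> ennreal C)"
proof -
  define C where "C = \<bar>T\<bar> * a + max 1 \<bar>T\<bar> * enn2real (\<integral>\<^sup>+z. ennreal (min z 1) \<partial>N)"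
  have "ennreal s * tail_ext s \<le> ennreal C" if s: "s \<le> T" for s
  proof (cases "0 < s")
    case True
    have "ennreal s * emeasure N {s<..} = (\<integral>\<^sup>+x. ennreal s * indicator {s<..} x \<partial>N)"
      by (simp add: nn_integral_cmult_indicator)
    also have "\<dots> \<le> (\<integral>\<^sup>+x. ennreal (max 1 \<bar>T\<bar>) * ennreal (min x 1) \<partial>N)"
    proof (rule nn_integral_mono)
      fix x
      have "s \<le> max 1 \<bar>T\<bar> * min x 1" if "s < x"
      proof -
        have "s \<le> max 1 s * min x 1" using min_scale[of x s] True that by auto
        also have "\<dots> \<le> max 1 \<bar>T\<bar> * min x 1" using s True that by (intro mult_right_mono) auto
        finally show ?thesis .
      qed
      then show "ennreal s * indicator {s<..} x \<le> ennreal (max 1 \<bar>T\<bar>) * ennreal (min x 1)"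
        using True by (auto simp: ennreal_mult[symmetric] intro!: ennreal_leI split: split_indicator)
    qed
    also have "\<dots> = ennreal (max 1 \<bar>T\<bar>) * (\<integral>\<^sup>+x. ennreal (min x 1) \<partial>N)"
      by (rule nn_integral_cmult) measurable
    also have "\<dots> = ennreal (max 1 \<bar>T\<bar> * enn2real (\<integral>\<^sup>+z. ennreal (min z 1) \<partial>N))"
      using nn_integral_min by (simp add: ennreal_mult)
    finally have 1: "ennreal s * emeasure N {s<..} \<le> \<dots>" .
    have 2: "ennreal s * ennreal a \<le> ennreal (\<bar>T\<bar> * a)"
      using True s a_nonneg by (auto simp: ennreal_mult[symmetric] intro!: ennreal_leI mult_right_mono)
    have "ennreal s * tail_ext s = ennreal s * ennreal a + ennreal s * emeasure N {s<..}"
      using True by (simp add: tail_ext_eq distrib_left)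
    also have "\<dots> \<le> ennreal (\<bar>T\<bar> * a) + ennreal (max 1 \<bar>T\<bar> * enn2real (\<integral>\<^sup>+z. ennreal (min z 1) \<partial>N))"
      by (rule add_mono[OF 2 1])
    also have "\<dots> = ennreal C"
      using a_nonneg by (simp add: C_def)
    finally show ?thesis .
  qed (simp add: tail_ext_def)
  moreover have "0 \<le> C" using a_nonneg by (simp add: C_def)
  ultimately show ?thesis by blast
qed

text \<open>The indicators of \<open>{X i<..}\<close> converge off the point s, which has measure 0.
  Near s they are dominated by the indicator of a half-line of finite mass.\<close>

lemma tail_ext_tendsto:
  assumes s: "0 < s" and X: "X \<longlonglongrightarrow> s"
  shows "(\<lambda>i. tail_ext (X i)) \<longlonglongrightarrow> tail_ext s"
proof -
  have ev: "\<forall>\<^sub>F i in sequentially. s / 2 < X i" using X s by (intro order_tendstoD) auto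
  \<comment> \<open>Cutting off at \<open>s / 2\<close> makes the domination by
    \<open>{s / 3<..}\<close> hold for every index, not only eventually.\<close>
  define Y where "Y i = max (X i) (s / 2)" for i
  have Y: "Y \<longlonglongrightarrow> s" using tendsto_max[OF X tendsto_const[of "s/2"]] s by (simp add: Y_def[abs_def] max_def)
  have "(\<lambda>i. \<integral>\<^sup>+x. (if Y i < x then 1 else 0) \<partial>N) \<longlonglongrightarrow> (\<integral>\<^sup>+x. (if s < x then 1 else 0) \<partial>N)"
  proof (rule nn_integral_dominated_convergence[where w="\<lambda>x. if s / 3 < x then 1 else 0"])
    show "(\<integral>\<^sup>+x. (if s / 3 < x then 1 else 0) \<partial>N) < \<infinity>"
      using N_tail_finite[of "s/3"] s by (simp add: emeasure_Ioi_eq)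
    show "AE x in N. (if Y i < x then 1 else 0) \<le> (if s / 3 < x then 1 else 0 :: ennreal)" for i
      using s by (auto simp: Y_def)
    show "AE x in N. (\<lambda>i. if Y i < x then 1 else 0 :: ennreal) \<longlonglongrightarrow> (if s < x then 1 else 0)"
      using AE_N_neq[of s]
    proof eventually_elim
      case (elim x)
      then consider "x < s" | "s < x" by linarith
      then show ?case
      proof cases
        case 1
        then have "\<forall>\<^sub>F i in sequentially. x < Y i" using Y by (intro order_tendstoD) auto
        then show ?thesis by - (rule tendsto_eventually, erule eventually_mono, use 1 in auto)
      next
        case 2
        then have "\<forall>\<^sub>F i in sequentially. Y i < x" using Y by (intro order_tendstoD) auto
        then show ?thesis by - (rule tendsto_eventually, erule eventually_mono, use 2 in auto)
      qed
    qed
  qed measurable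
  then have "(\<lambda>i. ennreal a + emeasure N {Y i<..}) \<longlonglongrightarrow> tail_ext s"
    using s by (auto simp: tail_ext_eq emeasure_Ioi_eq intro!: tendsto_add)
  moreover have "\<forall>\<^sub>F i in sequentially. ennreal a + emeasure N {Y i<..} = tail_ext (X i)"
    using ev by eventually_elim (use s in \<open>auto simp: tail_ext_eq Y_def max_def\<close>)
  ultimately show ?thesis by (rule Lim_transform_eventually)
qed

end

section \<open>Weak evolution equations\<close>

text \<open>\<open>F\<close> is the Laplace transform of the density \<open>u\<close>. The support
  condition is only almost everywhere, so that arbitrary versions of a density qualify. Total mass
  may be infinite: finiteness is required of the transform at each z > 0 only.\<close>

definition laplace_density :: "(real \<Rightarrow> real) \<Rightarrow> (real \<Rightarrow> real) \<Rightarrow> bool" where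
  "laplace_density u F \<longleftrightarrow> u \<in> borel_measurable borel \<and> (\<forall>x. 0 \<le> u x) \<and>
     (AE x in lborel. x \<le> 0 \<longrightarrow> u x = 0) \<and>
     (\<forall>z>0. 0 \<le> F z \<and> (\<integral>\<^sup>+x. ennreal (exp (- z * x)) * ennreal (u x) \<partial>lborel) = ennreal (F z))"

lemma laplace_densityD:
  assumes "laplace_density u F"
  shows "u \<in> borel_measurable borel" "0 \<le> u x" "AE x in lborel. x \<le> 0 \<longrightarrow> u x = 0"
    "0 < z \<Longrightarrow> 0 \<le> F z" "0 < z \<Longrightarrow> (\<integral>\<^sup>+x. ennreal (exp (- z * x)) * ennreal (u x) \<partial>lborel) = ennreal (F z)"
  using assms by (auto simp: laplace_density_def)

lemma laplace_density_exp:
  assumes u: "laplace_density u F" and z: "0 < z"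
  shows "integrable lborel (\<lambda>x. exp (- z * x) * u x)" "(LINT x|lborel. exp (- z * x) * u x) = F z"
proof -
  note [measurable] = laplace_densityD(1)[OF u]
  have eq: "(\<integral>\<^sup>+x. ennreal (exp (- z * x) * u x) \<partial>lborel) = ennreal (F z)"
    using laplace_densityD(5)[OF u z] by (simp add: ennreal_mult laplace_densityD(2)[OF u])
  show "integrable lborel (\<lambda>x. exp (- z * x) * u x)"
    by (rule integrableI_nn_integral_finite[OF _ _ eq])
       (use laplace_densityD(2)[OF u] laplace_densityD(4)[OF u z] in auto)
  show "(LINT x|lborel. exp (- z * x) * u x) = F z"
    by (rule integral_eq_nn_integral[THEN trans])
       (use laplace_densityD(2)[OF u] laplace_densityD(4)[OF u z] in \<open>simp_all only: eq, auto\<close>)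
qed

lemma laplace_density_integrable:
  assumes u: "laplace_density u F" and [measurable]: "h \<in> borel_measurable borel"
    and bound: "\<And>y. 0 \<le> y \<Longrightarrow> \<bar>h y\<bar> \<le> C * exp (- y)"
  shows "integrable lborel (\<lambda>x. h x * u x)"
proof (rule Bochner_Integration.integrable_bound)
  show "integrable lborel (\<lambda>x. C * (exp (- 1 * x) * u x))"
    by (intro integrable_mult_right laplace_density_exp[OF u]) simp
  note [measurable] = laplace_densityD(1)[OF u]
  show "AE x in lborel. norm (h x * u x) \<le> norm (C * (exp (- 1 * x) * u x))"
    using laplace_densityD(3)[OF u]
  proof eventually_elim
    case (elim x)
    show ?case
    proof (cases "x \<le> 0")
      case False
      have "norm (h x * u x) = \<bar>h x\<bar> * u x" using laplace_densityD(2)[OF u] by (simp add: abs_mult)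
      also have "\<dots> \<le> (C * exp (- x)) * u x"
        using bound[of x] False laplace_densityD(2)[OF u] by (intro mult_right_mono) auto
      also have "\<dots> = C * (exp (- 1 * x) * u x)" by simp
      finally show ?thesis unfolding real_norm_def by (rule order_trans[OF _ abs_ge_self])
    qed (use elim in simp)
  qed
  show "(\<lambda>x. h x * u x) \<in> borel_measurable lborel" by measurable
qed

text \<open>An error of size \<open>e * exp (- y)\<close> costs \<open>e * F 1\<close> after
  integration, which replaces a bound by the possibly infinite mass of \<open>u\<close>.\<close>

lemma laplace_density_approx:
  assumes u: "laplace_density u F" and h [measurable]: "h \<in> borel_measurable borel"
    and bound: "\<And>y. 0 \<le> y \<Longrightarrow> \<bar>h y\<bar> \<le> C * exp (- y)"
    and c: "\<And>y. 0 \<le> y \<Longrightarrow> \<bar>h y - (\<Sum>j<n. c j * exp (- (real j + 1) * y))\<bar> \<le> e * exp (- y)"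
  shows "\<bar>(LINT x|lborel. h x * u x) - (\<Sum>j<n. c j * F (real j + 1))\<bar> \<le> e * F 1"
proof -
  note [measurable] = laplace_densityD(1)[OF u]
  note ih = laplace_density_integrable[OF u h bound]
  define S where "S x = (\<Sum>j<n. c j * exp (- (real j + 1) * x))" for x
  have S: "S x * u x = (\<Sum>j<n. c j * (exp (- (real j + 1) * x) * u x))" for x
    by (simp add: S_def sum_distrib_right mult.assoc)
  have i: "integrable lborel (\<lambda>x. exp (- (real j + 1) * x) * u x)" for j
    by (rule laplace_density_exp[OF u]) simp
  have iS: "integrable lborel (\<lambda>x. S x * u x)"
    unfolding S by (intro Bochner_Integration.integrable_sum integrable_mult_right i)
  have LS: "(LINT x|lborel. S x * u x) = (\<Sum>j<n. c j * F (real j + 1))"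
  proof -
    have eq: "(LINT x|lborel. exp (- (real j + 1) * x) * u x) = F (real j + 1)" for j
      by (rule laplace_density_exp(2)[OF u]) simp
    show ?thesis
      unfolding S
      by (subst Bochner_Integration.integral_sum, rule integrable_mult_right, rule i)
         (simp only: integral_mult_right_zero eq)
  qed
  have "(LINT x|lborel. h x * u x) - (\<Sum>j<n. c j * F (real j + 1)) = (LINT x|lborel. h x * u x - S x * u x)"
    by (subst Bochner_Integration.integral_diff[OF ih iS], assumption) (rule arg_cong2[where f="(-)", OF refl LS[symmetric]])
  also have "\<bar>\<dots>\<bar> \<le> (LINT x|lborel. \<bar>h x * u x - S x * u x\<bar>)"
    by (rule integral_abs_bound)
  also have "\<dots> \<le> (LINT x|lborel. e * (exp (- 1 * x) * u x))"
  proof (rule integral_mono_AE)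
    show "AE x in lborel. \<bar>h x * u x - S x * u x\<bar> \<le> e * (exp (- 1 * x) * u x)"
      using laplace_densityD(3)[OF u]
    proof eventually_elim
      case (elim x)
      show ?case
      proof (cases "x \<le> 0")
        case False
        have "\<bar>h x * u x - S x * u x\<bar> = \<bar>h x - S x\<bar> * u x"
          using laplace_densityD(2)[OF u] by (simp add: left_diff_distrib[symmetric] abs_mult)
        also have "\<dots> \<le> (e * exp (- x)) * u x"
          using c[of x] False laplace_densityD(2)[OF u] by (intro mult_right_mono) (auto simp: S_def)
        finally show ?thesis by simp
      qed (use elim in simp)
    qed
    show "integrable lborel (\<lambda>x. e * (exp (- 1 * x) * u x))"
      by (intro integrable_mult_right laplace_density_exp[OF u]) simp
    show "integrable lborel (\<lambda>x. \<bar>h x * u x - S x * u x\<bar>)"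
      using ih iS by auto
  qed
  also have "\<dots> = e * F 1"
    using laplace_density_exp(2)[OF u, of 1] by simp
  finally show ?thesis .
qed

text \<open>Both functions vanish at infinity and the integral of \<open>exp (- v)\<close> over v >=
  y is \<open>exp (- y)\<close>, so an approximation of the derivative integrates to one of the
  function with the same error. Thus a single choice of coefficients serves both sides of a weak
  equation.\<close>

lemma exp_poly_antiderivative:
  fixes \<phi> D :: "real \<Rightarrow> real"
  assumes der: "\<And>x. (\<phi> has_real_derivative D x) (at x)" and zero: "\<And>y. K \<le> y \<Longrightarrow> \<phi> y = 0"
    and c: "\<And>y. 0 \<le> y \<Longrightarrow> \<bar>D y - (\<Sum>j<n. c j * exp (- (real j + 1) * y))\<bar> \<le> e * exp (- y)"
    and y: "0 \<le> y"
  shows "\<bar>\<phi> y - (\<Sum>j<n. - (c j / (real j + 1)) * exp (- (real j + 1) * y))\<bar> \<le> e * exp (- y)"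
proof -
  define S where "S y = (\<Sum>j<n. - (c j / (real j + 1)) * exp (- (real j + 1) * y))" for y
  have S': "(S has_real_derivative (\<Sum>j<n. c j * exp (- (real j + 1) * y))) (at y)" for y
    unfolding S_def
  proof (rule DERIV_sum)
    fix j
    have *: "((\<lambda>y. - (c j / w) * exp (- w * y)) has_real_derivative c j * exp (- w * y)) (at y)" if "w \<noteq> 0" for w
      using that by (auto intro!: derivative_eq_intros)
    show "((\<lambda>y. - (c j / (real j + 1)) * exp (- (real j + 1) * y)) has_real_derivative c j * exp (- (real j + 1) * y)) (at y)"
      by (rule *) linarith
  qed
  have lim: "((\<lambda>y. s * (\<phi> y - S y) - e * exp (- y)) \<longlongrightarrow> 0) at_top" for s
  proof -
    have "(\<phi> \<longlongrightarrow> 0) at_top"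
      by (rule tendsto_eventually) (use zero in \<open>auto simp: eventually_at_top_linorder\<close>)
    moreover have "(S \<longlongrightarrow> 0) at_top"
      unfolding S_def by (rule tendsto_null_sum) (intro tendsto_mult_right_zero exp_neg_tendsto_0, simp)
    moreover have "((\<lambda>y. e * exp (- y)) \<longlongrightarrow> 0) at_top"
      using tendsto_mult_right_zero[OF exp_neg_tendsto_0[of 1], of e] by simp
    ultimately show ?thesis
      using tendsto_diff[of "\<lambda>y. s * (\<phi> y - S y)" 0 at_top "\<lambda>y. e * exp (- y)" 0]
        tendsto_mult_right_zero[of "\<lambda>y. \<phi> y - S y" at_top s] tendsto_diff[of \<phi> 0 at_top S 0] by simp
  qed
  \<comment> \<open>The left-hand side is nondecreasing in y and tends to 0, hence is never
    positive; the signs \<open>s = 1\<close> and \<open>s = -1\<close> give the two halves of the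
    absolute value.\<close>
  have le: "s * (\<phi> y - S y) - e * exp (- y) \<le> 0" if s: "\<bar>s\<bar> = 1" for s
  proof (rule tendsto_lowerbound[OF lim[of s]])
    show "\<forall>\<^sub>F w in at_top. s * (\<phi> y - S y) - e * exp (- y) \<le> s * (\<phi> w - S w) - e * exp (- w)"
      using eventually_ge_at_top[of y]
    proof eventually_elim
      case (elim w)
      show ?case
      proof (rule DERIV_nonneg_imp_nondecreasing[OF elim])
        fix v assume v: "y \<le> v" "v \<le> w"
        let ?d = "D v - (\<Sum>j<n. c j * exp (- (real j + 1) * v))"
        have "((\<lambda>y. s * (\<phi> y - S y) - e * exp (- y)) has_real_derivative s * ?d + e * exp (- v)) (at v)"
          by (auto intro!: derivative_eq_intros der S')
        moreover have "\<bar>s * ?d\<bar> \<le> e * exp (- v)"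
          using c[of v] v y s by (simp add: abs_mult)
        then have "0 \<le> s * ?d + e * exp (- v)" by linarith
        ultimately show "\<exists>d. ((\<lambda>y. s * (\<phi> y - S y) - e * exp (- y)) has_real_derivative d) (at v) \<and> 0 \<le> d"
          by blast
      qed
    qed
  qed simp
  from le[of 1] le[of "-1"] have "\<bar>\<phi> y - S y\<bar> \<le> e * exp (- y)" by auto
  then show ?thesis by (simp only: S_def)
qed

lemma C1_test_function:
  fixes \<phi> :: "real \<Rightarrow> real"
  assumes "\<phi> C1_differentiable_on UNIV" "bounded {x. \<phi> x \<noteq> 0}"
  obtains K where "\<And>x. (\<phi> has_real_derivative deriv \<phi> x) (at x)" "continuous_on UNIV (deriv \<phi>)"
    "\<And>y. K \<le> y \<Longrightarrow> \<phi> y = 0" "\<And>y. K \<le> y \<Longrightarrow> deriv \<phi> y = 0"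
proof -
  obtain D where D: "\<And>x. (\<phi> has_real_derivative D x) (at x)" "continuous_on UNIV D"
    using assms(1) by (auto simp: C1_differentiable_on_def has_real_derivative_iff_has_vector_derivative)
  have dD: "deriv \<phi> = D" using DERIV_imp_deriv[OF D(1)] by auto
  obtain K0 where "\<forall>x\<in>{x. \<phi> x \<noteq> 0}. norm x \<le> K0" using assms(2) unfolding bounded_iff by blast
  then have K0: "\<phi> x = 0" if "K0 < x" for x
    using that abs_ge_self[of x] by (force simp: not_less[symmetric])
  \<comment> \<open>\<open>\<phi>\<close> vanishes strictly beyond \<open>K0\<close>. The extra 1
    leaves an open neighbourhood on which it is 0, so its derivative vanishes as well.\<close>
  show thesis
  proof (rule that[of "K0 + 1"])
    fix y assume y: "K0 + 1 \<le> y"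
    show "\<phi> y = 0" using K0 y by auto
    have "((\<lambda>_. 0) has_real_derivative D y) (at y)"
      by (rule has_field_derivative_transform_within_open[OF D(1), where S="{K0<..}"]) (use K0 y in auto)
    then have "D y = 0" using DERIV_unique[OF _ DERIV_const] by blast
    then show "deriv \<phi> y = 0" by (simp add: dD)
  qed (use D dD in auto)
qed

text \<open>Termwise differentiation with derivatives converging uniformly on \<open>S\<close>. The
  limit function produced by \<open>has_derivative_sequence\<close> is identified with
  \<open>F\<close> by uniqueness of limits.\<close>

lemma has_real_derivative_uniform_limit:
  fixes F :: "real \<Rightarrow> real" and G :: "real \<Rightarrow> real"
  assumes S: "open S" "convex S" and der: "\<And>n r. r \<in> S \<Longrightarrow> (Fn n has_real_derivative Gn n r) (at r)"
    and lim: "\<And>r. r \<in> S \<Longrightarrow> (\<lambda>n. Fn n r) \<longlonglongrightarrow> F r"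
    and unif: "\<And>n r. r \<in> S \<Longrightarrow> \<bar>Gn n r - G r\<bar> \<le> e n" and e: "e \<longlonglongrightarrow> 0"
    and r: "r \<in> S"
  shows "(F has_real_derivative G r) (at r)"
proof -
  have "\<exists>g. \<forall>x\<in>S. (\<lambda>n. Fn n x) \<longlonglongrightarrow> g x \<and> (g has_derivative (*) (G x)) (at x within S)"
  proof (rule has_derivative_sequence[where f=Fn and f'="\<lambda>n x. (*) (Gn n x)" and g'="\<lambda>x. (*) (G x)" and l="F r", OF S(2) _ _ r lim[OF r]])
    show "(Fn n has_derivative (*) (Gn n x)) (at x within S)" if "x \<in> S" for n x
      using der[OF that] by (auto simp: has_field_derivative_def intro: has_derivative_at_withinI)
    show "\<forall>\<^sub>F n in sequentially. \<forall>x\<in>S. \<forall>h. norm (Gn n x * h - G x * h) \<le> d * norm h" if d: "0 < d" for d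
    proof -
      have "\<forall>\<^sub>F n in sequentially. e n < d" using e d by (intro order_tendstoD)
      then show ?thesis
      proof eventually_elim
        case (elim n)
        show ?case
        proof (intro ballI allI)
          fix x h assume x: "x \<in> S"
          have "norm (Gn n x * h - G x * h) = \<bar>Gn n x - G x\<bar> * \<bar>h\<bar>"
            by (simp add: left_diff_distrib[symmetric] abs_mult)
          also have "\<dots> \<le> d * \<bar>h\<bar>" using unif[OF x, of n] elim by (intro mult_right_mono) auto
          finally show "norm (Gn n x * h - G x * h) \<le> d * norm h" by simp
        qed
      qed
    qed
  qed
  then obtain g where g: "\<And>x. x \<in> S \<Longrightarrow> (\<lambda>n. Fn n x) \<longlonglongrightarrow> g x" "\<And>x. x \<in> S \<Longrightarrow> (g has_derivative (*) (G x)) (at x within S)"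
    by blast
  have "g x = F x" if "x \<in> S" for x using LIMSEQ_unique[OF g(1)[OF that] lim[OF that]] .
  moreover have "(g has_real_derivative G r) (at r)"
    using g(2)[OF r] at_within_open[OF r S(1)] by (simp add: has_field_derivative_def)
  ultimately show ?thesis
    using has_field_derivative_transform_within_open[OF _ S(1) r] by blast
qed

section \<open>Weak equations from Laplace transforms\<close>

context levy
begin

text \<open>Since \<open>u\<close> vanishes almost everywhere up to \<open>c\<close>, extending the
  integral beyond \<open>x - c\<close> adds nothing. An infinite integral causes no mismatch: both
  the Lebesgue integral and \<open>enn2real\<close> then return 0.\<close>

lemma tail_conv_integral:
  assumes [measurable]: "u \<in> borel_measurable borel" and u0: "\<And>x. 0 \<le> u x"
    and c: "AE x in lborel. x \<le> c \<longrightarrow> u x = 0"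
  shows "(LBINT s:{0<..<x - c}. u (x - s) * \<nu> s) = enn2real (\<integral>\<^sup>+s. tail_ext s * ennreal (u (x - s)) \<partial>lborel)"
proof -
  have \<nu>m: "(\<lambda>s. indicator {0<..<x - c} s *\<^sub>R (u (x - s) * \<nu> s)) = (\<lambda>s. indicator {0<..<x - c} s * (u (x - s) * enn2real (tail_ext s)))"
    using tail_nonneg by (auto simp: tail_ext_def fun_eq_iff split: split_indicator)
  have "(LBINT s:{0<..<x - c}. u (x - s) * \<nu> s) = enn2real (\<integral>\<^sup>+s. ennreal (indicator {0<..<x - c} s * (u (x - s) * enn2real (tail_ext s))) \<partial>lborel)"
    unfolding set_lebesgue_integral_def \<nu>m
    by (rule integral_eq_nn_integral) (auto intro!: mult_nonneg_nonneg u0)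
  also have "(\<integral>\<^sup>+s. ennreal (indicator {0<..<x - c} s * (u (x - s) * enn2real (tail_ext s))) \<partial>lborel) = (\<integral>\<^sup>+s. tail_ext s * ennreal (u (x - s)) \<partial>lborel)"
  proof (rule nn_integral_cong_AE)
    have "AE s in lborel. x + - 1 * s \<le> c \<longrightarrow> u (x + - 1 * s) = 0"
      by (rule AE_borel_affine[OF _ _ c]) measurable
    then show "AE s in lborel. ennreal (indicator {0<..<x - c} s * (u (x - s) * enn2real (tail_ext s))) = tail_ext s * ennreal (u (x - s))"
    proof eventually_elim
      case (elim s)
      have "tail_ext s = ennreal (enn2real (tail_ext s))" by (simp add: tail_ext_def)
      then have "tail_ext s * ennreal (u (x - s)) = ennreal (enn2real (tail_ext s) * u (x - s))"
        using u0 by (metis enn2real_nonneg ennreal_mult)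
      then show ?case using elim
        by (auto simp: tail_ext_def mult.commute split: split_indicator)
    qed
  qed
  finally show ?thesis .
qed

text \<open>The lower end \<open>c\<close> of the operator and the bound \<open>d\<close> on the
  support of \<open>u\<close> are kept separate because the density equation uses
  \<open>c = b * t\<close> and the inverse equation \<open>c = 0\<close>, both with support beyond
  the drift line. With \<open>c = 0\<close> the lemma also computes the transform of the inverse
  density itself.\<close>

lemma conv_primitive_laplace:
  assumes u: "laplace_density u F" and c: "0 \<le> c" "c \<le> d" and d: "AE x in lborel. x \<le> d \<longrightarrow> u x = 0"
  shows "laplace_density (conv_primitive b \<nu> c u) (\<lambda>z. f z / z * F z)"
    and "AE x in lborel. x \<le> d \<longrightarrow> conv_primitive b \<nu> c u x = 0"
    and "AE x in lborel. ennreal (conv_primitive b \<nu> c u x) = ennreal b * ennreal (u x) + (\<integral>\<^sup>+s. tail_ext s * ennreal (u (x - s)) \<partial>lborel)"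
    and "conv_primitive b \<nu> c u x = b * u x + enn2real (\<integral>\<^sup>+s. tail_ext s * ennreal (u (x - s)) \<partial>lborel)"
proof -
  note [measurable] = laplace_densityD(1)[OF u]
  note u0 = laplace_densityD(2)[OF u]
  have cAE: "AE x in lborel. x \<le> c \<longrightarrow> u x = 0" using d by eventually_elim (use c in auto)
  define I where "I x = (\<integral>\<^sup>+s. tail_ext s * ennreal (u (x - s)) \<partial>lborel)" for x
  have [measurable]: "I \<in> borel_measurable borel" unfolding I_def by measurable
  have P: "conv_primitive b \<nu> c u x = b * u x + enn2real (I x)" for x
    by (simp add: conv_primitive_def tail_conv_integral[OF _ u0 cAE] I_def)
  then show "conv_primitive b \<nu> c u x = b * u x + enn2real (\<integral>\<^sup>+s. tail_ext s * ennreal (u (x - s)) \<partial>lborel)"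
    by (simp add: I_def)
  have lapI: "(\<integral>\<^sup>+x. ennreal (exp (- z * x)) * I x \<partial>lborel) = ennreal ((f z / z - b) * F z)" if z: "0 < z" for z
  proof -
    have "I x = (\<integral>\<^sup>+y. tail_ext (x - y) \<partial>density lborel (\<lambda>y. ennreal (u y)))" for x
      unfolding I_def by (subst nn_integral_conv_commute) (auto simp: nn_integral_density mult.commute)
    then have "(\<integral>\<^sup>+x. ennreal (exp (- z * x)) * I x \<partial>lborel) =
       (\<integral>\<^sup>+s. ennreal (exp (- z * s)) * tail_ext s \<partial>lborel) * (\<integral>\<^sup>+y. ennreal (exp (- z * y)) \<partial>density lborel (\<lambda>y. ennreal (u y)))"
      by (simp only:, intro nn_integral_conv_exp)
         (auto intro!: sigma_finite_measure.sigma_finite_iff_density_finite[THEN iffD2] sigma_finite_lborel)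
    also have "\<dots> = ennreal (f z / z - b) * ennreal (F z)"
      using laplace_densityD(5)[OF u z] tail_ext_laplace[OF z]
      by (simp add: nn_integral_density mult.commute)
    also have "\<dots> = ennreal ((f z / z - b) * F z)"
      using f_ge[OF z] z laplace_densityD(4)[OF u z] by (intro ennreal_mult[symmetric]) (auto simp: field_simps)
    finally show ?thesis .
  qed
  \<comment> \<open>A finite transform at one point forces the convolution to be finite almost
    everywhere, so passing through \<open>enn2real\<close> loses nothing.\<close>
  have "AE x in lborel. ennreal (exp (- 1 * x)) * I x \<noteq> \<infinity>"
    by (rule nn_integral_PInf_AE) (auto simp: lapI[of 1, simplified])
  then have Ifin: "AE x in lborel. I x < \<infinity>"
    by eventually_elim (auto simp: ennreal_mult_eq_top_iff less_top)
  then show AEP: "AE x in lborel. ennreal (conv_primitive b \<nu> c u x) = ennreal b * ennreal (u x) + (\<integral>\<^sup>+s. tail_ext s * ennreal (u (x - s)) \<partial>lborel)"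
    by eventually_elim (use b_nonneg u0 in \<open>simp add: P ennreal_mult[symmetric] I_def[symmetric]\<close>)
  have I0: "I x = 0" if "x \<le> d" for x
  proof -
    have "AE s in lborel. x + - 1 * s \<le> d \<longrightarrow> u (x + - 1 * s) = 0"
      by (rule AE_borel_affine[OF _ _ d]) measurable
    then have "AE s in lborel. tail_ext s * ennreal (u (x - s)) = 0"
      by eventually_elim (use that in \<open>auto simp: tail_ext_def\<close>)
    then show ?thesis unfolding I_def by (subst nn_integral_0_iff_AE) auto
  qed
  show AE0: "AE x in lborel. x \<le> d \<longrightarrow> conv_primitive b \<nu> c u x = 0"
    using d by eventually_elim (auto simp: P I0)
  show "laplace_density (conv_primitive b \<nu> c u) (\<lambda>z. f z / z * F z)"
    unfolding laplace_density_def
  proof (intro conjI allI impI)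
    show "conv_primitive b \<nu> c u \<in> borel_measurable borel" unfolding P[abs_def] by measurable
    show "0 \<le> conv_primitive b \<nu> c u x" for x using b_nonneg u0 by (simp add: P)
    show "AE x in lborel. x \<le> 0 \<longrightarrow> conv_primitive b \<nu> c u x = 0"
      using AE0 by eventually_elim (use c in auto)
    fix z :: real assume z: "0 < z"
    show "0 \<le> f z / z * F z" using f_nonneg[OF z] z laplace_densityD(4)[OF u z] by auto
    have "(\<integral>\<^sup>+x. ennreal (exp (- z * x)) * ennreal (conv_primitive b \<nu> c u x) \<partial>lborel) =
       (\<integral>\<^sup>+x. ennreal b * (ennreal (exp (- z * x)) * ennreal (u x)) + ennreal (exp (- z * x)) * I x \<partial>lborel)"
    proof (rule nn_integral_cong_AE)
      show "AE x in lborel. ennreal (exp (- z * x)) * ennreal (conv_primitive b \<nu> c u x) =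
         ennreal b * (ennreal (exp (- z * x)) * ennreal (u x)) + ennreal (exp (- z * x)) * I x"
        using AEP by eventually_elim (simp add: I_def distrib_left mult_ac)
    qed
    also have "\<dots> = ennreal b * (\<integral>\<^sup>+x. ennreal (exp (- z * x)) * ennreal (u x) \<partial>lborel) + ennreal ((f z / z - b) * F z)"
      by (subst nn_integral_add, measurable, subst nn_integral_cmult, measurable) (simp only: lapI[OF z])
    also have "\<dots> = ennreal b * ennreal (F z) + ennreal ((f z / z - b) * F z)"
      by (simp only: laplace_densityD(5)[OF u z])
    also have "\<dots> = ennreal (b * F z + (f z / z - b) * F z)"
    proof -
      have "0 \<le> (f z / z - b) * F z"
        using f_ge[OF z] z laplace_densityD(4)[OF u z] by (intro mult_nonneg_nonneg) (auto simp: field_simps)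
      then show ?thesis
        using laplace_densityD(4)[OF u z] b_nonneg by (simp only: ennreal_plus ennreal_mult mult_nonneg_nonneg)
    qed
    also have "b * F z + (f z / z - b) * F z = f z / z * F z" by (simp add: algebra_simps)
    finally show "(\<integral>\<^sup>+x. ennreal (exp (- z * x)) * ennreal (conv_primitive b \<nu> c u x) \<partial>lborel) = ennreal (f z / z * F z)" .
  qed
qed

text \<open>On exponential polynomials the equation can be checked by differentiating
  \<open>exp (- r * f z)\<close>; the error for a general test function is uniform in r because
  \<open>exp (- r * f 1) \<le> 1\<close>. The factor \<open>\<tau>\<close> makes one proof cover the
  subordinator, with \<open>\<tau> z = 1\<close>, and the inverse, with
  \<open>\<tau> z = f z / z\<close>.\<close>

lemma weak_evolution_laplace:
  assumes u: "\<And>r. 0 < r \<Longrightarrow> laplace_density (u r) (\<lambda>z. \<tau> z * exp (- r * f z))"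
    and supp: "\<And>r. 0 < r \<Longrightarrow> AE x in lborel. x \<le> b * r \<longrightarrow> u r x = 0"
    and c: "\<And>r. 0 < r \<Longrightarrow> 0 \<le> c r" "\<And>r. 0 < r \<Longrightarrow> c r \<le> b * r"
  shows "weak_evolution b \<nu> c u"
  unfolding weak_evolution_def
proof (intro allI impI, elim conjE)
  fix \<phi> :: "real \<Rightarrow> real" and r :: real
  assume \<phi>: "\<phi> C1_differentiable_on UNIV" "bounded {x. \<phi> x \<noteq> 0}" and r: "0 < r"
  obtain K where der: "\<And>x. (\<phi> has_real_derivative deriv \<phi> x) (at x)" and cont: "continuous_on UNIV (deriv \<phi>)"
    and z: "\<And>y. K \<le> y \<Longrightarrow> \<phi> y = 0" "\<And>y. K \<le> y \<Longrightarrow> deriv \<phi> y = 0"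
    using C1_test_function[OF \<phi>] by metis
  have cont\<phi>: "continuous_on UNIV \<phi>"
    using der by (meson DERIV_isCont continuous_at_imp_continuous_on)
  have [measurable]: "\<phi> \<in> borel_measurable borel" "deriv \<phi> \<in> borel_measurable borel"
    using cont cont\<phi> by (auto intro: borel_measurable_continuous_onI)
  obtain C where C: "\<And>y. 0 \<le> y \<Longrightarrow> \<bar>\<phi> y\<bar> \<le> C * exp (- y)"
    using compact_support_exp_bound[OF continuous_on_subset[OF cont\<phi> subset_UNIV] z(1)] by metis
  obtain C' where C': "\<And>y. 0 \<le> y \<Longrightarrow> \<bar>deriv \<phi> y\<bar> \<le> C' * exp (- y)"
    using compact_support_exp_bound[OF continuous_on_subset[OF cont subset_UNIV] z(2)] by metis
  define P where "P r = conv_primitive b \<nu> (c r) (u r)" for r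
  note P = conv_primitive_laplace(1,2)[OF u c supp, folded P_def]
  define e where "e n = 1 / (real n + 1)" for n
  have e_pos: "0 < e n" for n by (simp add: e_def)
  have "\<forall>n. \<exists>c m. \<forall>y\<ge>0. \<bar>deriv \<phi> y - (\<Sum>j<m. c j * exp (- (real j + 1) * y))\<bar> \<le> e n * exp (- y)"
  proof
    fix n
    from exp_poly_approx[OF continuous_on_subset[OF cont subset_UNIV] z(2) e_pos[of n]]
    show "\<exists>c m. \<forall>y\<ge>0. \<bar>deriv \<phi> y - (\<Sum>j<m. c j * exp (- (real j + 1) * y))\<bar> \<le> e n * exp (- y)"
      by metis
  qed
  then obtain p m where p: "\<And>n y. 0 \<le> y \<Longrightarrow> \<bar>deriv \<phi> y - (\<Sum>j<m n. p n j * exp (- (real j + 1) * y))\<bar> \<le> e n * exp (- y)"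
    by metis
  \<comment> \<open>The approximants of \<open>\<phi>\<close> are the antiderivatives of those of
    \<open>deriv \<phi>\<close>; the two sides of the weak equation then match term by term.\<close>
  note q = exp_poly_antiderivative[OF der z(1) p]
  have \<tau>: "0 \<le> \<tau> z" if "0 < z" for z
    using laplace_densityD(4)[OF u[of 1] that] by (simp add: zero_le_mult_iff)
  define F where "F r = (LINT x|lborel. \<phi> x * u r x)" for r
  define G where "G r = (LINT x|lborel. deriv \<phi> x * P r x)" for r
  have e_le: "exp (- r * f 1) \<le> 1" if "0 < r" for r
    using that f_nonneg[of 1] by auto
  have lim: "e \<longlonglongrightarrow> 0"
    unfolding e_def using LIMSEQ_inverse_real_of_nat by (simp add: inverse_eq_divide add.commute)
  have "(F has_real_derivative G r) (at r)"
  \<comment> \<open>Differentiating in r brings down \<open>- f (j + 1)\<close>, which turns the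
    coefficient \<open>- p n j / (j + 1)\<close> into \<open>p n j * f (j + 1) / (j + 1)\<close>.
    This is the transform of the convolution primitive tested with
    \<open>deriv \<phi>\<close>.\<close>
  proof (rule has_real_derivative_uniform_limit[where S="{0<..}" and e="\<lambda>n. e n * (f 1 * \<tau> 1)"
        and Fn="\<lambda>n r. \<Sum>j<m n. - (p n j / (real j + 1)) * (\<tau> (real j + 1) * exp (- r * f (real j + 1)))"
        and Gn="\<lambda>n r. \<Sum>j<m n. p n j * (f (real j + 1) / (real j + 1) * (\<tau> (real j + 1) * exp (- r * f (real j + 1))))"])
    fix n and r :: real assume r: "r \<in> {0<..}"
    show "((\<lambda>r. \<Sum>j<m n. - (p n j / (real j + 1)) * (\<tau> (real j + 1) * exp (- r * f (real j + 1)))) has_real_derivative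
        (\<Sum>j<m n. p n j * (f (real j + 1) / (real j + 1) * (\<tau> (real j + 1) * exp (- r * f (real j + 1)))))) (at r)"
      by (rule DERIV_sum) (auto intro!: derivative_eq_intros)
    have "\<bar>G r - (\<Sum>j<m n. p n j * (f (real j + 1) / (real j + 1) * (\<tau> (real j + 1) * exp (- r * f (real j + 1)))))\<bar> \<le>
       e n * (f 1 / 1 * (\<tau> 1 * exp (- r * f 1)))"
      unfolding G_def by (rule laplace_density_approx[OF P(1) _ C' p]) (use r in auto)
    also have "\<dots> \<le> e n * (f 1 * \<tau> 1)"
    proof -
      have "\<tau> 1 * exp (- r * f 1) \<le> \<tau> 1" using e_le[of r] r \<tau>[of 1] by (intro mult_left_le) auto
      then show ?thesis using f_nonneg[of 1] e_pos[of n] by (intro mult_left_mono) (auto intro!: mult_left_mono)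
    qed
    finally show "\<bar>(\<Sum>j<m n. p n j * (f (real j + 1) / (real j + 1) * (\<tau> (real j + 1) * exp (- r * f (real j + 1))))) - G r\<bar> \<le> e n * (f 1 * \<tau> 1)"
      by (simp add: abs_minus_commute)
  next
    fix r :: real assume r: "r \<in> {0<..}"
    have bd: "\<bar>F r - (\<Sum>j<m n. - (p n j / (real j + 1)) * (\<tau> (real j + 1) * exp (- r * f (real j + 1))))\<bar> \<le> e n * (\<tau> 1 * exp (- r * f 1))" for n
      unfolding F_def by (rule laplace_density_approx[OF u _ C q]) (use r in auto)
    have "(\<lambda>n. (\<Sum>j<m n. - (p n j / (real j + 1)) * (\<tau> (real j + 1) * exp (- r * f (real j + 1)))) - F r) \<longlonglongrightarrow> 0"
      by (rule Lim_null_comparison[OF _ tendsto_mult_left_zero[OF lim, of "\<tau> 1 * exp (- r * f 1)"]])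
         (use bd in \<open>auto simp: abs_minus_commute simp del: sum_negf\<close>)
    then show "(\<lambda>n. \<Sum>j<m n. - (p n j / (real j + 1)) * (\<tau> (real j + 1) * exp (- r * f (real j + 1)))) \<longlonglongrightarrow> F r"
      by (rule LIM_zero_cancel)
  next
    show "(\<lambda>n. e n * (f 1 * \<tau> 1)) \<longlonglongrightarrow> 0" by (rule tendsto_mult_left_zero[OF lim])
  qed (use r in auto)
  moreover have F: "F r = (LBINT x:{b * r<..}. \<phi> x * u r x)" if "0 < r" for r
    unfolding F_def set_lebesgue_integral_def
  proof (rule integral_cong_AE)
    note [measurable] = laplace_densityD(1)[OF u[OF that]]
    show "(\<lambda>x. \<phi> x * u r x) \<in> borel_measurable lborel" by measurable
    show "(\<lambda>x. indicat_real {b * r<..} x *\<^sub>R (\<phi> x * u r x)) \<in> borel_measurable lborel" by measurable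
    show "AE x in lborel. \<phi> x * u r x = indicat_real {b * r<..} x *\<^sub>R (\<phi> x * u r x)"
      using supp[OF that] by eventually_elim (auto split: split_indicator)
  qed
  moreover have "G r = (LBINT x:{b * r<..}. deriv \<phi> x * P r x)"
    unfolding G_def set_lebesgue_integral_def
  proof (rule integral_cong_AE)
    note [measurable] = laplace_densityD(1)[OF P(1)[OF r r r r]]
    show "(\<lambda>x. deriv \<phi> x * P r x) \<in> borel_measurable lborel" by measurable
    show "(\<lambda>x. indicat_real {b * r<..} x *\<^sub>R (deriv \<phi> x * P r x)) \<in> borel_measurable lborel" by measurable
    show "AE x in lborel. deriv \<phi> x * P r x = indicat_real {b * r<..} x *\<^sub>R (deriv \<phi> x * P r x)"
      using P(2)[OF r r r r] by eventually_elim (auto split: split_indicator)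
  qed
  ultimately show "((\<lambda>r. LBINT x:{b * r<..}. \<phi> x * u r x) has_real_derivative
           (LBINT x:{b * r<..}. deriv \<phi> x * conv_primitive b \<nu> (c r) (u r) x)) (at r)"
    using has_field_derivative_transform_within_open[of F "G r" r "{0<..}"] r
    by (simp add: P_def)
qed

end

section \<open>From the weak to the classical equation\<close>

text \<open>Squaring the positive part removes its kink at 0, which makes the bump function below
  continuously differentiable.\<close>

lemma DERIV_pos_part_square:
  "((\<lambda>y::real. (max 0 y)\<^sup>2) has_real_derivative 2 * max 0 y) (at y)"
proof -
  consider "y < 0" | "0 < y" | "y = 0" by linarith
  then show ?thesis
  proof cases
    case 1
    have "((\<lambda>_. 0) has_real_derivative 2 * max 0 y) (at y)" using 1 by simp
    then show ?thesis
      by (rule has_field_derivative_transform_within_open[where S="{..<0}"]) (use 1 in auto)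
  next
    case 2
    have "((\<lambda>y. y\<^sup>2) has_real_derivative 2 * max 0 y) (at y)" using 2 by (auto intro!: derivative_eq_intros)
    then show ?thesis
      by (rule has_field_derivative_transform_within_open[where S="{0<..}"]) (use 2 in auto)
  next
    case 3
    have "((\<lambda>h. ((max 0 h)\<^sup>2 - 0) / h) \<longlongrightarrow> 0) (at (0::real))"
    proof (rule Lim_null_comparison)
      show "\<forall>\<^sub>F h in at (0::real). norm (((max 0 h)\<^sup>2 - 0) / h) \<le> \<bar>h\<bar>"
        by (intro always_eventually allI) (auto simp: max_def power2_eq_square)
      show "((\<lambda>h. \<bar>h\<bar>) \<longlongrightarrow> 0) (at (0::real))" by (intro tendsto_rabs_zero tendsto_ident_at)
    qed
    then show ?thesis using 3 by (simp add: has_field_derivative_iff)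
  qed
qed

text \<open>If the residual of the equation is nonzero at a point, continuity gives it a constant
  sign on a rectangle. The weak equation tested with a positive bump in that rectangle,
  differentiation under the integral and integration by parts make the weighted integral of the
  residual 0, a contradiction.\<close>

lemma weak_imp_classical_evolution:
  assumes weak: "weak_evolution b \<nu> c u"
    and meas: "\<And>r. 0 < r \<Longrightarrow> u r \<in> borel_measurable borel"
    and int: "\<And>r d. 0 < r \<Longrightarrow> set_integrable lborel {..d} (u r)"
  shows "classical_evolution b \<nu> c u"
proof -
  have main: "deriv (\<lambda>r. u r x0) r0 = - conv_deriv b \<nu> (c r0) (u r0) x0"
    if U: "open U" "U \<subseteq> {(r, x). 0 < r \<and> b * r < x}"
      and du: "\<And>r x. (r, x) \<in> U \<Longrightarrow> (\<lambda>r. u r x) differentiable (at r)"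
      and dP: "\<And>r x. (r, x) \<in> U \<Longrightarrow> conv_primitive b \<nu> (c r) (u r) differentiable (at x)"
      and cu: "continuous_on U (\<lambda>(r, x). deriv (\<lambda>r. u r x) r)"
      and cP: "continuous_on U (\<lambda>(r, x). conv_deriv b \<nu> (c r) (u r) x)"
      and x0: "(r0, x0) \<in> U" for U :: "(real \<times> real) set" and r0 x0
  proof (rule ccontr)
    assume neq: "deriv (\<lambda>r. u r x0) r0 \<noteq> - conv_deriv b \<nu> (c r0) (u r0) x0"
    define ur where "ur r x = deriv (\<lambda>r. u r x) r" for r x
    define P where "P = conv_primitive b \<nu> (c r0) (u r0)"
    define h where "h p = ur (fst p) (snd p) + conv_deriv b \<nu> (c (fst p)) (u (fst p)) (snd p)" for p
    have contU: "continuous_on U h"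
      using continuous_on_add[OF cu cP] by (simp add: h_def[abs_def] ur_def case_prod_unfold)
    \<comment> \<open>Multiplying by the sign treats positive and negative residuals
      together.\<close>
    define s where "s = sgn (h (r0, x0))"
    have hs: "0 < s * h (r0, x0)" using neq by (auto simp: s_def h_def ur_def sgn_if)
    have "open {p \<in> U. 0 < s * h p}"
      using continuous_openin_preimage_gen[OF continuous_on_mult[OF continuous_on_const[of U s] contU] open_greaterThan[of 0]] U(1)
      by (simp add: vimage_def Int_def openin_open_eq)
    moreover have "(r0, x0) \<in> {p \<in> U. 0 < s * h p}" using hs x0 by simp
    ultimately obtain A B where AB: "open A" "open B" "(r0, x0) \<in> A \<times> B" "A \<times> B \<subseteq> {p \<in> U. 0 < s * h p}"
      by (rule open_prod_elim)
    obtain e1 where e1: "0 < e1" "cball r0 e1 \<subseteq> A" using AB(1,3) by (auto simp: open_contains_cball)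
    obtain e2 where e2: "0 < e2" "cball x0 e2 \<subseteq> B" using AB(2,3) by (auto simp: open_contains_cball)
    define I where "I = {x0 - e2..x0 + e2}"
    have rect: "(r, x) \<in> U" "0 < s * h (r, x)" "0 < r" "b * r < x"
      if "\<bar>r - r0\<bar> \<le> e1" "x \<in> I" for r x
    proof -
      have "(r, x) \<in> A \<times> B" using e1 e2 that by (auto simp: subset_iff dist_real_def I_def abs_le_iff)
      then show "(r, x) \<in> U" "0 < s * h (r, x)" using AB(4) by auto
      then show "0 < r" "b * r < x" using U(2) by auto
    qed
    have r0: "0 < r0" using rect(3)[of r0 x0] e1 e2 by (auto simp: I_def)
    \<comment> \<open>The squared positive part of a parabola: nonnegative, continuously
      differentiable, and positive exactly on the open interval of radius \<open>e2\<close> about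
      \<open>x0\<close>.\<close>
    define \<phi> where "\<phi> x = (max 0 (e2\<^sup>2 - (x - x0)\<^sup>2))\<^sup>2" for x
    define \<phi>' where "\<phi>' x = 2 * max 0 (e2\<^sup>2 - (x - x0)\<^sup>2) * (- 2 * (x - x0))" for x
    have \<phi>_der: "(\<phi> has_real_derivative \<phi>' x) (at x)" for x
      unfolding \<phi>_def \<phi>'_def
      by (rule DERIV_chain2[OF DERIV_pos_part_square]) (auto intro!: derivative_eq_intros)
    have \<phi>'_cont: "continuous_on S \<phi>'" for S unfolding \<phi>'_def by (intro continuous_intros)
    have \<phi>_cont: "continuous_on S \<phi>" for S unfolding \<phi>_def by (intro continuous_intros)
    have [measurable]: "\<phi> \<in> borel_measurable borel" "\<phi>' \<in> borel_measurable borel"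
      using \<phi>_cont \<phi>'_cont by (auto intro: borel_measurable_continuous_onI)
    have out: "e2\<^sup>2 \<le> (x - x0)\<^sup>2" if "x \<notin> {x0 - e2<..<x0 + e2}" for x
      using that e2(1) abs_le_square_iff[of e2 "x - x0"] by (auto simp: abs_if)
    have \<phi>0: "\<phi> x = 0" "\<phi>' x = 0" if "x \<notin> {x0 - e2<..<x0 + e2}" for x
      using out[OF that] by (auto simp: \<phi>_def \<phi>'_def max_def)
    have \<phi>I: "x \<in> I \<or> \<phi> x = 0" "x \<in> I \<or> \<phi>' x = 0" for x
    proof -
      have "x \<in> I \<or> x \<notin> {x0 - e2<..<x0 + e2}" by (auto simp: I_def)
      then show "x \<in> I \<or> \<phi> x = 0" "x \<in> I \<or> \<phi>' x = 0" using \<phi>0 by blast+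
    qed
    have \<phi>pos: "0 < \<phi> x" if "x \<in> {x0 - e2<..<x0 + e2}" for x
    proof -
      have "\<bar>x - x0\<bar> < e2" using that by auto
      from power_strict_mono[OF this, of 2] have "(x - x0)\<^sup>2 < e2\<^sup>2" by simp
      then show ?thesis by (simp add: \<phi>_def)
    qed
    have \<phi>nn: "0 \<le> \<phi> x" for x by (simp add: \<phi>_def)
    have \<phi>le: "\<bar>\<phi> x\<bar> \<le> e2 ^ 4" for x
    proof -
      have "(max 0 (e2\<^sup>2 - (x - x0)\<^sup>2))\<^sup>2 \<le> (e2\<^sup>2)\<^sup>2" by (intro power_mono) auto
      then show ?thesis by (simp add: \<phi>_def)
    qed
    have dphi: "deriv \<phi> = \<phi>'" using DERIV_imp_deriv[OF \<phi>_der] by auto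
    have C1: "\<phi> C1_differentiable_on UNIV"
      unfolding C1_differentiable_on_def
      using \<phi>_der \<phi>'_cont by (auto simp: has_real_derivative_iff_has_vector_derivative)
    have bs: "bounded {x. \<phi> x \<noteq> 0}"
    proof (rule bounded_subset)
      show "{x. \<phi> x \<noteq> 0} \<subseteq> {x0 - e2<..<x0 + e2}" using \<phi>0(1) by blast
    qed simp
    have derF: "((\<lambda>r. LBINT x:{b * r<..}. \<phi> x * u r x) has_real_derivative (LBINT x:{b * r0<..}. \<phi>' x * P x)) (at r0)"
      using weak C1 bs r0 unfolding weak_evolution_def dphi[symmetric] P_def by blast
    \<comment> \<open>The bump lives to the right of \<open>b * r\<close> for all r close to
      \<open>r0\<close>, so the moving domain of integration can be replaced by the whole line
      before differentiating.\<close>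
    have near: "\<phi> x = 0 \<or> b * r < x" if "\<bar>r - r0\<bar> \<le> e1" for r x
      using rect(4)[OF that, of x] \<phi>I(1)[of x] by blast
    have near': "\<phi>' x = 0 \<or> b * r < x" if "\<bar>r - r0\<bar> \<le> e1" for r x
      using rect(4)[OF that, of x] \<phi>I(2)[of x] by blast
    have F: "(LBINT x:{b * r<..}. \<phi> x * u r x) = (LINT x|lborel. \<phi> x * u r x)" if "\<bar>r - r0\<bar> < e1" for r
      unfolding set_lebesgue_integral_def
      by (intro Bochner_Integration.integral_cong refl) (use near[of r] that in \<open>auto split: split_indicator\<close>)
    have G: "(LBINT x:{b * r0<..}. \<phi>' x * P x) = (LINT x|lborel. \<phi>' x * P x)"
      unfolding set_lebesgue_integral_def
      by (intro Bochner_Integration.integral_cong refl) (use near'[of r0] e1(1) in \<open>auto split: split_indicator\<close>)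
    have derF': "((\<lambda>r. LINT x|lborel. \<phi> x * u r x) has_real_derivative (LINT x|lborel. \<phi>' x * P x)) (at r0)"
      by (rule has_field_derivative_transform_within_open[where S="ball r0 e1", OF derF[unfolded G]])
         (use F e1 in \<open>auto simp: dist_real_def abs_minus_commute\<close>)
    have comp: "compact (cball r0 e1 \<times> I)" unfolding I_def by (intro compact_Times) auto
    have rectU: "cball r0 e1 \<times> I \<subseteq> U" using rect(1) by (auto simp: dist_real_def abs_minus_commute)
    have cur: "continuous_on U (\<lambda>p. ur (fst p) (snd p))" using cu by (simp add: ur_def case_prod_unfold)
    have "bounded ((\<lambda>p. ur (fst p) (snd p)) ` (cball r0 e1 \<times> I))"
      by (intro compact_imp_bounded compact_continuous_image continuous_on_subset[OF cur rectU] comp)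
    then obtain C where C: "\<forall>y\<in>(\<lambda>p. ur (fst p) (snd p)) ` (cball r0 e1 \<times> I). norm y \<le> C"
      unfolding bounded_iff by blast
    have C': "\<bar>ur r x\<bar> \<le> C" if "\<bar>r - r0\<bar> \<le> e1" "x \<in> I" for r x
      using C that by (force simp: dist_real_def abs_minus_commute)
    have slice: "continuous_on I (\<lambda>x. k (r0, x))" if "continuous_on U k" for k :: "real \<times> real \<Rightarrow> real"
      by (rule continuous_on_compose2[OF that, of I "\<lambda>x. (r0, x)"])
         (use rect(1)[of r0] e1 in \<open>auto intro!: continuous_intros\<close>)
    have int\<phi>: "integrable lborel (\<lambda>x. \<phi> x * u r x)" if "0 < r" for r
    proof (rule Bochner_Integration.integrable_bound[OF integrable_mult_right[OF int[OF that, of "x0 + e2", unfolded set_integrable_def], of "e2 ^ 4"]])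
      note [measurable] = meas[OF that]
      show "(\<lambda>x. \<phi> x * u r x) \<in> borel_measurable lborel" by measurable
      show "AE x in lborel. norm (\<phi> x * u r x) \<le> norm (e2 ^ 4 * (indicat_real {..x0 + e2} x *\<^sub>R u r x))"
      proof (intro always_eventually allI)
        fix x
        have "\<bar>\<phi> x\<bar> * \<bar>u r x\<bar> \<le> e2 ^ 4 * \<bar>u r x\<bar>" using \<phi>le[of x] by (intro mult_right_mono) auto
        then show "norm (\<phi> x * u r x) \<le> norm (e2 ^ 4 * (indicat_real {..x0 + e2} x *\<^sub>R u r x))"
          using \<phi>I(1)[of x] by (auto simp: I_def abs_mult split: split_indicator)
      qed
    qed
    have measI: "(\<lambda>x. \<phi> x * k x) \<in> borel_measurable borel" if "continuous_on I k" for k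
    proof -
      have "(\<lambda>x. indicator I x *\<^sub>R k x) \<in> borel_measurable borel"
        using that by (intro borel_measurable_continuous_on_indicator) (auto simp: I_def)
      then have "(\<lambda>x. \<phi> x * (indicator I x *\<^sub>R k x)) \<in> borel_measurable borel" by measurable
      also have "(\<lambda>x. \<phi> x * (indicator I x *\<^sub>R k x)) = (\<lambda>x. \<phi> x * k x)"
        using \<phi>I(1) by (intro ext) (auto split: split_indicator)
      finally show ?thesis .
    qed
    \<comment> \<open>A second computation of the same derivative, now under the integral sign.
      Uniqueness of derivatives transfers the weak equation to the classical r-derivative.\<close>
    have derF2: "((\<lambda>r. LINT x|lborel. \<phi> x * u r x) has_real_derivative (LINT x|lborel. \<phi> x * ur r0 x)) (at r0)"
    proof (rule has_real_derivative_integral[where e=e1 and w="\<lambda>x. e2 ^ 4 * C * indicator I x"])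
      show "integrable lborel (\<lambda>x. \<phi> x * u r x)" if "\<bar>r - r0\<bar> < e1" for r
        using rect(3)[of r x0] that e2 by (intro int\<phi>) (auto simp: I_def)
      show "(\<lambda>x. \<phi> x * ur r0 x) \<in> borel_measurable lborel"
        using measI[OF slice[OF cur]] by simp
      show "AE x in lborel. \<forall>r. \<bar>r - r0\<bar> < e1 \<longrightarrow>
         ((\<lambda>r. \<phi> x * u r x) has_real_derivative \<phi> x * ur r x) (at r) \<and> \<bar>\<phi> x * ur r x\<bar> \<le> e2 ^ 4 * C * indicator I x"
      proof (intro always_eventually allI impI)
        fix x r assume r: "\<bar>r - r0\<bar> < e1"
        show "((\<lambda>r. \<phi> x * u r x) has_real_derivative \<phi> x * ur r x) (at r) \<and> \<bar>\<phi> x * ur r x\<bar> \<le> e2 ^ 4 * C * indicator I x"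
        proof (cases "x \<in> I")
          case True
          have "(r, x) \<in> U" using rect(1) r True by auto
          then have "((\<lambda>r. u r x) has_real_derivative ur r x) (at r)"
            unfolding ur_def using du real_differentiable_def DERIV_deriv_iff_real_differentiable by blast
          then have "((\<lambda>r. \<phi> x * u r x) has_real_derivative \<phi> x * ur r x) (at r)" by (rule DERIV_cmult)
          moreover have "\<bar>\<phi> x\<bar> * \<bar>ur r x\<bar> \<le> e2 ^ 4 * C"
            using \<phi>le[of x] C'[of r x] r True by (intro mult_mono) auto
          ultimately show ?thesis using True by (simp add: abs_mult)
        next
          case False
          then have "\<phi> x = 0" using \<phi>I(1)[of x] by blast
          then show ?thesis using False by simp
        qed
      qed
      show "integrable lborel (\<lambda>x. e2 ^ 4 * C * indicator I x)"
        unfolding I_def by (intro integrable_mult_right) (use e2(1) in \<open>simp add: integrable_indicator_iff\<close>)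
    qed (rule e1(1))
    have eq1: "(LINT x|lborel. \<phi>' x * P x) = (LINT x|lborel. \<phi> x * ur r0 x)"
      by (rule DERIV_unique[OF derF' derF2])
    define P' where "P' x = conv_deriv b \<nu> (c r0) (u r0) x" for x
    have P_der: "(P has_real_derivative P' x) (at x)" if "x \<in> I" for x
      using dP[of r0 x] rect(1)[of r0 x] that e1
      unfolding P_def P'_def conv_deriv_def
      by (auto simp: DERIV_deriv_iff_real_differentiable)
    have cP'I: "continuous_on I P'"
      using slice[OF cP] by (simp add: P'_def)
    have cPI: "continuous_on I P"
      using P_der by (meson DERIV_isCont continuous_at_imp_continuous_on)
    \<comment> \<open>Integration by parts: the boundary terms vanish because \<open>\<phi>\<close>
      is 0 at both end points.\<close>
    have FTC: "integral\<^sup>L lborel (\<lambda>x. indicator I x *\<^sub>R (\<phi>' x * P x + \<phi> x * P' x)) = \<phi> (x0 + e2) * P (x0 + e2) - \<phi> (x0 - e2) * P (x0 - e2)"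
      unfolding I_def
    proof (rule integral_FTC_Icc)
      show "x0 - e2 \<le> x0 + e2" using e2 by simp
      show "((\<lambda>x. \<phi> x * P x) has_vector_derivative \<phi>' x * P x + \<phi> x * P' x) (at x within {x0 - e2..x0 + e2})"
        if "x0 - e2 \<le> x" "x \<le> x0 + e2" for x
      proof -
        have "((\<lambda>x. \<phi> x * P x) has_real_derivative \<phi>' x * P x + P' x * \<phi> x) (at x)"
          by (rule DERIV_mult[OF \<phi>_der P_der]) (use that in \<open>auto simp: I_def\<close>)
        then show ?thesis
          by (auto simp: has_real_derivative_iff_has_vector_derivative[symmetric] mult.commute intro: has_field_derivative_at_within)
      qed
      show "continuous_on {x0 - e2..x0 + e2} (\<lambda>x. \<phi>' x * P x + \<phi> x * P' x)"
        using cPI cP'I by (intro continuous_intros \<phi>'_cont \<phi>_cont) (auto simp: I_def)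
    qed
    have ci: "integrable lborel (\<lambda>x. indicator I x *\<^sub>R k x)" if "continuous_on I k" for k :: "real \<Rightarrow> real"
      using borel_integrable_compact[of I k] that by (auto simp: I_def scaleR_conv_of_real indicator_def if_distrib cong: if_cong)
    have e: "(LINT x|lborel. k x) = (LINT x|lborel. indicator I x *\<^sub>R k x)"
      if "\<And>x. x \<in> I \<or> k x = 0" for k :: "real \<Rightarrow> real"
      by (intro Bochner_Integration.integral_cong refl) (use that in \<open>auto split: split_indicator\<close>)
    have iA: "integrable lborel (\<lambda>x. indicator I x *\<^sub>R (\<phi> x * ur r0 x))"
      by (intro ci continuous_on_mult \<phi>_cont) (use slice[OF cur] in simp)
    have iB: "integrable lborel (\<lambda>x. indicator I x *\<^sub>R (\<phi> x * P' x))"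
      by (intro ci continuous_on_mult \<phi>_cont cP'I)
    have iC: "integrable lborel (\<lambda>x. indicator I x *\<^sub>R (\<phi>' x * P x))"
      by (intro ci continuous_on_mult \<phi>'_cont cPI)
    have "(LINT x|lborel. indicator I x *\<^sub>R (\<phi> x * h (r0, x))) =
      (LINT x|lborel. indicator I x *\<^sub>R (\<phi> x * ur r0 x)) + (LINT x|lborel. indicator I x *\<^sub>R (\<phi> x * P' x))"
      by (subst Bochner_Integration.integral_add[OF iA iB, symmetric], intro Bochner_Integration.integral_cong refl)
         (simp add: h_def P'_def algebra_simps)
    also have "(LINT x|lborel. indicator I x *\<^sub>R (\<phi> x * ur r0 x)) = (LINT x|lborel. indicator I x *\<^sub>R (\<phi>' x * P x))"
    proof -
      have "x \<in> I \<or> \<phi> x * ur r0 x = 0" "x \<in> I \<or> \<phi>' x * P x = 0" for x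
        using \<phi>I[of x] by auto
      from eq1[symmetric, unfolded e[OF this(1)] e[OF this(2)]] show ?thesis .
    qed
    also have "(LINT x|lborel. indicator I x *\<^sub>R (\<phi>' x * P x)) + (LINT x|lborel. indicator I x *\<^sub>R (\<phi> x * P' x)) =
      (LINT x|lborel. indicator I x *\<^sub>R (\<phi>' x * P x + \<phi> x * P' x))"
      by (subst Bochner_Integration.integral_add[OF iC iB, symmetric], intro Bochner_Integration.integral_cong refl)
         (simp add: algebra_simps)
    also have "\<dots> = 0" unfolding FTC using \<phi>0(1)[of "x0 + e2"] \<phi>0(1)[of "x0 - e2"] by simp
    finally have z: "(LINT x|lborel. indicator I x *\<^sub>R (\<phi> x * h (r0, x))) = 0" .
    define k where "k x = indicator I x *\<^sub>R (\<phi> x * (s * h (r0, x)))" for x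
    have kI: "integrable lborel k"
      unfolding k_def by (intro ci continuous_intros \<phi>_cont slice contU)
    have k0: "0 \<le> k x" for x
    proof (cases "x \<in> I")
      case True
      then have "0 \<le> \<phi> x * (s * h (r0, x))"
        using rect(2)[of r0 x] e1(1) by (intro mult_nonneg_nonneg[OF \<phi>nn less_imp_le]) auto
      then show ?thesis using True by (simp add: k_def)
    qed (simp add: k_def)
    have "(LINT x|lborel. k x) = s * (LINT x|lborel. indicator I x *\<^sub>R (\<phi> x * h (r0, x)))"
      unfolding k_def by (subst integral_mult_right_zero[symmetric]) (auto intro!: Bochner_Integration.integral_cong simp: mult_ac)
    then have "AE x in lborel. k x = 0"
      using z integral_nonneg_eq_0_iff_AE[OF kI] k0 by simp
    moreover have "k x \<noteq> 0" if "x \<in> {x0 - e2<..<x0 + e2}" for x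
    proof -
      have "x \<in> I" using that by (auto simp: I_def)
      moreover have "0 < \<phi> x * (s * h (r0, x))"
        using rect(2)[of r0 x] e1(1) \<open>x \<in> I\<close> by (intro mult_pos_pos[OF \<phi>pos[OF that]]) auto
      ultimately have "0 < k x" by (simp only: k_def indicator_simps scaleR_one)
      then show ?thesis by simp
    qed
    ultimately have "AE x in lborel. x \<notin> {x0 - e2<..<x0 + e2}"
      by (metis (mono_tags, lifting) eventually_mono)
    then have "{x0 - e2<..<x0 + e2} \<in> null_sets lborel" by (subst AE_iff_null_sets) auto
    then have "emeasure lborel {x0 - e2<..<x0 + e2} = 0" by auto
    then show False using e2 by simp
  qed
  then show ?thesis
    unfolding classical_evolution_def
  proof (intro allI impI ballI, elim conjE)
    fix U p
    assume H: "open U" "U \<subseteq> {(r, x). 0 < r \<and> b * r < x}" "\<forall>(r, x)\<in>U. (\<lambda>r. u r x) differentiable (at r)"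
      "\<forall>(r, x)\<in>U. conv_primitive b \<nu> (c r) (u r) differentiable (at x)"
      "continuous_on U (\<lambda>(r, x). deriv (\<lambda>r. u r x) r)" "continuous_on U (\<lambda>(r, x). conv_deriv b \<nu> (c r) (u r) x)"
      and p: "p \<in> U"
    obtain r x where rx: "p = (r, x)" by (cases p)
    have "deriv (\<lambda>r. u r x) r = - conv_deriv b \<nu> (c r) (u r) x"
    proof (rule main[OF H(1,2) _ _ H(5,6) p[unfolded rx]])
      show "(\<lambda>r. u r x) differentiable (at r)" if "(r, x) \<in> U" for r x
        using bspec[OF H(3) that] by simp
      show "conv_primitive b \<nu> (c r) (u r) differentiable (at x)" if "(r, x) \<in> U" for r x
        using bspec[OF H(4) that] by simp
    qed
    then show "case p of (r, x) \<Rightarrow> deriv (\<lambda>r. u r x) r = - conv_deriv b \<nu> (c r) (u r) x"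
      by (simp add: rx)
  qed
qed

section \<open>The law of the subordinator\<close>

text \<open>The possibly defective law on the finite values, as a measure on the real line: with it,
  having a density becomes an equality of measures to which \<open>laplace_unique\<close>
  applies.\<close>

definition finite_law :: "'w measure \<Rightarrow> ('w \<Rightarrow> ennreal) \<Rightarrow> real measure" where
  "finite_law M X = distr (restrict_space M {\<omega>\<in>space M. X \<omega> < \<infinity>}) borel (\<lambda>\<omega>. enn2real (X \<omega>))"

lemma sets_finite_law [simp, measurable_cong]: "sets (finite_law M X) = sets borel"
  by (simp add: finite_law_def)

lemma space_finite_law [simp]: "space (finite_law M X) = UNIV"
  by (simp add: finite_law_def)

lemma nn_integral_finite_law:
  assumes [measurable]: "X \<in> borel_measurable M" "h \<in> borel_measurable borel"
  shows "(\<integral>\<^sup>+y. h y \<partial>finite_law M X) = (\<integral>\<^sup>+\<omega>. (if X \<omega> < \<infinity> then h (enn2real (X \<omega>)) else 0) \<partial>M)"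
proof -
  have "(\<integral>\<^sup>+y. h y \<partial>finite_law M X) = (\<integral>\<^sup>+\<omega>. h (enn2real (X \<omega>)) \<partial>restrict_space M {\<omega>\<in>space M. X \<omega> < \<infinity>})"
    unfolding finite_law_def by (rule nn_integral_distr) (auto intro: measurable_restrict_space1)
  also have "\<dots> = (\<integral>\<^sup>+\<omega>. h (enn2real (X \<omega>)) * indicator {\<omega>\<in>space M. X \<omega> < \<infinity>} \<omega> \<partial>M)"
    by (rule nn_integral_restrict_space) measurable
  also have "\<dots> = (\<integral>\<^sup>+\<omega>. (if X \<omega> < \<infinity> then h (enn2real (X \<omega>)) else 0) \<partial>M)"
    by (intro nn_integral_cong) (auto split: split_indicator)
  finally show ?thesis .
qed

text \<open>Nonnegativity is what allows measurability of \<open>u\<close> to be recovered from that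
  of \<open>ennreal (u x)\<close>.\<close>

lemma finite_part_density_iff:
  assumes [measurable]: "X \<in> borel_measurable M"
  shows "finite_part_density M X u \<longleftrightarrow>
    (\<forall>x. 0 \<le> u x) \<and> u \<in> borel_measurable borel \<and> finite_law M X = density lborel (\<lambda>x. ennreal (u x))"
proof -
  let ?R = "restrict_space M {\<omega>\<in>space M. X \<omega> < \<infinity>}"
  have meas: "(\<lambda>\<omega>. enn2real (X \<omega>)) \<in> measurable ?R lborel"
    by (auto intro: measurable_restrict_space1)
  have d: "distr ?R lborel (\<lambda>\<omega>. enn2real (X \<omega>)) = finite_law M X"
    unfolding finite_law_def by (rule distr_cong) auto
  have u: "u \<in> borel_measurable borel" if "(\<lambda>x. ennreal (u x)) \<in> borel_measurable lborel" "\<forall>x. 0 \<le> u x"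
  proof -
    have "(\<lambda>x. enn2real (ennreal (u x))) \<in> borel_measurable lborel" using that(1) by measurable
    then show ?thesis using that(2) by simp
  qed
  show ?thesis
    unfolding finite_part_density_def distributed_def d using meas u by auto
qed

lemma AE_finite_law_nonneg: "X \<in> borel_measurable M \<Longrightarrow> AE y in finite_law M X. 0 \<le> y"
  unfolding finite_law_def by (subst AE_distr_iff) (auto intro: measurable_restrict_space1)

section \<open>One-dimensional laws of the subordinator\<close>

locale subordinator_process = levy a b N for a b N +
  fixes M :: "'w measure" and \<sigma> :: "real \<Rightarrow> 'w \<Rightarrow> ennreal"
  assumes sub: "subordinator M (bernstein a b N) \<sigma>"
begin

lemma prob_space_M: "prob_space M"
  and \<sigma>_measurable: "0 \<le> t \<Longrightarrow> \<sigma> t \<in> borel_measurable M"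
  and \<sigma>_0: "\<omega> \<in> space M \<Longrightarrow> \<sigma> 0 \<omega> = 0"
  and \<sigma>_mono: "\<omega> \<in> space M \<Longrightarrow> 0 \<le> s \<Longrightarrow> s \<le> t \<Longrightarrow> \<sigma> s \<omega> \<le> \<sigma> t \<omega>"
  and \<sigma>_right_cont: "\<omega> \<in> space M \<Longrightarrow> 0 \<le> t \<Longrightarrow> continuous (at_right t) (\<lambda>r. \<sigma> r \<omega>)"
  and \<sigma>_laplace: "0 \<le> t \<Longrightarrow> 0 < z \<Longrightarrow>
    (LINT \<omega>|M. (if \<sigma> t \<omega> = \<infinity> then 0 else exp (- z * enn2real (\<sigma> t \<omega>)))) = exp (- t * f z)"
  using sub unfolding subordinator_def by blast+

sublocale PM: prob_space M by (rule prob_space_M)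

text \<open>Truncating the time at 0 makes the family total in t, so that measurability in t can be
  stated on the whole line.\<close>

definition law :: "real \<Rightarrow> real measure" where "law t = finite_law M (\<sigma> (max t 0))"

lemma sets_law [simp, measurable_cong]: "sets (law t) = sets borel" and space_law [simp]: "space (law t) = UNIV"
  by (simp_all add: law_def)

lemma \<sigma>_max_measurable [measurable]: "\<sigma> (max t 0) \<in> borel_measurable M"
  by (rule \<sigma>_measurable) simp

lemma law_eq: "0 \<le> t \<Longrightarrow> law t = finite_law M (\<sigma> t)"
  by (simp add: law_def max_def)

lemma nn_integral_law:
  assumes [measurable]: "h \<in> borel_measurable borel"
  shows "(\<integral>\<^sup>+y. h y \<partial>law t) = (\<integral>\<^sup>+\<omega>. (if \<sigma> (max t 0) \<omega> < \<infinity> then h (enn2real (\<sigma> (max t 0) \<omega>)) else 0) \<partial>M)"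
  unfolding law_def by (rule nn_integral_finite_law) measurable

lemma law_UNIV_le: "emeasure (law t) UNIV \<le> 1"
proof -
  have "emeasure (law t) UNIV = (\<integral>\<^sup>+y. 1 \<partial>law t)" by simp
  also have "\<dots> = (\<integral>\<^sup>+\<omega>. (if \<sigma> (max t 0) \<omega> < \<infinity> then 1 else 0) \<partial>M)"
    by (rule nn_integral_law) measurable
  also have "\<dots> \<le> (\<integral>\<^sup>+\<omega>. 1 \<partial>M)" by (intro nn_integral_mono) auto
  also have "\<dots> = 1" by (simp add: PM.emeasure_space_1)
  finally show ?thesis .
qed

lemma finite_measure_law: "finite_measure (law t)"
  by (rule finite_measureI) (use law_UNIV_le[of t] in \<open>auto simp: top_unique\<close>)

lemma sigma_finite_law: "sigma_finite_measure (law t)"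
  using finite_measure_law by (simp add: finite_measure_def)

lemma AE_law_nonneg: "AE y in law t. 0 \<le> y"
  unfolding law_def by (rule AE_finite_law_nonneg) measurable

lemma law_laplace:
  assumes t: "0 \<le> t" and z: "0 < z"
  shows "(\<integral>\<^sup>+y. ennreal (exp (- z * y)) \<partial>law t) = ennreal (exp (- t * f z))"
proof -
  note [measurable] = \<sigma>_measurable[OF t]
  let ?g = "\<lambda>\<omega>. (if \<sigma> t \<omega> = \<infinity> then 0 else exp (- z * enn2real (\<sigma> t \<omega>)))"
  have "integrable M ?g"
    by (rule PM.integrable_const_bound[of _ 1]) (use z in auto)
  then have "(\<integral>\<^sup>+\<omega>. ennreal (?g \<omega>) \<partial>M) = ennreal (exp (- t * f z))"
    by (subst nn_integral_eq_integral) (simp_all only: \<sigma>_laplace[OF t z], auto)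
  moreover have "(\<integral>\<^sup>+y. ennreal (exp (- z * y)) \<partial>law t) = (\<integral>\<^sup>+\<omega>. ennreal (?g \<omega>) \<partial>M)"
    unfolding law_eq[OF t]
    by (subst nn_integral_finite_law) (auto intro!: nn_integral_cong simp: less_top[symmetric])
  ultimately show ?thesis by simp
qed

lemma law_Chernoff:
  assumes t: "0 \<le> t" and z: "0 < z"
  shows "emeasure (law t) {..s} \<le> ennreal (exp (z * s - t * f z))"
proof -
  have "emeasure (law t) {..s} = (\<integral>\<^sup>+y. indicator {..s} y \<partial>law t)" by simp
  also have "\<dots> \<le> (\<integral>\<^sup>+y. ennreal (exp (z * s)) * ennreal (exp (- z * y)) \<partial>law t)"
    using z by (intro nn_integral_mono)
      (auto simp: ennreal_mult[symmetric] exp_add[symmetric] mult_left_mono split: split_indicator simp del: ennreal_1 simp: ennreal_1[symmetric] intro!: ennreal_leI)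
  also have "\<dots> = ennreal (exp (z * s)) * ennreal (exp (- t * f z))"
    by (subst nn_integral_cmult) (simp_all only: law_laplace[OF t z], measurable)
  also have "\<dots> = ennreal (exp (z * s - t * f z))"
    by (simp add: ennreal_mult[symmetric] exp_add[symmetric])
  finally show ?thesis .
qed

text \<open>At \<open>s = b * t\<close> the Chernoff exponent is \<open>- t * (f z - b * z)\<close>,
  which \<open>f_unbounded\<close> makes as negative as desired. In particular there is no atom on
  the drift line.\<close>

lemma law_Iic_drift: assumes t: "0 < t" shows "emeasure (law t) {..b * t} = 0"
proof -
  have "emeasure (law t) {..b * t} \<le> 0 + ennreal e" if e: "0 < e" for e
  proof -
    obtain z where z: "0 < z" "- ln e / t \<le> f z - b * z" using f_unbounded by blast
    then have "- ln e \<le> t * (f z - b * z)" using t by (simp add: field_simps)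
    then have "exp (z * (b * t) - t * f z) \<le> exp (ln e)" by (simp add: algebra_simps)
    then have "ennreal (exp (z * (b * t) - t * f z)) \<le> ennreal e" using e by (intro ennreal_leI) simp
    with law_Chernoff[of t z "b * t"] t z(1) show ?thesis by (auto intro: order_trans)
  qed
  then have "emeasure (law t) {..b * t} \<le> 0" by (rule ennreal_le_epsilon) auto
  then show ?thesis by simp
qed

lemma AE_law_drift: assumes t: "0 < t" shows "AE y in law t. b * t < y"
  by (rule AE_I[of _ _ "{..b * t}"]) (use law_Iic_drift[OF t] in \<open>auto simp: not_less\<close>)

text \<open>By monotonicity and right-continuity, the path is below c at time t iff it is below c at
  some rational time after t. This writes the sublevel set as a countable union of
  rectangles.\<close>

lemma joint_measurable [measurable]: "(\<lambda>p. \<sigma> (max (fst p) 0) (snd p)) \<in> borel_measurable (borel \<Otimes>\<^sub>M M)"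
proof (rule borel_measurableI_less)
  fix c :: ennreal
  have "{p \<in> space (borel \<Otimes>\<^sub>M M). \<sigma> (max (fst p) 0) (snd p) < c} =
    (\<Union>q\<in>\<rat> \<inter> {0<..}. {p \<in> space (borel \<Otimes>\<^sub>M M). max (fst p) 0 < q \<and> \<sigma> (max q 0) (snd p) < c})"
  proof (intro set_eqI iffI)
    fix p :: "real \<times> 'w" assume p: "p \<in> {p \<in> space (borel \<Otimes>\<^sub>M M). \<sigma> (max (fst p) 0) (snd p) < c}"
    define t where "t = max (fst p) 0"
    have \<omega>: "snd p \<in> space M" and t: "0 \<le> t" using p by (auto simp: space_pair_measure t_def)
    have "((\<lambda>r. \<sigma> r (snd p)) \<longlongrightarrow> \<sigma> t (snd p)) (at_right t)"
      using \<sigma>_right_cont[OF \<omega> t] by (simp add: continuous_within)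
    then have "\<forall>\<^sub>F r in at_right t. \<sigma> r (snd p) < c"
      using p by (intro order_tendstoD) (auto simp: t_def)
    then obtain d where d: "t < d" "\<And>r. t < r \<Longrightarrow> r < d \<Longrightarrow> \<sigma> r (snd p) < c"
      by (auto simp: eventually_at_right_field)
    obtain q where q: "q \<in> \<rat>" "t < q" "q < d" using Rats_dense_in_real[OF d(1)] by auto
    then show "p \<in> (\<Union>q\<in>\<rat> \<inter> {0<..}. {p \<in> space (borel \<Otimes>\<^sub>M M). max (fst p) 0 < q \<and> \<sigma> (max q 0) (snd p) < c})"
    proof -
      have "max (fst p) 0 < q" using q(2) by (simp add: t_def)
      moreover have "\<sigma> (max q 0) (snd p) < c" using d(2)[of q] q(2,3) t by (simp add: max_def)
      ultimately show ?thesis using p q(1,2) t by (intro UN_I[of q]) auto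
    qed
  next
    fix p :: "real \<times> 'w"
    assume "p \<in> (\<Union>q\<in>\<rat> \<inter> {0<..}. {p \<in> space (borel \<Otimes>\<^sub>M M). max (fst p) 0 < q \<and> \<sigma> (max q 0) (snd p) < c})"
    then obtain q where q: "p \<in> space (borel \<Otimes>\<^sub>M M)" "max (fst p) 0 < q" "\<sigma> (max q 0) (snd p) < c" by blast
    then have "\<sigma> (max (fst p) 0) (snd p) \<le> \<sigma> (max q 0) (snd p)"
      by (intro \<sigma>_mono) (auto simp: space_pair_measure)
    with q show "p \<in> {p \<in> space (borel \<Otimes>\<^sub>M M). \<sigma> (max (fst p) 0) (snd p) < c}" by auto
  qed
  also have "\<dots> \<in> sets (borel \<Otimes>\<^sub>M M)"
  proof (rule sets.countable_UN'')
    show "countable (\<rat> \<inter> {0<..} :: real set)" using countable_rat by auto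
    show "{p \<in> space (borel \<Otimes>\<^sub>M M). max (fst p) 0 < q \<and> \<sigma> (max q 0) (snd p) < c} \<in> sets (borel \<Otimes>\<^sub>M M)" for q
      by measurable
  qed
  finally show "{p \<in> space (borel \<Otimes>\<^sub>M M). \<sigma> (max (fst p) 0) (snd p) < c} \<in> sets (borel \<Otimes>\<^sub>M M)" .
qed

text \<open>Here the integrating measure varies with the parameter. Rewriting the integral as an
  expectation over the fixed space \<open>M\<close> reduces the claim to
  \<open>joint_measurable\<close>.\<close>

lemma nn_integral_law_measurable:
  assumes [measurable]: "g \<in> borel_measurable M'" "case_prod h \<in> borel_measurable (M' \<Otimes>\<^sub>M borel)"
  shows "(\<lambda>x. \<integral>\<^sup>+y. h x y \<partial>law (g x)) \<in> borel_measurable M'"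
proof -
  have [measurable]: "(\<lambda>p. \<sigma> (max (g (fst p)) 0) (snd p)) \<in> borel_measurable (M' \<Otimes>\<^sub>M M)"
    using measurable_compose[OF _ joint_measurable, of "\<lambda>p. (g (fst p), snd p)" "M' \<Otimes>\<^sub>M M"] by simp
  have eq: "(\<integral>\<^sup>+y. h x y \<partial>law (g x)) = (\<integral>\<^sup>+\<omega>. (if \<sigma> (max (g x) 0) \<omega> < \<infinity> then h x (enn2real (\<sigma> (max (g x) 0) \<omega>)) else 0) \<partial>M)"
    if "x \<in> space M'" for x
    using that by (intro nn_integral_law) measurable
  have "(\<lambda>x. \<integral>\<^sup>+\<omega>. (if \<sigma> (max (g x) 0) \<omega> < \<infinity> then h x (enn2real (\<sigma> (max (g x) 0) \<omega>)) else 0) \<partial>M) \<in> borel_measurable M'"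
    by (rule PM.borel_measurable_nn_integral) (simp add: case_prod_unfold)
  then show ?thesis
    by (rule measurable_cong[THEN iffD2, rotated]) (rule eq)
qed

definition sb_conv :: "real \<Rightarrow> real \<Rightarrow> ennreal" where "sb_conv t x = (\<integral>\<^sup>+y. sb_levy (x - y) \<partial>law t)"
text \<open>The size-bias identity \<open>law_size_bias\<close> solved for the density, at every
  point instead of almost everywhere. The values are extended, since the convolution may be infinite
  on a null set.\<close>

definition ext_density :: "real \<Rightarrow> real \<Rightarrow> ennreal" where
  "ext_density t x = (if b * t < x then ennreal (t / (x - b * t)) * sb_conv t x else 0)"

lemma sb_conv_measurable [measurable (raw)]:
  assumes [measurable]: "g \<in> borel_measurable M'" "h \<in> borel_measurable M'"
  shows "(\<lambda>x. sb_conv (g x) (h x)) \<in> borel_measurable M'"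
  unfolding sb_conv_def by (rule nn_integral_law_measurable) measurable

lemma ext_density_measurable [measurable (raw)]:
  assumes [measurable]: "g \<in> borel_measurable M'" "h \<in> borel_measurable M'"
  shows "(\<lambda>x. ext_density (g x) (h x)) \<in> borel_measurable M'"
  unfolding ext_density_def by measurable

lemma sb_conv_zero: assumes "0 < t" "x \<le> b * t" shows "sb_conv t x = 0"
proof -
  have "AE y in law t. sb_levy (x - y) = 0"
    using AE_law_drift[OF assms(1)] by eventually_elim (use assms in \<open>auto intro: sb_levy_nonpos\<close>)
  then show ?thesis unfolding sb_conv_def by (subst nn_integral_0_iff_AE) auto
qed

lemma times_exp_bound: "0 < c \<Longrightarrow> 0 \<le> y \<Longrightarrow> y * exp (- c * y) \<le> 1 / c" for c y :: real
proof -
  assume c: "0 < c" "0 \<le> y"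
  have "c * y \<le> exp (c * y)" using exp_ge_add_one_self[of "c * y"] by linarith
  then show ?thesis using c by (simp add: exp_minus field_simps)
qed

text \<open>Obtained by differentiating the Laplace transform \<open>exp (- t * f z)\<close> in z
  under the integral; as for \<open>f_deriv\<close>, the radius \<open>z / 2\<close> keeps the
  exponent bounded away from 0.\<close>

lemma law_first_moment:
  assumes t: "0 < t" and z: "0 < z"
  shows "integrable (law t) (\<lambda>y. y * exp (- z * y))" "(LINT y|law t. y * exp (- z * y)) = t * f' z * exp (- t * f z)"
    "integrable (law t) (\<lambda>y. exp (- z * y))" "(LINT y|law t. exp (- z * y)) = exp (- t * f z)"
proof -
  interpret L: finite_measure "law t" by (rule finite_measure_law)
  have i1: "integrable (law t) (\<lambda>y. y * exp (- c * y))" if c: "0 < c" for c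
  proof (rule L.integrable_const_bound[of _ "1 / c"])
    show "AE y in law t. norm (y * exp (- c * y)) \<le> 1 / c"
      using AE_law_nonneg by eventually_elim (use times_exp_bound[OF c] in auto)
  qed simp
  show "integrable (law t) (\<lambda>y. y * exp (- z * y))" by (rule i1[OF z])
  have i0: "integrable (law t) (\<lambda>y. exp (- c * y))" if c: "0 < c" for c
  proof (rule L.integrable_const_bound[of _ 1])
    show "AE y in law t. norm (exp (- c * y)) \<le> 1"
      using AE_law_nonneg by eventually_elim (use c in auto)
  qed simp
  show "integrable (law t) (\<lambda>y. exp (- z * y))" by (rule i0[OF z])
  have L0: "(LINT y|law t. exp (- c * y)) = exp (- t * f c)" if c: "0 < c" for c
    using t law_laplace[of t c] c by (subst integral_eq_nn_integral) simp_all
  show "(LINT y|law t. exp (- z * y)) = exp (- t * f z)" by (rule L0[OF z])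
  have "((\<lambda>z. LINT y|law t. exp (- z * y)) has_real_derivative (LINT y|law t. - y * exp (- z * y))) (at z)"
  proof (rule has_real_derivative_integral[where e="z/2" and w="\<lambda>y. y * exp (- (z/2) * y)"])
    show "integrable (law t) (\<lambda>y. exp (- w * y))" if "\<bar>w - z\<bar> < z / 2" for w
      using that by (intro i0) linarith
    show "AE y in law t. \<forall>w. \<bar>w - z\<bar> < z / 2 \<longrightarrow>
        ((\<lambda>z. exp (- z * y)) has_real_derivative - y * exp (- w * y)) (at w) \<and>
        \<bar>- y * exp (- w * y)\<bar> \<le> y * exp (- (z / 2) * y)"
      using AE_law_nonneg
    proof eventually_elim
      case (elim y)
      have "z / 2 * y \<le> w * y" if "\<bar>w - z\<bar> < z / 2" for w
        using that elim by (intro mult_right_mono) linarith+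
      with elim show ?case by (auto intro!: derivative_eq_intros simp: abs_mult intro!: mult_left_mono)
    qed
    show "integrable (law t) (\<lambda>y. y * exp (- (z / 2) * y))" using z by (intro i1) auto
  qed (use z in auto)
  moreover have "((\<lambda>z. LINT y|law t. exp (- z * y)) has_real_derivative - t * f' z * exp (- t * f z)) (at z)"
  proof (rule has_field_derivative_transform_within_open[where S="{0<..}" and f="\<lambda>z. exp (- t * f z)"])
    show "((\<lambda>z. exp (- t * f z)) has_real_derivative - t * f' z * exp (- t * f z)) (at z)"
      by (auto intro!: derivative_eq_intros f_deriv[OF z])
  qed (use z L0 in auto)
  ultimately have "(LINT y|law t. - y * exp (- z * y)) = - t * f' z * exp (- t * f z)"
    by (rule DERIV_unique)
  then show "(LINT y|law t. y * exp (- z * y)) = t * f' z * exp (- t * f z)" by simp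
qed

text \<open>In terms of Laplace transforms this is the derivative in \<open>z\<close> of \<open>exp (- t * f z)\<close>. It is the source of
  all absolute continuity, and of a version of the density that is good for every \<open>t\<close> and, as a
  function of \<open>t\<close>, for every \<open>x\<close>.\<close>

lemma law_size_bias:
  assumes t: "0 < t"
  shows "density (law t) (\<lambda>y. ennreal (y - b * t)) = density lborel (\<lambda>x. ennreal t * sb_conv t x)"
proof (rule laplace_unique)
  show "AE y in density (law t) (\<lambda>y. ennreal (y - b * t)). 0 \<le> y"
    using AE_law_nonneg[of t] by (subst AE_density) auto
  show "AE x in density lborel (\<lambda>x. ennreal t * sb_conv t x). 0 \<le> x"
  proof -
    have "0 \<le> x" if "0 < ennreal t * sb_conv t x" for x
    proof (rule ccontr)
      assume "\<not> 0 \<le> x"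
      then have "x \<le> b * t" using b_nonneg t by (meson mult_nonneg_nonneg less_imp_le not_le order_trans)
      then show False using sb_conv_zero[OF t] that by simp
    qed
    then show ?thesis by (subst AE_density) auto
  qed
  have A: "(\<integral>\<^sup>+y. ennreal (exp (- z * y)) \<partial>density (law t) (\<lambda>y. ennreal (y - b * t))) = ennreal (t * (f' z - b) * exp (- t * f z))"
    if z: "0 < z" for z
  proof -
    have "(\<integral>\<^sup>+y. ennreal (exp (- z * y)) \<partial>density (law t) (\<lambda>y. ennreal (y - b * t))) =
      (\<integral>\<^sup>+y. ennreal (y - b * t) * ennreal (exp (- z * y)) \<partial>law t)"
      by (rule nn_integral_density) measurable
    also have "\<dots> = (\<integral>\<^sup>+y. ennreal ((y - b * t) * exp (- z * y)) \<partial>law t)"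
      by (intro nn_integral_cong) (simp add: ennreal_mult'')
    also have "\<dots> = ennreal (LINT y|law t. (y - b * t) * exp (- z * y))"
    proof (rule nn_integral_eq_integral)
      show "integrable (law t) (\<lambda>y. (y - b * t) * exp (- z * y))"
        unfolding left_diff_distrib using law_first_moment[OF t z] by (intro Bochner_Integration.integrable_diff integrable_mult_right)
      show "AE y in law t. 0 \<le> (y - b * t) * exp (- z * y)"
        using AE_law_drift[OF t] by eventually_elim auto
    qed
    also have "(LINT y|law t. (y - b * t) * exp (- z * y)) = t * f' z * exp (- t * f z) - b * t * exp (- t * f z)"
      unfolding left_diff_distrib using law_first_moment[OF t z]
      by (subst Bochner_Integration.integral_diff) (auto intro: integrable_mult_right)
    finally show ?thesis by (simp add: algebra_simps)
  qed
  have B: "(\<integral>\<^sup>+y. ennreal (exp (- z * y)) \<partial>density lborel (\<lambda>x. ennreal t * sb_conv t x)) = ennreal (t * (f' z - b) * exp (- t * f z))"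
    if z: "0 < z" for z
  proof -
    have "(\<integral>\<^sup>+y. ennreal (exp (- z * y)) \<partial>density lborel (\<lambda>x. ennreal t * sb_conv t x)) =
      (\<integral>\<^sup>+y. ennreal t * sb_conv t y * ennreal (exp (- z * y)) \<partial>lborel)"
      by (rule nn_integral_density) measurable
    also have "\<dots> = ennreal t * (\<integral>\<^sup>+x. ennreal (exp (- z * x)) * sb_conv t x \<partial>lborel)"
      by (subst nn_integral_cmult[symmetric]) (auto simp: mult_ac)
    also have "(\<integral>\<^sup>+x. ennreal (exp (- z * x)) * sb_conv t x \<partial>lborel) = ennreal (f' z - b) * ennreal (exp (- t * f z))"
      unfolding sb_conv_def using t
      by (subst nn_integral_conv_exp[OF _ _ sigma_finite_law]) (simp_all only: sb_levy_laplace[OF z] law_laplace[OF less_imp_le[OF t] z] sb_levy_measurable sets_law)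
    also have "ennreal t * (ennreal (f' z - b) * ennreal (exp (- t * f z))) = ennreal (t * (f' z - b) * exp (- t * f z))"
      using t f'_ge[OF z] by (simp add: ennreal_mult[symmetric] mult.assoc)
    finally show ?thesis .
  qed
  show "(\<integral>\<^sup>+x. ennreal (exp (- (real j + 1) * x)) \<partial>density (law t) (\<lambda>y. ennreal (y - b * t))) =
    (\<integral>\<^sup>+x. ennreal (exp (- (real j + 1) * x)) \<partial>density lborel (\<lambda>x. ennreal t * sb_conv t x))" for j :: nat
    by (subst A, simp, subst B) simp_all
  show "(\<integral>\<^sup>+x. ennreal (exp (- x)) \<partial>density (law t) (\<lambda>y. ennreal (y - b * t))) < \<infinity>"
    using A[of 1] by simp
qed auto

text \<open>Divides \<open>law_size_bias\<close> by \<open>y - b * t\<close>, which is positive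
  almost surely; a part of the law at or below the drift line would be lost here.\<close>

lemma law_density: assumes t: "0 < t" shows "law t = density lborel (ext_density t)"
proof -
  define g where "g x = (if b * t < x then ennreal (1 / (x - b * t)) else 0)" for x
  have [measurable]: "g \<in> borel_measurable borel" unfolding g_def by measurable
  have "law t = density (law t) (\<lambda>_. 1)" by (rule density_1[symmetric])
  also have "\<dots> = density (law t) (\<lambda>y. ennreal (y - b * t) * g y)"
  proof (rule density_cong)
    show "AE y in law t. 1 = ennreal (y - b * t) * g y"
      using AE_law_drift[OF t] by eventually_elim (simp add: g_def ennreal_mult[symmetric])
  qed measurable
  also have "\<dots> = density (density (law t) (\<lambda>y. ennreal (y - b * t))) g"
    by (subst density_density_eq) auto
  also have "\<dots> = density (density lborel (\<lambda>x. ennreal t * sb_conv t x)) g"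
    by (simp only: law_size_bias[OF t])
  also have "\<dots> = density lborel (\<lambda>x. (ennreal t * sb_conv t x) * g x)"
    by (subst density_density_eq) auto
  also have "(\<lambda>x. (ennreal t * sb_conv t x) * g x) = ext_density t"
    using t by (auto simp: fun_eq_iff ext_density_def g_def ennreal_mult divide_ennreal[symmetric] ennreal_mult'' mult_ac divide_inverse)
  finally show ?thesis .
qed

text \<open>At points where \<open>ext_density\<close> is infinite this takes the value 0; those
  points form a null set for each t > 0.\<close>

definition sub_density :: "real \<Rightarrow> real \<Rightarrow> real" where "sub_density t x = enn2real (ext_density t x)"

lemma AE_ext_density_finite: assumes t: "0 < t" shows "AE x in lborel. ennreal (sub_density t x) = ext_density t x"
proof -
  have "(\<integral>\<^sup>+x. ext_density t x \<partial>lborel) = emeasure (law t) UNIV"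
    by (simp add: law_density[OF t] emeasure_density)
  then have "(\<integral>\<^sup>+x. ext_density t x \<partial>lborel) \<noteq> \<infinity>" using law_UNIV_le[of t] by (auto simp: top_unique)
  then have "AE x in lborel. ext_density t x \<noteq> \<infinity>" by (intro nn_integral_PInf_AE) auto
  then show ?thesis by eventually_elim (simp add: sub_density_def less_top[symmetric])
qed

lemma sub_density_finite_part_density: assumes t: "0 < t" shows "finite_part_density M (\<sigma> t) (sub_density t)"
proof -
  have "density lborel (\<lambda>x. ennreal (sub_density t x)) = density lborel (ext_density t)"
    by (rule density_cong) (use AE_ext_density_finite[OF t] in \<open>auto simp: sub_density_def\<close>)
  moreover have "sub_density t \<in> borel_measurable borel" unfolding sub_density_def[abs_def] by measurable
  ultimately show ?thesis
    using \<sigma>_measurable[of t] t law_density[OF t] law_eq[of t]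
    by (subst finite_part_density_iff) (auto simp: sub_density_def)
qed

text \<open>\<open>u\<close> is an arbitrary version, so everything derived from this lemma is
  independent of the choice made in \<open>sub_density\<close>.\<close>

lemma density_laplace:
  assumes t: "0 < t" and u: "finite_part_density M (\<sigma> t) u"
  shows "laplace_density u (\<lambda>z. exp (- t * f z))" "AE x in lborel. x \<le> b * t \<longrightarrow> u x = 0"
    "law t = density lborel (\<lambda>x. ennreal (u x))"
proof -
  have meas: "\<sigma> t \<in> borel_measurable M" using t by (intro \<sigma>_measurable) auto
  from u have u0: "\<And>x. 0 \<le> u x" and [measurable]: "u \<in> borel_measurable borel" and l: "law t = density lborel (\<lambda>x. ennreal (u x))"
    using t by (auto simp: finite_part_density_iff[OF meas] law_eq)
  show "law t = density lborel (\<lambda>x. ennreal (u x))" by (rule l)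
  show AE: "AE x in lborel. x \<le> b * t \<longrightarrow> u x = 0"
    using AE_law_drift[OF t] u0 unfolding l
    by (subst (asm) AE_density) (auto elim!: eventually_mono simp: ennreal_less_zero_iff not_less intro: antisym)
  show "laplace_density u (\<lambda>z. exp (- t * f z))"
    unfolding laplace_density_def
  proof (intro conjI allI impI u0)
    show "AE x in lborel. x \<le> 0 \<longrightarrow> u x = 0"
      using AE by eventually_elim (use t b_nonneg in \<open>auto intro: order_trans mult_nonneg_nonneg\<close>)
    show "(\<integral>\<^sup>+x. ennreal (exp (- z * x)) * ennreal (u x) \<partial>lborel) = ennreal (exp (- t * f z))" if z: "0 < z" for z
      using law_laplace[of t z] t z unfolding l by (subst (asm) nn_integral_density) (auto simp: mult.commute)
  qed auto
qed

end

section \<open>The law of the inverse\<close>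

text \<open>Lets a property known for almost every time be used along times decreasing to a
  prescribed one. The bound \<open>t + 1\<close> provides common dominating functions.\<close>

lemma AE_lborel_right_sequence:
  assumes "AE t in lborel. P (t::real)"
  obtains X where "\<And>n. P (X n)" "\<And>n. t < X n" "\<And>n. X n \<le> t + 1" "X \<longlonglongrightarrow> t"
proof -
  have "\<exists>x. P x \<and> t < x \<and> x < t + 1 / (real n + 1)" for n
  proof (rule ccontr)
    assume H: "\<nexists>x. P x \<and> t < x \<and> x < t + 1 / (real n + 1)"
    have "AE x in lborel. x \<notin> {t<..<t + 1 / (real n + 1)}"
      using assms by eventually_elim (use H in auto)
    then have "{t<..<t + 1 / (real n + 1)} \<in> null_sets lborel" by (subst AE_iff_null_sets) auto
    then have "emeasure lborel {t<..<t + 1 / (real n + 1)} = 0" by auto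
    then show False by simp
  qed
  then obtain X where X: "\<And>n. P (X n)" "\<And>n. t < X n" "\<And>n. X n < t + 1 / (real n + 1)" by metis
  have "X \<longlonglongrightarrow> t"
  proof (rule tendsto_sandwich)
    show "(\<lambda>n. t) \<longlonglongrightarrow> t" by simp
    show "(\<lambda>n. t + 1 / (real n + 1)) \<longlonglongrightarrow> t"
      using tendsto_add[OF tendsto_const LIMSEQ_inverse_real_of_nat, of t]
      by (simp add: inverse_eq_divide add.commute)
    show "\<forall>\<^sub>F n in sequentially. t \<le> X n" "\<forall>\<^sub>F n in sequentially. X n \<le> t + 1 / (real n + 1)"
      using X(2,3) by (auto intro!: always_eventually less_imp_le)
  qed
  moreover have "X n \<le> t + 1" for n
  proof -
    have "1 / (real n + 1) \<le> 1" by simp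
    then show ?thesis using X(3)[of n] by linarith
  qed
  ultimately show thesis using X that by blast
qed

section \<open>The inverse: paths, double Laplace transform and density\<close>

context subordinator_process
begin

abbreviation L :: "real \<Rightarrow> 'w \<Rightarrow> ennreal" where "L \<equiv> inverse_subordinator \<sigma>"

lemma L_less_iff: "L t \<omega> < x \<longleftrightarrow> (\<exists>s>0. ennreal s < x \<and> ennreal t < \<sigma> s \<omega>)"
  unfolding inverse_subordinator_def Inf_less_iff by auto

lemma L_le: "0 < x \<Longrightarrow> ennreal t < \<sigma> x \<omega> \<Longrightarrow> L t \<omega> \<le> ennreal x"
  unfolding inverse_subordinator_def by (rule Inf_lower) auto

lemma L_mono: "t \<le> t' \<Longrightarrow> L t \<omega> \<le> L t' \<omega>"
  unfolding inverse_subordinator_def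
  by (rule Inf_superset_mono) (auto intro: le_less_trans[OF ennreal_leI])

lemma less_L_imp: assumes "\<omega> \<in> space M" "0 < x" "L t \<omega> < ennreal x" shows "ennreal t < \<sigma> x \<omega>"
proof -
  obtain s where s: "0 < s" "ennreal s < ennreal x" "ennreal t < \<sigma> s \<omega>"
    using assms(3) by (auto simp: L_less_iff)
  then have "\<sigma> s \<omega> \<le> \<sigma> x \<omega>" using assms by (intro \<sigma>_mono) (auto simp: ennreal_less_iff)
  with s show ?thesis by auto
qed

text \<open>A real passage time below c can be replaced by a slightly larger rational one still
  below c, because paths are nondecreasing.\<close>

lemma L_joint_measurable: "(\<lambda>p. L (fst p) (snd p)) \<in> borel_measurable (borel \<Otimes>\<^sub>M M)"
proof (rule borel_measurableI_less)
  fix c :: ennreal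
  have "{p \<in> space (borel \<Otimes>\<^sub>M M). L (fst p) (snd p) < c} =
    (\<Union>q\<in>\<rat> \<inter> {q. 0 < q \<and> ennreal q < c}. {p \<in> space (borel \<Otimes>\<^sub>M M). ennreal (fst p) < \<sigma> (max q 0) (snd p)})"
  proof (intro set_eqI iffI)
    fix p :: "real \<times> 'w" assume p: "p \<in> {p \<in> space (borel \<Otimes>\<^sub>M M). L (fst p) (snd p) < c}"
    then obtain s where s: "0 < s" "ennreal s < c" "ennreal (fst p) < \<sigma> s (snd p)" by (auto simp: L_less_iff)
    obtain s' where s': "ennreal s < s'" "s' < c" using dense[OF s(2)] by blast
    then have "s' < \<infinity>" by (auto intro: less_le_trans simp: top_greatest)
    then have s'_eq: "s' = ennreal (enn2real s')" by simp
    then have "s < enn2real s'" using s'(1) s(1) s'_eq ennreal_less_iff[of s "enn2real s'"] by simp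
    then obtain q where q: "q \<in> \<rat>" "s < q" "q < enn2real s'" using Rats_dense_in_real by blast
    have "ennreal q < c"
    proof -
      have "ennreal q < ennreal (enn2real s')" using q s(1) by (intro ennreal_lessI) auto
      then show ?thesis using s'(2) s'_eq by simp
    qed
    moreover have "ennreal (fst p) < \<sigma> (max q 0) (snd p)"
      using \<sigma>_mono[of "snd p" s "max q 0"] p q s by (auto simp: space_pair_measure intro: less_le_trans)
    ultimately show "p \<in> (\<Union>q\<in>\<rat> \<inter> {q. 0 < q \<and> ennreal q < c}. {p \<in> space (borel \<Otimes>\<^sub>M M). ennreal (fst p) < \<sigma> (max q 0) (snd p)})"
      using q s p by (intro UN_I[of q]) auto
  next
    fix p :: "real \<times> 'w"
    assume "p \<in> (\<Union>q\<in>\<rat> \<inter> {q. 0 < q \<and> ennreal q < c}. {p \<in> space (borel \<Otimes>\<^sub>M M). ennreal (fst p) < \<sigma> (max q 0) (snd p)})"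
    then obtain q where "p \<in> space (borel \<Otimes>\<^sub>M M)" "0 < q" "ennreal q < c" "ennreal (fst p) < \<sigma> (max q 0) (snd p)" by blast
    then show "p \<in> {p \<in> space (borel \<Otimes>\<^sub>M M). L (fst p) (snd p) < c}" by (auto simp: L_less_iff max_def)
  qed
  also have "\<dots> \<in> sets (borel \<Otimes>\<^sub>M M)"
  proof (rule sets.countable_UN'')
    show "countable (\<rat> \<inter> {q. 0 < q \<and> ennreal q < c})" using countable_rat by auto
    show "{p \<in> space (borel \<Otimes>\<^sub>M M). ennreal (fst p) < \<sigma> (max q 0) (snd p)} \<in> sets (borel \<Otimes>\<^sub>M M)" for q by measurable
  qed
  finally show "{p \<in> space (borel \<Otimes>\<^sub>M M). L (fst p) (snd p) < c} \<in> sets (borel \<Otimes>\<^sub>M M)" .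
qed

lemma L_measurable [measurable]: "L t \<in> borel_measurable M"
  using measurable_compose[OF _ L_joint_measurable, of "\<lambda>\<omega>. (t, \<omega>)" M] by simp

text \<open>If \<open>L t \<omega> < c\<close>, some s below c has
  \<open>\<sigma> s \<omega>\<close> strictly above t, hence also above all times close to t. The
  opposite inequality is monotonicity in t.\<close>

lemma L_right_continuous:
  assumes "X \<longlonglongrightarrow> t" "\<And>n. t \<le> X n"
  shows "(\<lambda>n. L (X n) \<omega>) \<longlonglongrightarrow> L t \<omega>"
proof (rule order_tendstoI)
  fix c assume "c < L t \<omega>"
  then show "\<forall>\<^sub>F n in sequentially. c < L (X n) \<omega>"
    by (intro always_eventually allI less_le_trans[OF _ L_mono[OF assms(2)]])
next
  fix c assume "L t \<omega> < c"
  then obtain s where s: "0 < s" "ennreal s < c" "ennreal t < \<sigma> s \<omega>" by (auto simp: L_less_iff)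
  have "\<forall>\<^sub>F n in sequentially. ennreal (X n) < \<sigma> s \<omega>"
    by (rule order_tendstoD(2)[OF tendsto_ennrealI[OF assms(1)] s(3)])
  then show "\<forall>\<^sub>F n in sequentially. L (X n) \<omega> < c"
    by eventually_elim (use s in \<open>auto simp: L_less_iff\<close>)
qed

definition inverse_law :: "real \<Rightarrow> real measure" where "inverse_law t = finite_law M (L t)"

lemma sets_inverse_law [simp, measurable_cong]: "sets (inverse_law t) = sets borel" and space_inverse_law [simp]: "space (inverse_law t) = UNIV"
  by (simp_all add: inverse_law_def)

lemma nn_integral_inverse_law:
  assumes [measurable]: "h \<in> borel_measurable borel"
  shows "(\<integral>\<^sup>+l. h l \<partial>inverse_law t) = (\<integral>\<^sup>+\<omega>. (if L t \<omega> < \<infinity> then h (enn2real (L t \<omega>)) else 0) \<partial>M)"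
  unfolding inverse_law_def by (rule nn_integral_finite_law) measurable

lemma nn_integral_inverse_law_measurable:
  assumes [measurable]: "h \<in> borel_measurable borel"
  shows "(\<lambda>t. \<integral>\<^sup>+l. h l \<partial>inverse_law t) \<in> borel_measurable borel"
proof -
  have [measurable]: "(\<lambda>p. L (fst p) (snd p)) \<in> borel_measurable (borel \<Otimes>\<^sub>M M)" by (rule L_joint_measurable)
  show ?thesis
    unfolding nn_integral_inverse_law[OF assms]
    by (rule PM.borel_measurable_nn_integral) (simp add: case_prod_unfold)
qed

lemma AE_inverse_law_nonneg: "AE l in inverse_law t. 0 \<le> l"
  unfolding inverse_law_def by (rule AE_finite_law_nonneg) measurable

text \<open>The integrands vary with n because the weight \<open>X n - b * l\<close> does. Once
  \<open>L t \<omega>\<close> is infinite it stays so at later times, hence the infinite values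
  cause no discontinuity.\<close>

lemma inverse_law_right_continuous:
  assumes [measurable]: "\<And>n. h n \<in> borel_measurable borel" "k \<in> borel_measurable borel"
    and lim: "\<And>l l0. (\<And>n. 0 \<le> l n) \<Longrightarrow> l \<longlonglongrightarrow> l0 \<Longrightarrow> (\<lambda>n. h n (l n)) \<longlonglongrightarrow> k l0"
    and bound: "\<And>n l. 0 \<le> l \<Longrightarrow> h n l \<le> ennreal C"
    and X: "X \<longlonglongrightarrow> t" "\<And>n. t \<le> X n"
  shows "(\<lambda>n. \<integral>\<^sup>+l. h n l \<partial>inverse_law (X n)) \<longlonglongrightarrow> (\<integral>\<^sup>+l. k l \<partial>inverse_law t)"
  unfolding nn_integral_inverse_law[OF assms(1)] nn_integral_inverse_law[OF assms(2)]
proof (rule nn_integral_dominated_convergence[where w="\<lambda>_. ennreal C"])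
  show "(\<integral>\<^sup>+\<omega>. ennreal C \<partial>M) < \<infinity>" by (simp add: PM.emeasure_space_1)
  show "AE \<omega> in M. (if L (X n) \<omega> < \<infinity> then h n (enn2real (L (X n) \<omega>)) else 0) \<le> ennreal C" for n
    using bound by auto
  show "AE \<omega> in M. (\<lambda>n. if L (X n) \<omega> < \<infinity> then h n (enn2real (L (X n) \<omega>)) else 0) \<longlonglongrightarrow>
      (if L t \<omega> < \<infinity> then k (enn2real (L t \<omega>)) else 0)"
  proof (rule AE_I2)
    fix \<omega>
    note lr = L_right_continuous[OF X, of \<omega>]
    show "(\<lambda>n. if L (X n) \<omega> < \<infinity> then h n (enn2real (L (X n) \<omega>)) else 0) \<longlonglongrightarrow>
      (if L t \<omega> < \<infinity> then k (enn2real (L t \<omega>)) else 0)"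
    proof (cases "L t \<omega> < \<infinity>")
      case True
      have "(\<lambda>n. h n (enn2real (L (X n) \<omega>))) \<longlonglongrightarrow> k (enn2real (L t \<omega>))"
      proof (rule lim)
        have "(\<lambda>n. L (X n) \<omega>) \<longlonglongrightarrow> ennreal (enn2real (L t \<omega>))" using lr True by simp
        then show "(\<lambda>n. enn2real (L (X n) \<omega>)) \<longlonglongrightarrow> enn2real (L t \<omega>)" by (rule tendsto_enn2real) simp
      qed simp
      moreover have "\<forall>\<^sub>F n in sequentially. h n (enn2real (L (X n) \<omega>)) = (if L (X n) \<omega> < \<infinity> then h n (enn2real (L (X n) \<omega>)) else 0)"
        using order_tendstoD(2)[OF lr True] by eventually_elim simp
      ultimately have "(\<lambda>n. if L (X n) \<omega> < \<infinity> then h n (enn2real (L (X n) \<omega>)) else 0) \<longlonglongrightarrow> k (enn2real (L t \<omega>))"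
        by (rule Lim_transform_eventually)
      then show ?thesis using True by simp
    next
      case False
      then have "\<not> L (X n) \<omega> < \<infinity>" for n using L_mono[OF X(2), of \<omega> n] by (auto simp: top_unique not_less)
      then show ?thesis using False by simp
    qed
  qed
qed measurable

text \<open>\<open>exp (- q * l)\<close> is the integral of \<open>q * exp (- q * x)\<close> over x
  > l. Apart from the single point x = l, the inverse at t lies below x iff the subordinator has
  passed t at time x.\<close>

lemma L_exp_pathwise:
  assumes \<omega>: "\<omega> \<in> space M" and q: "0 < q"
  shows "(\<integral>\<^sup>+x. ennreal (q * exp (- q * x)) * (if 0 < x \<and> ennreal t < \<sigma> (max x 0) \<omega> then 1 else 0) \<partial>lborel) =
    (if L t \<omega> < \<infinity> then ennreal (exp (- q * enn2real (L t \<omega>))) else 0)"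
proof (cases "L t \<omega> < \<infinity>")
  case True
  define l where "l = enn2real (L t \<omega>)"
  have l: "L t \<omega> = ennreal l" "0 \<le> l" using True by (simp_all add: l_def)
  have "(\<integral>\<^sup>+x. ennreal (q * exp (- q * x)) * (if 0 < x \<and> ennreal t < \<sigma> (max x 0) \<omega> then 1 else 0) \<partial>lborel) =
     (\<integral>\<^sup>+x. ennreal q * (ennreal (exp (- q * x)) * indicator {l<..} x) \<partial>lborel)"
  proof (rule nn_integral_cong_AE)
    show "AE x in lborel. ennreal (q * exp (- q * x)) * (if 0 < x \<and> ennreal t < \<sigma> (max x 0) \<omega> then 1 else 0) =
       ennreal q * (ennreal (exp (- q * x)) * indicator {l<..} x)"
      using AE_lborel_singleton[of l]
    proof eventually_elim
      case (elim x)
      have "0 < x \<and> ennreal t < \<sigma> (max x 0) \<omega> \<longleftrightarrow> l < x"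
      proof
        assume H: "0 < x \<and> ennreal t < \<sigma> (max x 0) \<omega>"
        then have "ennreal t < \<sigma> x \<omega>" by (auto simp: max_def)
        then have "ennreal l \<le> ennreal x" using L_le[of x t \<omega>] l H by simp
        then have "l \<le> x" using H by (subst (asm) ennreal_le_iff) auto
        then show "l < x" using elim by simp
      next
        assume "l < x"
        then show "0 < x \<and> ennreal t < \<sigma> (max x 0) \<omega>"
          using less_L_imp[OF \<omega>, of x t] l by (auto simp: ennreal_less_iff)
      qed
      then show ?case using q by (auto simp: ennreal_mult split: split_indicator)
    qed
  qed
  also have "\<dots> = ennreal q * ennreal (exp (- q * l) / q)"
    by (subst nn_integral_cmult) (simp_all only: nn_integral_exp_Ioi[OF q], measurable)
  also have "\<dots> = ennreal (exp (- q * l))" using q by (simp add: ennreal_mult[symmetric])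
  finally show ?thesis using True by (simp add: l_def)
next
  case False
  have "\<not> (0 < x \<and> ennreal t < \<sigma> (max x 0) \<omega>)" for x
  proof
    assume H: "0 < x \<and> ennreal t < \<sigma> (max x 0) \<omega>"
    then have "ennreal t < \<sigma> x \<omega>" by (auto simp: max_def)
    then have "L t \<omega> \<le> ennreal x" using H by (intro L_le) auto
    then show False using False by (auto simp: top_unique less_top[symmetric])
  qed
  then show ?thesis using False by (simp del: de_Morgan_conj)
qed

lemma nn_integral_exp_tail:
  assumes z: "0 < z" and \<omega>: "\<omega> \<in> space M" and x: "0 < x"
  shows "(\<integral>\<^sup>+t. ennreal (exp (- z * t)) * (if 0 < t \<and> ennreal t < \<sigma> x \<omega> then 1 else 0) \<partial>lborel) =
    ennreal ((1 - (if \<sigma> x \<omega> = \<infinity> then 0 else exp (- z * enn2real (\<sigma> x \<omega>)))) / z)"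
proof (cases "\<sigma> x \<omega> = \<infinity>")
  case True
  have "(\<integral>\<^sup>+t. ennreal (exp (- z * t)) * (if 0 < t \<and> ennreal t < \<sigma> x \<omega> then 1 else 0) \<partial>lborel) =
    (\<integral>\<^sup>+t. ennreal (exp (- z * t)) * indicator {0<..} t \<partial>lborel)"
    by (intro nn_integral_cong) (auto simp: True split: split_indicator)
  then show ?thesis using nn_integral_exp_Ioi[OF z, of 0] True by simp
next
  case False
  define s where "s = enn2real (\<sigma> x \<omega>)"
  have s: "\<sigma> x \<omega> = ennreal s" "0 \<le> s" using False by (simp_all add: s_def less_top)
  have "(\<integral>\<^sup>+t. ennreal (exp (- z * t)) * (if 0 < t \<and> ennreal t < \<sigma> x \<omega> then 1 else 0) \<partial>lborel) =
    (\<integral>\<^sup>+t. ennreal (exp (- z * t)) * indicator {0<..<s} t \<partial>lborel)"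
    by (intro nn_integral_cong) (auto simp: s ennreal_less_iff split: split_indicator)
  also have "\<dots> = ennreal ((1 - exp (- z * s)) / z)" by (rule nn_integral_exp_Ioo[OF z s(2)])
  finally show ?thesis using False by (simp add: s_def)
qed

text \<open>Both variables enter through the event that \<open>\<sigma> x\<close> exceeds t, so
  Tonelli reduces the double transform to the transform of \<open>\<sigma> x\<close>. It remains to
  integrate \<open>q * exp (- q * x) * (1 - exp (- x * f z)) / z\<close> over x > 0.\<close>

lemma L_double_laplace:
  assumes q: "0 < q" and z: "0 < z"
  shows "(\<integral>\<^sup>+t. ennreal (exp (- z * t)) * (indicator {0<..} t * (\<integral>\<^sup>+l. ennreal (exp (- q * l)) \<partial>inverse_law t)) \<partial>lborel) =
    ennreal (f z / (z * (q + f z)))"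
proof -
  interpret P: pair_sigma_finite lborel M by standard
  interpret P': pair_sigma_finite M lborel by standard
  have [measurable]: "(\<lambda>p. \<sigma> (max (fst p) 0) (snd p)) \<in> borel_measurable (lborel \<Otimes>\<^sub>M M)"
    using joint_measurable by (simp add: measurable_def cong: measurable_cong_sets)
  let ?k = "\<lambda>t x \<omega>. if 0 < x \<and> ennreal t < \<sigma> (max x 0) \<omega> then 1 else 0 :: ennreal"
  have [measurable (raw)]: "(\<lambda>p. ?k (g p) (h p) (w p)) \<in> borel_measurable M'"
    if [measurable]: "g \<in> borel_measurable M'" "h \<in> borel_measurable M'" "w \<in> measurable M' M" for g h w and M' :: "'x measure"
  proof -
    have [measurable]: "(\<lambda>p. \<sigma> (max (h p) 0) (w p)) \<in> borel_measurable M'"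
      using measurable_compose[OF _ joint_measurable, of "\<lambda>p. (h p, w p)" M'] by simp
    show ?thesis by measurable
  qed
  have "(\<integral>\<^sup>+t. ennreal (exp (- z * t)) * (indicator {0<..} t * (\<integral>\<^sup>+l. ennreal (exp (- q * l)) \<partial>inverse_law t)) \<partial>lborel) =
    (\<integral>\<^sup>+t. (\<integral>\<^sup>+\<omega>. (\<integral>\<^sup>+x. ennreal (exp (- z * t)) * (indicator {0<..} t * (ennreal (q * exp (- q * x)) * ?k t x \<omega>)) \<partial>lborel) \<partial>M) \<partial>lborel)"
  proof (intro nn_integral_cong)
    fix t :: real
    have "(\<integral>\<^sup>+l. ennreal (exp (- q * l)) \<partial>inverse_law t) = (\<integral>\<^sup>+\<omega>. (\<integral>\<^sup>+x. ennreal (q * exp (- q * x)) * ?k t x \<omega> \<partial>lborel) \<partial>M)"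
      by (subst nn_integral_inverse_law, measurable) (intro nn_integral_cong, simp only: L_exp_pathwise[OF _ q])
    then have "ennreal (exp (- z * t)) * (indicator {0<..} t * (\<integral>\<^sup>+l. ennreal (exp (- q * l)) \<partial>inverse_law t)) =
      (\<integral>\<^sup>+\<omega>. ennreal (exp (- z * t)) * (indicator {0<..} t * (\<integral>\<^sup>+x. ennreal (q * exp (- q * x)) * ?k t x \<omega> \<partial>lborel)) \<partial>M)"
      by (subst nn_integral_cmult, measurable, subst nn_integral_cmult, measurable)
    also have "\<dots> = (\<integral>\<^sup>+\<omega>. (\<integral>\<^sup>+x. ennreal (exp (- z * t)) * (indicator {0<..} t * (ennreal (q * exp (- q * x)) * ?k t x \<omega>)) \<partial>lborel) \<partial>M)"
      by (intro nn_integral_cong, subst nn_integral_cmult, measurable, subst nn_integral_cmult, measurable)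
    finally show "ennreal (exp (- z * t)) * (indicator {0<..} t * (\<integral>\<^sup>+l. ennreal (exp (- q * l)) \<partial>inverse_law t)) =
      (\<integral>\<^sup>+\<omega>. (\<integral>\<^sup>+x. ennreal (exp (- z * t)) * (indicator {0<..} t * (ennreal (q * exp (- q * x)) * ?k t x \<omega>)) \<partial>lborel) \<partial>M)" .
  qed
  also have "\<dots> = (\<integral>\<^sup>+t. (\<integral>\<^sup>+x. (\<integral>\<^sup>+\<omega>. ennreal (exp (- z * t)) * (indicator {0<..} t * (ennreal (q * exp (- q * x)) * ?k t x \<omega>)) \<partial>M) \<partial>lborel) \<partial>lborel)"
    by (intro nn_integral_cong P'.Fubini'[symmetric]) measurable
  also have "\<dots> = (\<integral>\<^sup>+x. (\<integral>\<^sup>+t. (\<integral>\<^sup>+\<omega>. ennreal (exp (- z * t)) * (indicator {0<..} t * (ennreal (q * exp (- q * x)) * ?k t x \<omega>)) \<partial>M) \<partial>lborel) \<partial>lborel)"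
    by (rule lborel_pair.Fubini') measurable
  also have "\<dots> = (\<integral>\<^sup>+x. (\<integral>\<^sup>+\<omega>. (\<integral>\<^sup>+t. ennreal (exp (- z * t)) * (indicator {0<..} t * (ennreal (q * exp (- q * x)) * ?k t x \<omega>)) \<partial>lborel) \<partial>M) \<partial>lborel)"
    by (intro nn_integral_cong P'.Fubini') measurable
  also have "\<dots> = (\<integral>\<^sup>+x. ennreal ((q * exp (- q * x) - q * exp (- (q + f z) * x)) / z) * indicator {0..} x \<partial>lborel)"
  proof (rule nn_integral_cong_AE)
    show "AE x in lborel. (\<integral>\<^sup>+\<omega>. (\<integral>\<^sup>+t. ennreal (exp (- z * t)) * (indicator {0<..} t * (ennreal (q * exp (- q * x)) * ?k t x \<omega>)) \<partial>lborel) \<partial>M) =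
      ennreal ((q * exp (- q * x) - q * exp (- (q + f z) * x)) / z) * indicator {0..} x"
      using AE_lborel_singleton[of 0]
    proof eventually_elim
      case (elim x)
      show ?case
      proof (cases "0 < x")
        case True
        define Y where "Y \<omega> = (if \<sigma> x \<omega> = \<infinity> then 0 else exp (- z * enn2real (\<sigma> x \<omega>)))" for \<omega>
        have [measurable]: "\<sigma> x \<in> borel_measurable M" using True by (intro \<sigma>_measurable) auto
        have [measurable]: "Y \<in> borel_measurable M" unfolding Y_def[abs_def] by measurable
        have Y: "0 \<le> Y \<omega>" "Y \<omega> \<le> 1" for \<omega> using z by (auto simp: Y_def)
        have iY: "integrable M Y"
          by (rule PM.integrable_const_bound[of _ 1]) (use Y in auto)
        have LY: "(LINT \<omega>|M. Y \<omega>) = exp (- x * f z)"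
          unfolding Y_def using True by (intro \<sigma>_laplace z) auto
        have "(\<integral>\<^sup>+\<omega>. (\<integral>\<^sup>+t. ennreal (exp (- z * t)) * (indicator {0<..} t * (ennreal (q * exp (- q * x)) * ?k t x \<omega>)) \<partial>lborel) \<partial>M) =
          (\<integral>\<^sup>+\<omega>. ennreal (q * exp (- q * x) / z * (1 - Y \<omega>)) \<partial>M)"
        proof (intro nn_integral_cong)
          fix \<omega> assume \<omega>: "\<omega> \<in> space M"
          have "(\<integral>\<^sup>+t. ennreal (exp (- z * t)) * (indicator {0<..} t * (ennreal (q * exp (- q * x)) * ?k t x \<omega>)) \<partial>lborel) =
            (\<integral>\<^sup>+t. ennreal (q * exp (- q * x)) * (ennreal (exp (- z * t)) * (if 0 < t \<and> ennreal t < \<sigma> x \<omega> then 1 else 0)) \<partial>lborel)"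
            using True by (intro nn_integral_cong) (auto simp: max_def mult_ac split: split_indicator)
          also have "\<dots> = ennreal (q * exp (- q * x)) * ennreal ((1 - Y \<omega>) / z)"
            by (subst nn_integral_cmult, measurable) (simp only: nn_integral_exp_tail[OF z \<omega> True] Y_def)
          also have "\<dots> = ennreal (q * exp (- q * x) / z * (1 - Y \<omega>))"
            using q z Y by (simp add: ennreal_mult[symmetric])
          finally show "(\<integral>\<^sup>+t. ennreal (exp (- z * t)) * (indicator {0<..} t * (ennreal (q * exp (- q * x)) * ?k t x \<omega>)) \<partial>lborel) = \<dots>" .
        qed
        also have "\<dots> = ennreal (LINT \<omega>|M. q * exp (- q * x) / z * (1 - Y \<omega>))"
          by (rule nn_integral_eq_integral) (use iY q z Y in auto)
        also have "(LINT \<omega>|M. q * exp (- q * x) / z * (1 - Y \<omega>)) = q * exp (- q * x) / z * (1 - exp (- x * f z))"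
          using iY LY by (simp add: PM.prob_space)
        also have "\<dots> = (q * exp (- q * x) - q * exp (- (q + f z) * x)) / z"
          using z by (simp add: exp_add[symmetric] algebra_simps divide_simps)
        finally show ?thesis using True by simp
      qed (use elim in simp)
    qed
  qed
  also have "\<dots> = ennreal (0 - (- 1 + q / (q + f z)) / z)"
  proof (rule nn_integral_FTC_atLeast[where F="\<lambda>x. (- exp (- q * x) + q / (q + f z) * exp (- (q + f z) * x)) / z" and a=0, simplified mult_zero_right exp_zero mult_1_right])
    have fz: "0 \<le> f z" by (rule f_nonneg[OF z])
    show "((\<lambda>x. (- exp (- q * x) + q / (q + f z) * exp (- (q + f z) * x)) / z) has_real_derivative (q * exp (- q * x) - q * exp (- (q + f z) * x)) / z) (at x)" for x
    proof -
      have *: "((\<lambda>x. (- exp (- q * x) + q / w * exp (- w * x)) / z) has_real_derivative (q * exp (- q * x) - q * exp (- w * x)) / z) (at x)" if "0 < w" for w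
        using that z by (auto intro!: derivative_eq_intros simp: field_simps)
      show ?thesis by (rule *) (use q fz in linarith)
    qed
    show "0 \<le> (q * exp (- q * x) - q * exp (- (q + f z) * x)) / z" if "0 \<le> x" for x
    proof -
      have "q * x \<le> (q + f z) * x" using that fz by (intro mult_right_mono) auto
      then have "exp (- (q + f z) * x) \<le> exp (- q * x)" by (simp only: exp_le_cancel_iff mult_minus_left neg_le_iff_le)
      then have "q * exp (- (q + f z) * x) \<le> q * exp (- q * x)" using q by (intro mult_left_mono) auto
      then show ?thesis by (intro divide_nonneg_pos z) linarith
    qed
    have "((\<lambda>x. (- exp (- q * x) + q / (q + f z) * exp (- (q + f z) * x)) / z) \<longlongrightarrow> (- 0 + q / (q + f z) * 0) / z) at_top"
      using z q fz by (intro tendsto_intros exp_neg_tendsto_0) auto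
    then show "((\<lambda>x. (- exp (- q * x) + q / (q + f z) * exp (- (q + f z) * x)) / z) \<longlongrightarrow> 0) at_top" by simp
  qed auto
  also have "0 - (- 1 + q / (q + f z)) / z = f z / (z * (q + f z))"
    using z q f_nonneg[OF z] by (simp add: field_simps)
  finally show ?thesis .
qed

text \<open>The candidate for l_t(r), with the value r of the inverse as first argument. The tail is
  convolved with \<open>law r\<close> itself, so that term involves no choice of version.\<close>

definition ext_inverse_density :: "real \<Rightarrow> real \<Rightarrow> ennreal" where
  "ext_inverse_density r t = ennreal b * ext_density r t + (\<integral>\<^sup>+y. tail_ext (t - y) \<partial>law r)"

lemma ext_inverse_density_measurable [measurable (raw)]:
  assumes [measurable]: "g \<in> borel_measurable M'" "h \<in> borel_measurable M'"
  shows "(\<lambda>x. ext_inverse_density (g x) (h x)) \<in> borel_measurable M'"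
proof -
  have [measurable]: "(\<lambda>x. \<integral>\<^sup>+y. tail_ext (h x - y) \<partial>law (g x)) \<in> borel_measurable M'"
    by (rule nn_integral_law_measurable) measurable
  show ?thesis unfolding ext_inverse_density_def by measurable
qed

lemma ext_inverse_density_zero: assumes r: "0 < r" and t: "t \<le> b * r" shows "ext_inverse_density r t = 0"
proof -
  have "AE y in law r. tail_ext (t - y) = 0"
    using AE_law_drift[OF r] by eventually_elim (use t in \<open>auto simp: tail_ext_def\<close>)
  then have "(\<integral>\<^sup>+y. tail_ext (t - y) \<partial>law r) = 0" by (subst nn_integral_0_iff_AE) auto
  then show ?thesis using t by (simp add: ext_inverse_density_def ext_density_def)
qed

lemma ext_inverse_density_laplace:
  assumes r: "0 < r" and z: "0 < z"
  shows "(\<integral>\<^sup>+t. ennreal (exp (- z * t)) * ext_inverse_density r t \<partial>lborel) = ennreal (f z / z * exp (- r * f z))"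
proof -
  have "(\<integral>\<^sup>+t. ennreal (exp (- z * t)) * ext_density r t \<partial>lborel) = ennreal (exp (- r * f z))"
    using law_laplace[of r z] r z
    by (simp add: law_density[OF r] nn_integral_density mult.commute)
  moreover have "(\<integral>\<^sup>+t. ennreal (exp (- z * t)) * (\<integral>\<^sup>+y. tail_ext (t - y) \<partial>law r) \<partial>lborel) = ennreal (f z / z - b) * ennreal (exp (- r * f z))"
    using r by (subst nn_integral_conv_exp[OF tail_ext_measurable sets_law sigma_finite_law])
      (simp only: tail_ext_laplace[OF z] law_laplace[OF less_imp_le[OF r] z])
  moreover have [measurable]: "(\<lambda>t. \<integral>\<^sup>+y. tail_ext (t - y) \<partial>law r) \<in> borel_measurable borel"
    by (rule nn_integral_law_measurable) measurable
  have "(\<integral>\<^sup>+t. ennreal (exp (- z * t)) * ext_inverse_density r t \<partial>lborel) =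
     (\<integral>\<^sup>+t. ennreal b * (ennreal (exp (- z * t)) * ext_density r t) + ennreal (exp (- z * t)) * (\<integral>\<^sup>+y. tail_ext (t - y) \<partial>law r) \<partial>lborel)"
    by (intro nn_integral_cong) (simp add: ext_inverse_density_def distrib_left mult_ac)
  then have "(\<integral>\<^sup>+t. ennreal (exp (- z * t)) * ext_inverse_density r t \<partial>lborel) =
     ennreal b * (\<integral>\<^sup>+t. ennreal (exp (- z * t)) * ext_density r t \<partial>lborel) +
     (\<integral>\<^sup>+t. ennreal (exp (- z * t)) * (\<integral>\<^sup>+y. tail_ext (t - y) \<partial>law r) \<partial>lborel)"
    by (subst (asm) nn_integral_add, measurable, subst (asm) nn_integral_cmult, measurable)
  ultimately have "(\<integral>\<^sup>+t. ennreal (exp (- z * t)) * ext_inverse_density r t \<partial>lborel) =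
     ennreal b * ennreal (exp (- r * f z)) + ennreal (f z / z - b) * ennreal (exp (- r * f z))" by simp
  also have "\<dots> = (ennreal b + ennreal (f z / z - b)) * ennreal (exp (- r * f z))"
    by (simp add: distrib_right)
  also have "ennreal b + ennreal (f z / z - b) = ennreal (f z / z)"
    using f_ge[OF z] z b_nonneg by (subst ennreal_plus[symmetric]) (auto simp: field_simps)
  also have "ennreal (f z / z) * ennreal (exp (- r * f z)) = ennreal (f z / z * exp (- r * f z))"
    using f_nonneg[OF z] z by (intro ennreal_mult[symmetric]) auto
  finally show ?thesis .
qed

text \<open>Both sides, as functions of t, are densities with Laplace transform
  \<open>f z / (z * (q + f z))\<close>, and so agree almost everywhere. The exceptional set may
  depend on q.\<close>

lemma AE_inverse_law_exp:
  assumes q: "0 < q"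
  shows "AE t in lborel. 0 < t \<longrightarrow> (\<integral>\<^sup>+l. ennreal (exp (- q * l)) \<partial>inverse_law t) = (\<integral>\<^sup>+r. ennreal (exp (- q * r)) * (indicator {0<..} r * ext_inverse_density r t) \<partial>lborel)"
proof -
  define A where "A t = indicator {0<..} t * (\<integral>\<^sup>+l. ennreal (exp (- q * l)) \<partial>inverse_law t)" for t :: real
  define B where "B t = (\<integral>\<^sup>+r. ennreal (exp (- q * r)) * (indicator {0<..} r * ext_inverse_density r t) \<partial>lborel)" for t
  have Am: "A \<in> borel_measurable borel"
    unfolding A_def using nn_integral_inverse_law_measurable[of "\<lambda>l. ennreal (exp (- q * l))"] by measurable
  have Bm: "B \<in> borel_measurable borel" unfolding B_def by measurable
  have A_lap: "(\<integral>\<^sup>+t. ennreal (exp (- z * t)) \<partial>density lborel A) = ennreal (f z / (z * (q + f z)))" if z: "0 < z" for z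
    using L_double_laplace[OF q z] Am by (subst nn_integral_density) (simp_all add: A_def mult_ac)
  have B_lap: "(\<integral>\<^sup>+t. ennreal (exp (- z * t)) \<partial>density lborel B) = ennreal (f z / (z * (q + f z)))" if z: "0 < z" for z
  proof -
    have fz: "0 \<le> f z" by (rule f_nonneg[OF z])
    have "(\<integral>\<^sup>+t. ennreal (exp (- z * t)) \<partial>density lborel B) =
      (\<integral>\<^sup>+t. (\<integral>\<^sup>+r. ennreal (exp (- q * r)) * (indicator {0<..} r * (ennreal (exp (- z * t)) * ext_inverse_density r t)) \<partial>lborel) \<partial>lborel)"
    proof (subst nn_integral_density)
      show "B \<in> borel_measurable lborel" using Bm by simp
      show "(\<integral>\<^sup>+t. B t * ennreal (exp (- z * t)) \<partial>lborel) = (\<integral>\<^sup>+t. (\<integral>\<^sup>+r. ennreal (exp (- q * r)) * (indicator {0<..} r * (ennreal (exp (- z * t)) * ext_inverse_density r t)) \<partial>lborel) \<partial>lborel)"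
        unfolding B_def by (intro nn_integral_cong, subst nn_integral_multc[symmetric], measurable) (intro nn_integral_cong, simp add: mult_ac)
    qed measurable
    also have "\<dots> = (\<integral>\<^sup>+r. (\<integral>\<^sup>+t. ennreal (exp (- q * r)) * (indicator {0<..} r * (ennreal (exp (- z * t)) * ext_inverse_density r t)) \<partial>lborel) \<partial>lborel)"
      by (rule lborel_pair.Fubini') measurable
    also have "\<dots> = (\<integral>\<^sup>+r. ennreal (f z / z) * (ennreal (exp (- (q + f z) * r)) * indicator {0<..} r) \<partial>lborel)"
    proof (intro nn_integral_cong)
      fix r :: real
      show "(\<integral>\<^sup>+t. ennreal (exp (- q * r)) * (indicator {0<..} r * (ennreal (exp (- z * t)) * ext_inverse_density r t)) \<partial>lborel) =
        ennreal (f z / z) * (ennreal (exp (- (q + f z) * r)) * indicator {0<..} r)"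
      proof (cases "0 < r")
        case True
        have "(\<integral>\<^sup>+t. ennreal (exp (- q * r)) * (indicator {0<..} r * (ennreal (exp (- z * t)) * ext_inverse_density r t)) \<partial>lborel) =
          ennreal (exp (- q * r)) * (\<integral>\<^sup>+t. ennreal (exp (- z * t)) * ext_inverse_density r t \<partial>lborel)"
          using True by (subst nn_integral_cmult[symmetric]) auto
        also have "\<dots> = ennreal (exp (- q * r)) * ennreal (f z / z * exp (- r * f z))"
          by (simp only: ext_inverse_density_laplace[OF True z])
        also have "\<dots> = ennreal (f z / z * (exp (- q * r) * exp (- r * f z)))"
          using fz z by (simp add: ennreal_mult[symmetric] mult_ac)
        also have "exp (- q * r) * exp (- r * f z) = exp (- (q + f z) * r)"
          by (simp add: exp_add[symmetric] algebra_simps)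
        also have "ennreal (f z / z * exp (- (q + f z) * r)) = ennreal (f z / z) * ennreal (exp (- (q + f z) * r))"
          using fz z by (intro ennreal_mult) auto
        finally show ?thesis using True by simp
      qed simp
    qed
    also have "\<dots> = ennreal (f z / z) * ennreal (exp (- (q + f z) * 0) / (q + f z))"
      using q fz by (subst nn_integral_cmult, measurable, subst nn_integral_exp_Ioi) auto
    also have "\<dots> = ennreal (f z / (z * (q + f z)))"
      using fz q z by (simp add: ennreal_mult[symmetric])
    finally show ?thesis .
  qed
  have B0: "B t = 0" if "t \<le> 0" for t
  proof -
    have *: "ennreal (exp (- q * r)) * (indicator {0<..} r * ext_inverse_density r t) = 0" for r
    proof (cases "0 < r")
      case True
      then have "t \<le> b * r" using that b_nonneg by (meson mult_nonneg_nonneg less_imp_le order_trans)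
      then show ?thesis using ext_inverse_density_zero[OF True] by simp
    qed simp
    have "B t = (\<integral>\<^sup>+r. 0 \<partial>(lborel :: real measure))" unfolding B_def by (intro nn_integral_cong *)
    then show ?thesis by simp
  qed
  have "density lborel A = density lborel B"
  proof (rule laplace_unique)
    show "AE x in density lborel A. 0 \<le> x"
      using Am by (subst AE_density) (auto simp: A_def split: split_indicator)
    have "0 \<le> x" if "0 < B x" for x using B0[of x] that by (cases "x \<le> 0") auto
    then show "AE x in density lborel B. 0 \<le> x"
      using Bm by (subst AE_density) auto
    show "(\<integral>\<^sup>+x. ennreal (exp (- (real j + 1) * x)) \<partial>density lborel A) = (\<integral>\<^sup>+x. ennreal (exp (- (real j + 1) * x)) \<partial>density lborel B)" for j
      by (subst A_lap, simp, subst B_lap) simp_all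
    show "(\<integral>\<^sup>+x. ennreal (exp (- x)) \<partial>density lborel A) < \<infinity>" using A_lap[of 1] by simp
  qed auto
  then have "AE t in lborel. A t = B t"
    using Am Bm by (intro sigma_finite_measure.density_unique[OF sigma_finite_lborel]) auto
  then show ?thesis by eventually_elim (auto simp: A_def B_def)
qed

lemma inverse_law_exp_finite: "0 \<le> q \<Longrightarrow> (\<integral>\<^sup>+l. ennreal (exp (- q * l)) \<partial>inverse_law t) \<le> 1"
proof -
  assume q: "0 \<le> q"
  have "(\<integral>\<^sup>+l. ennreal (exp (- q * l)) \<partial>inverse_law t) \<le> (\<integral>\<^sup>+\<omega>. 1 \<partial>M)"
    by (subst nn_integral_inverse_law, measurable) (intro nn_integral_mono, use q in auto)
  then show ?thesis by (simp add: PM.emeasure_space_1)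
qed

text \<open>Uniqueness needs only the countably many exponents q = 1, 2, 3, ..., whose exceptional
  sets combine into one null set of times.\<close>

lemma AE_inverse_law_eq: "AE t in lborel. 0 < t \<longrightarrow> inverse_law t = density lborel (\<lambda>r. indicator {0<..} r * ext_inverse_density r t)"
proof -
  have "AE t in lborel. \<forall>j::nat. 0 < t \<longrightarrow> (\<integral>\<^sup>+l. ennreal (exp (- (real j + 1) * l)) \<partial>inverse_law t) =
     (\<integral>\<^sup>+r. ennreal (exp (- (real j + 1) * r)) * (indicator {0<..} r * ext_inverse_density r t) \<partial>lborel)"
    by (subst AE_all_countable) (intro allI AE_inverse_law_exp, simp)
  then show ?thesis
  proof (eventually_elim, intro impI)
    fix t :: real
    assume H: "\<forall>j::nat. 0 < t \<longrightarrow> (\<integral>\<^sup>+l. ennreal (exp (- (real j + 1) * l)) \<partial>inverse_law t) =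
     (\<integral>\<^sup>+r. ennreal (exp (- (real j + 1) * r)) * (indicator {0<..} r * ext_inverse_density r t) \<partial>lborel)" and t: "0 < t"
    show "inverse_law t = density lborel (\<lambda>r. indicator {0<..} r * ext_inverse_density r t)"
    proof (rule laplace_unique)
      show "AE x in density lborel (\<lambda>r. indicator {0<..} r * ext_inverse_density r t). 0 \<le> x"
        by (subst AE_density) (auto split: split_indicator)
      show "(\<integral>\<^sup>+x. ennreal (exp (- (real j + 1) * x)) \<partial>inverse_law t) =
        (\<integral>\<^sup>+x. ennreal (exp (- (real j + 1) * x)) \<partial>density lborel (\<lambda>r. indicator {0<..} r * ext_inverse_density r t))" for j :: nat
        using H t by (subst nn_integral_density) (auto simp: mult_ac)
      show "(\<integral>\<^sup>+x. ennreal (exp (- x)) \<partial>inverse_law t) < \<infinity>"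
        using inverse_law_exp_finite[of 1 t] by (auto intro: le_less_trans)
    qed (auto intro: AE_inverse_law_nonneg)
  qed
qed

text \<open>Splitting \<open>t - b * r = (t - y) + (y - b * r)\<close> and using \<open>law_size_bias\<close> for the second part removes
  the singularity at \<open>t = b * r\<close>; the right-hand side depends on \<open>t\<close> through convolutions only.\<close>

lemma ext_inverse_density_times_distance:
  assumes r: "0 < r"
  shows "ennreal (t - b * r) * ext_inverse_density r t =
    ennreal r * (\<integral>\<^sup>+y. sb_levy (t - y) * ext_inverse_density r y \<partial>lborel) + (\<integral>\<^sup>+y. ennreal (t - y) * tail_ext (t - y) \<partial>law r)"
proof -
  interpret P: pair_sigma_finite lborel "law r"
    using sigma_finite_law by (auto simp: pair_sigma_finite_def lborel.sigma_finite_measure_axioms)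
  have [measurable]: "(\<lambda>t. \<integral>\<^sup>+y. tail_ext (t - y) \<partial>law r) \<in> borel_measurable borel"
    by (rule nn_integral_law_measurable) measurable
  \<comment> \<open>The convolution of \<open>sb_levy\<close>, the tail and \<open>law r\<close>. It
    appears both in the convolution of \<open>sb_levy\<close> with the inverse density and in the
    part of the weight handled by \<open>law_size_bias\<close>.\<close>
  define J where "J = (\<integral>\<^sup>+w. (\<integral>\<^sup>+y. sb_levy (t - y) * tail_ext (y - w) \<partial>lborel) \<partial>law r)"
  \<comment> \<open>In the drift term the weight cancels the denominator of
    \<open>ext_density\<close>; on the other side of the drift line both sides are 0.\<close>
  have 1: "ennreal (t - b * r) * (ennreal b * ext_density r t) = ennreal r * (ennreal b * sb_conv r t)"
  proof (cases "b * r < t")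
    case True
    then have "ennreal (t - b * r) * ennreal (r / (t - b * r)) = ennreal r"
      using r by (simp add: ennreal_mult[symmetric])
    then have "ennreal (t - b * r) * (ennreal b * (ennreal (r / (t - b * r)) * sb_conv r t)) = ennreal b * (ennreal r * sb_conv r t)"
      by (metis mult.assoc mult.left_commute)
    then show ?thesis using True by (simp add: ext_density_def mult_ac)
  qed (use sb_conv_zero[OF r, of t] in \<open>simp add: ext_density_def\<close>)
  have sb_conv: "sb_conv r t = (\<integral>\<^sup>+y. sb_levy (t - y) * ext_density r y \<partial>lborel)"
    unfolding sb_conv_def law_density[OF r] by (subst nn_integral_density) (auto simp: mult.commute)
  have "(\<integral>\<^sup>+y. sb_levy (t - y) * ext_inverse_density r y \<partial>lborel) =
    (\<integral>\<^sup>+y. ennreal b * (sb_levy (t - y) * ext_density r y) + (\<integral>\<^sup>+w. sb_levy (t - y) * tail_ext (y - w) \<partial>law r) \<partial>lborel)"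
    by (intro nn_integral_cong, subst nn_integral_cmult, measurable) (simp add: ext_inverse_density_def distrib_left mult_ac)
  also have "\<dots> = ennreal b * sb_conv r t + (\<integral>\<^sup>+y. (\<integral>\<^sup>+w. sb_levy (t - y) * tail_ext (y - w) \<partial>law r) \<partial>lborel)"
    unfolding sb_conv by (subst nn_integral_add, measurable, subst nn_integral_cmult, measurable)
  also have "(\<integral>\<^sup>+y. (\<integral>\<^sup>+w. sb_levy (t - y) * tail_ext (y - w) \<partial>law r) \<partial>lborel) = J"
    unfolding J_def by (rule P.Fubini'[symmetric]) measurable
  finally have 2: "(\<integral>\<^sup>+y. sb_levy (t - y) * ext_inverse_density r y \<partial>lborel) = ennreal b * sb_conv r t + J" .
  have "(\<integral>\<^sup>+y. ennreal (y - b * r) * tail_ext (t - y) \<partial>law r) = (\<integral>\<^sup>+y. tail_ext (t - y) \<partial>density (law r) (\<lambda>y. ennreal (y - b * r)))"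
    by (rule nn_integral_density[symmetric]) measurable
  also have "\<dots> = (\<integral>\<^sup>+y. ennreal r * sb_conv r y * tail_ext (t - y) \<partial>lborel)"
    unfolding law_size_bias[OF r] by (rule nn_integral_density) measurable
  also have "\<dots> = ennreal r * (\<integral>\<^sup>+y. (\<integral>\<^sup>+w. tail_ext (t - y) * sb_levy (y - w) \<partial>law r) \<partial>lborel)"
    by (subst nn_integral_cmult[symmetric], measurable)
       (intro nn_integral_cong, subst nn_integral_cmult, measurable, simp add: sb_conv_def mult_ac)
  also have "(\<integral>\<^sup>+y. (\<integral>\<^sup>+w. tail_ext (t - y) * sb_levy (y - w) \<partial>law r) \<partial>lborel) = (\<integral>\<^sup>+w. (\<integral>\<^sup>+y. tail_ext (t - y) * sb_levy (y - w) \<partial>lborel) \<partial>law r)"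
    by (rule P.Fubini'[symmetric]) measurable
  also have "\<dots> = J"
    unfolding J_def
  proof (rule nn_integral_cong)
    fix w
    \<comment> \<open>The reflection y -> t + w - y exchanges the two kernels, so the order of
      convolution is immaterial.\<close>
    show "(\<integral>\<^sup>+y. tail_ext (t - y) * sb_levy (y - w) \<partial>lborel) = (\<integral>\<^sup>+y. sb_levy (t - y) * tail_ext (y - w) \<partial>lborel)"
      using nn_integral_real_affine[of "\<lambda>y. tail_ext (t - y) * sb_levy (y - w)" "-1" "t + w"]
      by (simp add: mult.commute algebra_simps)
  qed
  finally have 3: "(\<integral>\<^sup>+y. ennreal (y - b * r) * tail_ext (t - y) \<partial>law r) = ennreal r * J" .
  have "ennreal (t - b * r) * (\<integral>\<^sup>+y. tail_ext (t - y) \<partial>law r) = (\<integral>\<^sup>+y. ennreal (t - b * r) * tail_ext (t - y) \<partial>law r)"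
    by (rule nn_integral_cmult[symmetric]) measurable
  also have "\<dots> = (\<integral>\<^sup>+y. ennreal (t - y) * tail_ext (t - y) + ennreal (y - b * r) * tail_ext (t - y) \<partial>law r)"
  proof (rule nn_integral_cong_AE)
    show "AE y in law r. ennreal (t - b * r) * tail_ext (t - y) = ennreal (t - y) * tail_ext (t - y) + ennreal (y - b * r) * tail_ext (t - y)"
      using AE_law_drift[OF r]
    proof eventually_elim
      case (elim y)
      show ?case
      proof (cases "y < t")
        case True
        then have "ennreal (t - b * r) = ennreal (t - y) + ennreal (y - b * r)"
          using elim by (subst ennreal_plus[symmetric]) auto
        then show ?thesis by (simp add: distrib_right)
      qed (simp add: tail_ext_def)
    qed
  qed
  also have "\<dots> = (\<integral>\<^sup>+y. ennreal (t - y) * tail_ext (t - y) \<partial>law r) + ennreal r * J"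
    by (subst nn_integral_add, measurable) (simp only: 3)
  finally have 4: "ennreal (t - b * r) * (\<integral>\<^sup>+y. tail_ext (t - y) \<partial>law r) = \<dots>" .
  show ?thesis
    unfolding ext_inverse_density_def[of r t] distrib_left 1 4 2 by (simp add: distrib_left add_ac)
qed

lemma AE_law_neq: assumes r: "0 < r" shows "AE y in law r. y \<noteq> t"
  unfolding law_density[OF r] by (subst AE_density) (use AE_lborel_singleton[of t] in auto)

lemma nn_integral_min_finite: "(\<integral>\<^sup>+s. ennreal s * indicator {..T} s \<partial>N) < \<infinity>"
proof -
  have "(\<integral>\<^sup>+s. ennreal s * indicator {..T} s \<partial>N) \<le> (\<integral>\<^sup>+s. ennreal (max 1 \<bar>T\<bar>) * ennreal (min s 1) \<partial>N)"
  proof (rule nn_integral_mono_AE)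
    show "AE s in N. ennreal s * indicator {..T} s \<le> ennreal (max 1 \<bar>T\<bar>) * ennreal (min s 1)"
      using AE_N_pos
    proof eventually_elim
      case (elim s)
      have "s \<le> max 1 \<bar>T\<bar> * min s 1" if "s \<le> T"
      proof -
        have "s \<le> max 1 s * min s 1" using min_scale[of s s] elim by simp
        also have "\<dots> \<le> max 1 \<bar>T\<bar> * min s 1" using elim that by (intro mult_right_mono) auto
        finally show ?thesis .
      qed
      then show ?case using elim
        by (auto simp: ennreal_mult[symmetric] intro!: ennreal_leI split: split_indicator)
    qed
  qed
  also have "\<dots> = ennreal (max 1 \<bar>T\<bar>) * (\<integral>\<^sup>+s. ennreal (min s 1) \<partial>N)"
    by (rule nn_integral_cmult) measurable
  also have "\<dots> < \<infinity>" using nn_integral_min by (auto simp: ennreal_mult_less_top)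
  finally show ?thesis .
qed

section \<open>From almost every time to every time\<close>

context
  fixes q :: real
  assumes q: "1 \<le> q"
begin

text \<open>\<open>w\<close> is what the first term of
  \<open>ext_inverse_density_times_distance\<close> becomes, before convolution with
  \<open>s N(ds)\<close>, after integration against \<open>exp (- q * r)\<close>; its factor r
  appears as l. The assumption q >= 1 gives \<open>l * exp (- q * l) \<le> 1\<close> and hence a
  constant bound.\<close>

definition w :: "real \<Rightarrow> ennreal" where
  "w y = indicator {0<..} y * (\<integral>\<^sup>+l. ennreal (l * exp (- q * l)) \<partial>inverse_law y)"
definition R2 :: "real \<Rightarrow> ennreal" where
  "R2 t = (\<integral>\<^sup>+r. (indicator {0<..} r * ennreal (exp (- q * r))) * (\<integral>\<^sup>+y. ennreal (t - y) * tail_ext (t - y) \<partial>law r) \<partial>lborel)"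

lemma w_measurable [measurable]: "w \<in> borel_measurable borel"
  unfolding w_def using nn_integral_inverse_law_measurable[of "\<lambda>l. ennreal (l * exp (- q * l))"] by measurable

lemma l_exp_le: "0 \<le> l \<Longrightarrow> l * exp (- q * l) \<le> 1"
  using times_exp_bound[of q l] q by (meson divide_le_eq_1_pos less_le_trans order_trans zero_less_one)

lemma ennreal_l_exp_le: "0 \<le> l \<Longrightarrow> ennreal (l * exp (- q * l)) \<le> 1"
  using ennreal_leI[OF l_exp_le, of l] by simp

lemma inverse_law_UNIV_le: "emeasure (inverse_law y) UNIV \<le> 1"
  using inverse_law_exp_finite[of 0 y] by simp

lemma w_le: "w y \<le> 1"
proof -
  have "(\<integral>\<^sup>+l. ennreal (l * exp (- q * l)) \<partial>inverse_law y) \<le> (\<integral>\<^sup>+l. 1 \<partial>inverse_law y)"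
  proof (rule nn_integral_mono_AE)
    show "AE l in inverse_law y. ennreal (l * exp (- q * l)) \<le> 1"
      using AE_inverse_law_nonneg[of y] by eventually_elim (rule ennreal_l_exp_le)
  qed
  also have "\<dots> \<le> 1" using inverse_law_UNIV_le[of y] by simp
  finally show ?thesis by (auto simp: w_def split: split_indicator)
qed

text \<open>After Tonelli the inverse density stands inside an integral over y, where the
  almost-everywhere identification \<open>AE_inverse_law_eq\<close> is enough. The formula thus
  holds for every t without presupposing the density at t.\<close>

lemma ext_inverse_density_weighted_integral:
  "(\<integral>\<^sup>+r. indicator {0<..} r * (ennreal (exp (- q * r)) * (ennreal (t - b * r) * ext_inverse_density r t)) \<partial>lborel) =
    (\<integral>\<^sup>+s. w (t - s) * ennreal s \<partial>N) + R2 t"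
proof -
  let ?g = "\<lambda>r. indicator {0<..} r * ennreal (exp (- q * r)) :: ennreal"
  have [measurable]: "(\<lambda>r. \<integral>\<^sup>+y. ennreal (t - y) * tail_ext (t - y) \<partial>law r) \<in> borel_measurable borel"
    by (rule nn_integral_law_measurable) measurable
  have "(\<integral>\<^sup>+r. indicator {0<..} r * (ennreal (exp (- q * r)) * (ennreal (t - b * r) * ext_inverse_density r t)) \<partial>lborel) =
    (\<integral>\<^sup>+r. (\<integral>\<^sup>+y. ?g r * ennreal r * (sb_levy (t - y) * ext_inverse_density r y) \<partial>lborel) + ?g r * (\<integral>\<^sup>+y. ennreal (t - y) * tail_ext (t - y) \<partial>law r) \<partial>lborel)"
  proof (rule nn_integral_cong)
    fix r :: real
    show "indicator {0<..} r * (ennreal (exp (- q * r)) * (ennreal (t - b * r) * ext_inverse_density r t)) =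
      (\<integral>\<^sup>+y. ?g r * ennreal r * (sb_levy (t - y) * ext_inverse_density r y) \<partial>lborel) + ?g r * (\<integral>\<^sup>+y. ennreal (t - y) * tail_ext (t - y) \<partial>law r)"
    proof (cases "0 < r")
      case True
      show ?thesis
        by (subst nn_integral_cmult, measurable) (simp add: ext_inverse_density_times_distance[OF True] distrib_left mult.assoc)
    qed simp
  qed
  also have "\<dots> = (\<integral>\<^sup>+r. (\<integral>\<^sup>+y. ?g r * ennreal r * (sb_levy (t - y) * ext_inverse_density r y) \<partial>lborel) \<partial>lborel) + R2 t"
    unfolding R2_def by (rule nn_integral_add) measurable
  also have "(\<integral>\<^sup>+r. (\<integral>\<^sup>+y. ?g r * ennreal r * (sb_levy (t - y) * ext_inverse_density r y) \<partial>lborel) \<partial>lborel) =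
    (\<integral>\<^sup>+y. (\<integral>\<^sup>+r. ?g r * ennreal r * (sb_levy (t - y) * ext_inverse_density r y) \<partial>lborel) \<partial>lborel)"
    by (rule lborel_pair.Fubini') measurable
  also have "\<dots> = (\<integral>\<^sup>+y. sb_levy (t - y) * w y \<partial>lborel)"
  proof (rule nn_integral_cong_AE)
    show "AE y in lborel. (\<integral>\<^sup>+r. ?g r * ennreal r * (sb_levy (t - y) * ext_inverse_density r y) \<partial>lborel) = sb_levy (t - y) * w y"
      using AE_inverse_law_eq
    proof eventually_elim
      case (elim y)
      have e: "(\<integral>\<^sup>+r. ?g r * ennreal r * (sb_levy (t - y) * ext_inverse_density r y) \<partial>lborel) =
        sb_levy (t - y) * (\<integral>\<^sup>+r. (indicator {0<..} r * ext_inverse_density r y) * ennreal (r * exp (- q * r)) \<partial>lborel)"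
        by (subst nn_integral_cmult[symmetric], measurable) (intro nn_integral_cong, simp add: ennreal_mult'' mult_ac)
      show ?case
      proof (cases "0 < y")
        case True
        then have "w y = (\<integral>\<^sup>+l. ennreal (l * exp (- q * l)) \<partial>density lborel (\<lambda>r. indicator {0<..} r * ext_inverse_density r y))"
          using elim by (simp add: w_def)
        also have "\<dots> = (\<integral>\<^sup>+r. (indicator {0<..} r * ext_inverse_density r y) * ennreal (r * exp (- q * r)) \<partial>lborel)"
          by (rule nn_integral_density) measurable
        finally show ?thesis by (simp only: e)
      next
        case False
        have z: "indicator {0<..} r * ext_inverse_density r y = 0" for r
        proof (cases "0 < r")
          case True
          then have "y \<le> b * r" using False b_nonneg by (meson mult_nonneg_nonneg less_imp_le order_trans not_less)
          then show ?thesis using ext_inverse_density_zero[OF True] by simp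
        qed simp
        have "(\<integral>\<^sup>+r. ?g r * ennreal r * (sb_levy (t - y) * ext_inverse_density r y) \<partial>lborel) = 0"
          unfolding e z by simp
        then show ?thesis using False by (simp add: w_def)
      qed
    qed
  qed
  also have "\<dots> = (\<integral>\<^sup>+s. w (t - s) * sb_levy s \<partial>lborel)"
    by (subst nn_integral_conv_commute[symmetric]) (auto simp: mult.commute)
  also have "\<dots> = (\<integral>\<^sup>+s. w (t - s) * ennreal s \<partial>N)"
    by (rule nn_integral_sb_levy) measurable
  finally show ?thesis .
qed

text \<open>For y > 0 this is right-continuity of the law of the inverse, and for y < 0 the function
  is locally 0. Leaving out y = 0 is harmless in a convolution with the atomless measure
  \<open>N\<close>.\<close>

lemma w_right_continuous:
  assumes X: "X \<longlonglongrightarrow> y" "\<And>n. y \<le> X n" and y: "y \<noteq> 0"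
  shows "(\<lambda>n. w (X n)) \<longlonglongrightarrow> w y"
proof (cases "0 < y")
  case True
  have "(\<lambda>n. \<integral>\<^sup>+l. ennreal (l * exp (- q * l)) \<partial>inverse_law (X n)) \<longlonglongrightarrow> (\<integral>\<^sup>+l. ennreal (l * exp (- q * l)) \<partial>inverse_law y)"
    by (rule inverse_law_right_continuous[where C=1, OF _ _ _ _ X])
       (use ennreal_l_exp_le in \<open>auto intro!: tendsto_intros tendsto_ennrealI\<close>)
  moreover have "0 < X n" for n using True X(2)[of n] by linarith
  ultimately show ?thesis using True by (simp add: w_def)
next
  case False
  then have "\<forall>\<^sub>F n in sequentially. X n < 0" using X(1) y by (intro order_tendstoD) auto
  then have "\<forall>\<^sub>F n in sequentially. w (X n) = 0" by eventually_elim (simp add: w_def)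
  then show ?thesis using False by (intro tendsto_eventually) (simp add: w_def)
qed

text \<open>\<open>w\<close> is at most 1 and vanishes at nonpositive arguments, so the integrands
  are dominated by s on \<open>{..t + 1}\<close>, which is integrable by the Levy condition.\<close>

lemma R1_right_continuous:
  assumes X: "X \<longlonglongrightarrow> t" "\<And>n. t \<le> X n" "\<And>n. X n \<le> t + 1"
  shows "(\<lambda>n. \<integral>\<^sup>+s. w (X n - s) * ennreal s \<partial>N) \<longlonglongrightarrow> (\<integral>\<^sup>+s. w (t - s) * ennreal s \<partial>N)"
proof (rule nn_integral_dominated_convergence[where w="\<lambda>s. ennreal s * indicator {..t + 1} s"])
  show "AE s in N. w (X n - s) * ennreal s \<le> ennreal s * indicator {..t + 1} s" for n
  proof (rule AE_I2)
    fix s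
    show "w (X n - s) * ennreal s \<le> ennreal s * indicator {..t + 1} s"
    proof (cases "s \<le> t + 1")
      case True
      then show ?thesis using mult_right_mono[OF w_le, of "ennreal s" "X n - s"] by simp
    next
      case False
      then show ?thesis using X(3)[of n] by (simp add: w_def)
    qed
  qed
  show "AE s in N. (\<lambda>n. w (X n - s) * ennreal s) \<longlonglongrightarrow> w (t - s) * ennreal s"
    using AE_N_neq[of t] AE_N_pos
  proof eventually_elim
    case (elim s)
    have "(\<lambda>n. w (X n - s)) \<longlonglongrightarrow> w (t - s)"
      using elim X by (intro w_right_continuous) (auto intro!: tendsto_intros)
    moreover have "w (t - s) < \<infinity>" using w_le[of "t - s"] by (auto intro: le_less_trans)
    ultimately show ?case
      using elim by (intro tendsto_mult_ennreal tendsto_const) auto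
  qed
  show "(\<integral>\<^sup>+s. ennreal s * indicator {..t + 1} s \<partial>N) < \<infinity>" by (rule nn_integral_min_finite)
qed measurable

text \<open>Dominated convergence twice, first in y and then in r, with the constant of
  \<open>s_tail_ext_bound\<close>. The only critical point y = t is not charged by
  \<open>law r\<close>.\<close>

lemma R2_right_continuous:
  assumes X: "X \<longlonglongrightarrow> t" "\<And>n. t \<le> X n" "\<And>n. X n \<le> t + 1"
  shows "(\<lambda>n. R2 (X n)) \<longlonglongrightarrow> R2 t"
proof -
  obtain C where C: "0 \<le> C" "\<And>s. s \<le> t + 1 \<Longrightarrow> ennreal s * tail_ext s \<le> ennreal C"
    using s_tail_ext_bound[of "t + 1"] by blast
  have [measurable]: "(\<lambda>r. \<integral>\<^sup>+y. ennreal (v - y) * tail_ext (v - y) \<partial>law r) \<in> borel_measurable borel" for v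
    by (rule nn_integral_law_measurable) measurable
  have bd: "(\<integral>\<^sup>+y. ennreal (X n - y) * tail_ext (X n - y) \<partial>law r) \<le> ennreal C" for n r
  proof -
    have "(\<integral>\<^sup>+y. ennreal (X n - y) * tail_ext (X n - y) \<partial>law r) \<le> (\<integral>\<^sup>+y. ennreal C \<partial>law r)"
    proof (rule nn_integral_mono_AE)
      show "AE y in law r. ennreal (X n - y) * tail_ext (X n - y) \<le> ennreal C"
        using AE_law_nonneg[of r]
      proof eventually_elim
        case (elim y)
        show ?case by (rule C(2)) (use elim X(3)[of n] in linarith)
      qed
    qed
    also have "\<dots> \<le> ennreal C * 1" using law_UNIV_le[of r] by (simp add: mult_left_mono del: mult_1_right)
    finally show ?thesis by simp
  qed
  have inner: "(\<lambda>n. \<integral>\<^sup>+y. ennreal (X n - y) * tail_ext (X n - y) \<partial>law r) \<longlonglongrightarrow> (\<integral>\<^sup>+y. ennreal (t - y) * tail_ext (t - y) \<partial>law r)"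
    if r: "0 < r" for r
  proof (rule nn_integral_dominated_convergence[where w="\<lambda>_. ennreal C"])
    show "(\<integral>\<^sup>+y. ennreal C \<partial>law r) < \<infinity>"
      using law_UNIV_le[of r] by (auto simp: ennreal_mult_less_top intro: le_less_trans)
    show "AE y in law r. ennreal (X n - y) * tail_ext (X n - y) \<le> ennreal C" for n
      using AE_law_nonneg[of r]
    proof eventually_elim
      case (elim y)
      show ?case by (rule C(2)) (use elim X(3)[of n] in linarith)
    qed
    show "AE y in law r. (\<lambda>n. ennreal (X n - y) * tail_ext (X n - y)) \<longlonglongrightarrow> ennreal (t - y) * tail_ext (t - y)"
      using AE_law_neq[OF r, of t]
    proof eventually_elim
      case (elim y)
      have l: "(\<lambda>n. X n - y) \<longlonglongrightarrow> t - y" by (intro tendsto_intros X)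
      show ?case
      proof (cases "y < t")
        case True
        then show ?thesis
          by (intro tendsto_mult_ennreal tendsto_ennrealI l tail_ext_tendsto) (auto simp: tail_ext_def)
      next
        case False
        then have "\<forall>\<^sub>F n in sequentially. X n - y < 0" using elim by (intro order_tendstoD(2)[OF l]) auto
        then have "\<forall>\<^sub>F n in sequentially. ennreal (X n - y) * tail_ext (X n - y) = 0"
          by eventually_elim (simp add: tail_ext_def)
        then show ?thesis using False by (intro tendsto_eventually) (simp add: tail_ext_def)
      qed
    qed
  qed measurable
  show ?thesis
    unfolding R2_def
  proof (rule nn_integral_dominated_convergence[where w="\<lambda>r. ennreal C * (ennreal (exp (- q * r)) * indicator {0<..} r)"])
    have "(\<integral>\<^sup>+r. ennreal C * (ennreal (exp (- q * r)) * indicator {0<..} r) \<partial>lborel) = ennreal C * ennreal (exp (- q * 0) / q)"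
      using q by (subst nn_integral_cmult, measurable, subst nn_integral_exp_Ioi) auto
    then show "(\<integral>\<^sup>+r. ennreal C * (ennreal (exp (- q * r)) * indicator {0<..} r) \<partial>lborel) < \<infinity>"
      by (simp add: ennreal_mult_less_top)
    show "AE r in lborel. (indicator {0<..} r * ennreal (exp (- q * r))) * (\<integral>\<^sup>+y. ennreal (X n - y) * tail_ext (X n - y) \<partial>law r)
        \<le> ennreal C * (ennreal (exp (- q * r)) * indicator {0<..} r)" for n
    proof (rule AE_I2)
      fix r :: real
      show "(indicator {0<..} r * ennreal (exp (- q * r))) * (\<integral>\<^sup>+y. ennreal (X n - y) * tail_ext (X n - y) \<partial>law r)
        \<le> ennreal C * (ennreal (exp (- q * r)) * indicator {0<..} r)"
      proof -
        have "(indicator {0<..} r * ennreal (exp (- q * r))) * (\<integral>\<^sup>+y. ennreal (X n - y) * tail_ext (X n - y) \<partial>law r)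
          \<le> (indicator {0<..} r * ennreal (exp (- q * r))) * ennreal C"
          by (intro mult_left_mono bd) simp
        then show ?thesis by (simp add: mult_ac)
      qed
    qed
    show "AE r in lborel. (\<lambda>n. (indicator {0<..} r * ennreal (exp (- q * r))) * (\<integral>\<^sup>+y. ennreal (X n - y) * tail_ext (X n - y) \<partial>law r))
      \<longlonglongrightarrow> (indicator {0<..} r * ennreal (exp (- q * r))) * (\<integral>\<^sup>+y. ennreal (t - y) * tail_ext (t - y) \<partial>law r)"
    proof (rule AE_I2)
      fix r :: real
      show "(\<lambda>n. (indicator {0<..} r * ennreal (exp (- q * r))) * (\<integral>\<^sup>+y. ennreal (X n - y) * tail_ext (X n - y) \<partial>law r))
        \<longlonglongrightarrow> (indicator {0<..} r * ennreal (exp (- q * r))) * (\<integral>\<^sup>+y. ennreal (t - y) * tail_ext (t - y) \<partial>law r)"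
      proof (cases "0 < r")
        case True
        have "(\<integral>\<^sup>+y. ennreal (t - y) * tail_ext (t - y) \<partial>law r) \<le> ennreal C"
          by (rule LIMSEQ_le_const2[OF inner[OF True]]) (use bd in auto)
        then show ?thesis
          using True by (intro tendsto_mult_ennreal tendsto_const inner) (auto simp: top_unique)
      qed simp
    qed
  qed measurable
qed

lemma inverse_law_weighted_exp:
  assumes t: "0 < t"
  shows "(\<integral>\<^sup>+l. ennreal (t - b * l) * ennreal (exp (- q * l)) \<partial>inverse_law t) =
    (\<integral>\<^sup>+r. indicator {0<..} r * (ennreal (exp (- q * r)) * (ennreal (t - b * r) * ext_inverse_density r t)) \<partial>lborel)"
proof -
  have "AE t in lborel. 0 < t \<longrightarrow> (\<integral>\<^sup>+l. ennreal (t - b * l) * ennreal (exp (- q * l)) \<partial>inverse_law t) =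
    (\<integral>\<^sup>+s. w (t - s) * ennreal s \<partial>N) + R2 t"
    using AE_inverse_law_eq
  proof eventually_elim
    case (elim t)
    show ?case
      unfolding ext_inverse_density_weighted_integral[symmetric]
      using elim by (auto simp: nn_integral_density mult_ac)
  qed
  note ae = this
  obtain X where X: "\<And>n. 0 < X n \<longrightarrow> (\<integral>\<^sup>+l. ennreal (X n - b * l) * ennreal (exp (- q * l)) \<partial>inverse_law (X n)) =
    (\<integral>\<^sup>+s. w (X n - s) * ennreal s \<partial>N) + R2 (X n)" "\<And>n. t < X n" "\<And>n. X n \<le> t + 1" "X \<longlonglongrightarrow> t"
    by (rule AE_lborel_right_sequence[OF ae, where t=t]) blast
  have X': "\<And>n. t \<le> X n" using X(2) by (auto intro: less_imp_le)
  have eq: "(\<integral>\<^sup>+l. ennreal (X n - b * l) * ennreal (exp (- q * l)) \<partial>inverse_law (X n)) =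
    (\<integral>\<^sup>+s. w (X n - s) * ennreal s \<partial>N) + R2 (X n)" for n
    using X(1)[of n] X(2)[of n] t by auto
  have "(\<lambda>n. \<integral>\<^sup>+l. ennreal (X n - b * l) * ennreal (exp (- q * l)) \<partial>inverse_law (X n)) \<longlonglongrightarrow> (\<integral>\<^sup>+l. ennreal (t - b * l) * ennreal (exp (- q * l)) \<partial>inverse_law t)"
  proof (rule inverse_law_right_continuous[where C="t + 1", OF _ _ _ _ X(4) X'])
    fix l :: "nat \<Rightarrow> real" and l0 assume l: "l \<longlonglongrightarrow> l0"
    show "(\<lambda>n. ennreal (X n - b * l n) * ennreal (exp (- q * l n))) \<longlonglongrightarrow> ennreal (t - b * l0) * ennreal (exp (- q * l0))"
      by (simp add: ennreal_mult''[symmetric]) (intro tendsto_ennrealI tendsto_intros l X)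
  next
    fix n and l :: real assume l: "0 \<le> l"
    have "ennreal (X n - b * l) * ennreal (exp (- q * l)) \<le> ennreal (t + 1) * 1"
    proof (rule mult_mono)
      have "0 \<le> b * l" using b_nonneg l by simp
      then show "ennreal (X n - b * l) \<le> ennreal (t + 1)" using X(3)[of n] by (intro ennreal_leI) linarith
      show "ennreal (exp (- q * l)) \<le> 1" using l q by simp
    qed auto
    then show "ennreal (X n - b * l) * ennreal (exp (- q * l)) \<le> ennreal (t + 1)" by simp
  qed measurable
  moreover have "(\<lambda>n. (\<integral>\<^sup>+s. w (X n - s) * ennreal s \<partial>N) + R2 (X n)) \<longlonglongrightarrow> (\<integral>\<^sup>+s. w (t - s) * ennreal s \<partial>N) + R2 t"
    by (intro tendsto_add R1_right_continuous[OF X(4) X' X(3)] R2_right_continuous[OF X(4) X' X(3)])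
  ultimately show ?thesis
    unfolding ext_inverse_density_weighted_integral eq using LIMSEQ_unique by blast
qed

end

text \<open>If the inverse at t is at least \<open>t / b\<close>, then \<open>\<sigma> x\<close> is
  at most t for every x < t / b. The Chernoff bound for these x is continuous up to
  \<open>t / b\<close>, where its exponent is \<open>- (t / b) * (f z - b * z)\<close>; so z is
  chosen at the end point and x afterwards.\<close>

lemma inverse_law_end_point: assumes t: "0 < t" and b: "0 < b" shows "emeasure (inverse_law t) {t / b..} = 0"
proof -
  have le: "emeasure (inverse_law t) {t / b..} \<le> ennreal (exp (z * t - x * f z))" if x: "0 < x" "x < t / b" and z: "0 < z" for x z
  proof -
    have [measurable]: "\<sigma> x \<in> borel_measurable M" using x by (intro \<sigma>_measurable) auto
    have "emeasure (inverse_law t) {t / b..} = (\<integral>\<^sup>+l. indicator {t / b..} l \<partial>inverse_law t)" by simp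
    also have "\<dots> = (\<integral>\<^sup>+\<omega>. (if L t \<omega> < \<infinity> then indicator {t / b..} (enn2real (L t \<omega>)) else 0) \<partial>M)"
      by (rule nn_integral_inverse_law) measurable
    also have "\<dots> \<le> (\<integral>\<^sup>+\<omega>. (if \<sigma> x \<omega> < \<infinity> then indicator {..t} (enn2real (\<sigma> x \<omega>)) else 0) \<partial>M)"
    proof (rule nn_integral_mono)
      fix \<omega>
      show "(if L t \<omega> < \<infinity> then indicator {t / b..} (enn2real (L t \<omega>)) else 0) \<le> (if \<sigma> x \<omega> < \<infinity> then indicator {..t} (enn2real (\<sigma> x \<omega>)) else 0 :: ennreal)"
      proof (cases "L t \<omega> < \<infinity> \<and> t / b \<le> enn2real (L t \<omega>)")
        case True
        then have "ennreal x < L t \<omega>"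
          using x by (cases "L t \<omega>" rule: ennreal_cases) (auto simp: ennreal_less_iff)
        then have "\<sigma> x \<omega> \<le> ennreal t" using L_le[OF x(1), of t \<omega>] by (auto simp: not_less[symmetric])
        then have "\<sigma> x \<omega> < \<infinity>" "enn2real (\<sigma> x \<omega>) \<le> t"
          using t by (auto intro: le_less_trans simp: enn2real_leI)
        then show ?thesis by (auto split: split_indicator)
      qed auto
    qed
    also have "\<dots> = (\<integral>\<^sup>+y. indicator {..t} y \<partial>law x)"
      using x unfolding law_eq[OF less_imp_le[OF x(1)]] by (intro nn_integral_finite_law[symmetric]) auto
    also have "\<dots> = emeasure (law x) {..t}" by simp
    also have "\<dots> \<le> ennreal (exp (z * t - x * f z))" using x z by (intro law_Chernoff) auto
    finally show ?thesis .
  qed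
  have "emeasure (inverse_law t) {t / b..} \<le> 0 + ennreal e" if e: "0 < e" for e
  proof -
    \<comment> \<open>The summand 1 makes the bound at \<open>t / b\<close> strictly smaller than
      \<open>e\<close>, which leaves room to move to some x < t / b.\<close>
    obtain z where z: "0 < z" "b / t * (- ln e) + 1 \<le> f z - b * z" using f_unbounded by blast
    have tb: "0 < t / b" using t b by simp
    have "t / b * (b / t * (- ln e) + 1) \<le> t / b * (f z - b * z)" using z tb by (intro mult_left_mono) auto
    moreover have "t / b * (b / t * (- ln e) + 1) = - ln e + t / b" "t / b * (f z - b * z) = t / b * f z - z * t"
      using t b by (simp_all add: field_simps)
    ultimately have "- ln e + t / b \<le> t / b * f z - z * t" by simp
    then have "z * t - t / b * f z < ln e" using tb by linarith
    then have "exp (z * t - t / b * f z) < e" using e by (metis exp_less_mono exp_ln)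
    moreover have "((\<lambda>x. exp (z * t - x * f z)) \<longlongrightarrow> exp (z * t - t / b * f z)) (at_left (t / b))"
      by (intro tendsto_intros)
    ultimately have "\<forall>\<^sub>F x in at_left (t / b). exp (z * t - x * f z) < e" by (intro order_tendstoD)
    then have "\<forall>\<^sub>F x in at_left (t / b). exp (z * t - x * f z) < e \<and> x \<in> {0<..<t / b}"
      using eventually_at_left_real[OF tb] by eventually_elim auto
    then obtain x where x: "exp (z * t - x * f z) < e" "0 < x" "x < t / b"
      using eventually_happens'[OF trivial_limit_at_left_real] by force
    have "emeasure (inverse_law t) {t / b..} \<le> ennreal (exp (z * t - x * f z))" by (rule le[OF x(2,3) z(1)])
    also have "\<dots> \<le> ennreal e" using x(1) by (intro ennreal_leI) simp
    finally show ?thesis by simp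
  qed
  then have "emeasure (inverse_law t) {t / b..} \<le> 0" by (rule ennreal_le_epsilon) auto
  then show ?thesis by simp
qed

lemma AE_inverse_law_less: assumes t: "0 < t" shows "AE l in inverse_law t. b * l < t"
proof (cases "b = 0")
  case False
  then have b: "0 < b" using b_nonneg by simp
  show ?thesis
    by (rule AE_I[of _ _ "{t / b..}"]) (use inverse_law_end_point[OF t b] b in \<open>auto simp: field_simps\<close>)
qed (use t in simp)

text \<open>The exponents q = 1, 2, 3, ... of \<open>inverse_law_weighted_exp\<close> identify the
  measure weighted by \<open>t - b * l\<close>. The weight is positive almost surely by
  \<open>AE_inverse_law_less\<close> and can be divided out.\<close>

lemma inverse_law_density: assumes t: "0 < t" shows "inverse_law t = density lborel (\<lambda>r. indicator {0<..} r * ext_inverse_density r t)"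
proof -
  define g where "g l = (if b * l < t then ennreal (1 / (t - b * l)) else 0)" for l
  have [measurable]: "g \<in> borel_measurable borel" unfolding g_def by measurable
  have lap: "(\<integral>\<^sup>+l. ennreal (exp (- q * l)) \<partial>density (inverse_law t) (\<lambda>l. ennreal (t - b * l))) =
     (\<integral>\<^sup>+l. ennreal (exp (- q * l)) \<partial>density lborel (\<lambda>r. indicator {0<..} r * (ennreal (t - b * r) * ext_inverse_density r t)))" if "1 \<le> q" for q
    using inverse_law_weighted_exp[OF that t] by (simp add: nn_integral_density mult_ac)
  have "density (inverse_law t) (\<lambda>l. ennreal (t - b * l)) = density lborel (\<lambda>r. indicator {0<..} r * (ennreal (t - b * r) * ext_inverse_density r t))"
  proof (rule laplace_unique)
    show "AE x in density (inverse_law t) (\<lambda>l. ennreal (t - b * l)). 0 \<le> x"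
      using AE_inverse_law_nonneg[of t] by (subst AE_density) auto
    show "AE x in density lborel (\<lambda>r. indicator {0<..} r * (ennreal (t - b * r) * ext_inverse_density r t)). 0 \<le> x"
      by (subst AE_density) (auto split: split_indicator)
    show "(\<integral>\<^sup>+l. ennreal (exp (- (real j + 1) * l)) \<partial>density (inverse_law t) (\<lambda>l. ennreal (t - b * l))) =
     (\<integral>\<^sup>+l. ennreal (exp (- (real j + 1) * l)) \<partial>density lborel (\<lambda>r. indicator {0<..} r * (ennreal (t - b * r) * ext_inverse_density r t)))" for j :: nat
      by (rule lap) simp
    have "(\<integral>\<^sup>+l. ennreal (exp (- l)) \<partial>density (inverse_law t) (\<lambda>l. ennreal (t - b * l))) = (\<integral>\<^sup>+l. ennreal (t - b * l) * ennreal (exp (- l)) \<partial>inverse_law t)"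
      by (rule nn_integral_density) measurable
    also have "\<dots> \<le> (\<integral>\<^sup>+l. ennreal t * ennreal (exp (- 1 * l)) \<partial>inverse_law t)"
    proof (rule nn_integral_mono_AE)
      show "AE l in inverse_law t. ennreal (t - b * l) * ennreal (exp (- l)) \<le> ennreal t * ennreal (exp (- 1 * l))"
        using AE_inverse_law_nonneg[of t] by eventually_elim (use b_nonneg in \<open>auto intro!: mult_right_mono ennreal_leI\<close>)
    qed
    also have "\<dots> = ennreal t * (\<integral>\<^sup>+l. ennreal (exp (- 1 * l)) \<partial>inverse_law t)" by (rule nn_integral_cmult) measurable
    also have "\<dots> < \<infinity>" using inverse_law_exp_finite[of 1 t] by (auto simp: ennreal_mult_less_top intro: le_less_trans)
    finally show "(\<integral>\<^sup>+l. ennreal (exp (- l)) \<partial>density (inverse_law t) (\<lambda>l. ennreal (t - b * l))) < \<infinity>" .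
  qed auto
  note eq = this
  have one: "ennreal (t - b * l) * g l = 1" if "b * l < t" for l
    using that by (simp add: g_def ennreal_mult[symmetric])
  have "inverse_law t = density (inverse_law t) (\<lambda>_. 1)" by (rule density_1[symmetric])
  also have "\<dots> = density (inverse_law t) (\<lambda>l. ennreal (t - b * l) * g l)"
  proof (rule density_cong)
    show "AE l in inverse_law t. 1 = ennreal (t - b * l) * g l"
      using AE_inverse_law_less[OF t] by eventually_elim (simp add: one)
  qed measurable
  also have "\<dots> = density (density (inverse_law t) (\<lambda>l. ennreal (t - b * l))) g"
    by (subst density_density_eq) auto
  also have "\<dots> = density lborel (\<lambda>r. (indicator {0<..} r * (ennreal (t - b * r) * ext_inverse_density r t)) * g r)"
    unfolding eq by (subst density_density_eq) auto
  also have "(\<lambda>r. (indicator {0<..} r * (ennreal (t - b * r) * ext_inverse_density r t)) * g r) = (\<lambda>r. indicator {0<..} r * ext_inverse_density r t)"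
  proof
    fix r
    show "(indicator {0<..} r * (ennreal (t - b * r) * ext_inverse_density r t)) * g r = indicator {0<..} r * ext_inverse_density r t"
    proof (cases "0 < r \<and> b * r < t")
      case True
      have "(ennreal (t - b * r) * ext_inverse_density r t) * g r = (ennreal (t - b * r) * g r) * ext_inverse_density r t" by (simp add: mult_ac)
      then show ?thesis using True one[of r] by simp
    next
      case False
      then show ?thesis using ext_inverse_density_zero[of r t] by (cases "0 < r") auto
    qed
  qed
  finally show ?thesis .
qed

text \<open>The first form makes the inverse density an instance of the convolution primitive, as a
  function of t. In the second, only \<open>b * \<mu> r t\<close> depends on the version of the
  density.\<close>

lemma inverse_density_eq:
  assumes r: "0 < r" and u: "finite_part_density M (\<sigma> r) (\<mu> r)"
  shows "inverse_density b \<nu> \<mu> t r = conv_primitive b \<nu> 0 (\<mu> r) t"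
    and "inverse_density b \<nu> \<mu> t r = b * \<mu> r t + enn2real (\<integral>\<^sup>+y. tail_ext (t - y) \<partial>law r)"
proof -
  show 1: "inverse_density b \<nu> \<mu> t r = conv_primitive b \<nu> 0 (\<mu> r) t"
    using r by (simp add: inverse_density_def conv_primitive_def)
  note d = density_laplace[OF r u]
  note [measurable] = laplace_densityD(1)[OF d(1)]
  have "conv_primitive b \<nu> 0 (\<mu> r) t = b * \<mu> r t + enn2real (\<integral>\<^sup>+s. tail_ext s * ennreal (\<mu> r (t - s)) \<partial>lborel)"
    by (rule conv_primitive_laplace(4)[OF d(1) _ _ d(2)]) (use b_nonneg r in auto)
  also have "(\<integral>\<^sup>+s. tail_ext s * ennreal (\<mu> r (t - s)) \<partial>lborel) = (\<integral>\<^sup>+y. tail_ext (t - y) * ennreal (\<mu> r y) \<partial>lborel)"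
    by (rule nn_integral_conv_commute) measurable
  also have "\<dots> = (\<integral>\<^sup>+y. tail_ext (t - y) \<partial>law r)"
    unfolding d(3) by (subst nn_integral_density) (auto simp: mult.commute)
  finally show "inverse_density b \<nu> \<mu> t r = b * \<mu> r t + enn2real (\<integral>\<^sup>+y. tail_ext (t - y) \<partial>law r)"
    using 1 by simp
qed

text \<open>For fixed t the formula is a function of r, and its drift term samples each density at
  the single point t. The explicit, jointly measurable version \<open>sub_density\<close> gives
  these values a meaning.\<close>

lemma inverse_finite_part_density:
  assumes t: "0 < t"
  shows "finite_part_density M (L t) (inverse_density b \<nu> sub_density t)"
proof -
  let ?l = "inverse_density b \<nu> sub_density t"
  let ?I = "\<lambda>r. \<integral>\<^sup>+y. tail_ext (t - y) \<partial>law r"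
  have [measurable]: "?I \<in> borel_measurable borel" by (rule nn_integral_law_measurable) measurable
  have [measurable]: "(\<lambda>r. sub_density r t) \<in> borel_measurable borel" unfolding sub_density_def by measurable
  have l_eq: "?l r = (if r < 0 then 0 else if r = 0 then ?l 0 else b * sub_density r t + enn2real (?I r))" for r
    using inverse_density_eq(2)[where \<mu>=sub_density and r=r and t=t, OF _ sub_density_finite_part_density] by (auto simp: inverse_density_def)
  have l0: "0 \<le> ?l 0"
    unfolding inverse_density_def set_lebesgue_integral_def
    by (auto intro!: integral_nonneg_AE AE_I2 mult_nonneg_nonneg tail_nonneg)
  have m0: "0 \<le> sub_density r t" for r by (simp add: sub_density_def)
  have nn: "0 \<le> ?l r" for r
    using l0 b_nonneg m0[of r] by (subst l_eq) (auto intro!: add_nonneg_nonneg mult_nonneg_nonneg)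
  have "?l = (\<lambda>r. if r < 0 then 0 else if r = 0 then ?l 0 else b * sub_density r t + enn2real (?I r))"
    using l_eq by auto
  also have "\<dots> \<in> borel_measurable borel" by measurable
  finally have [measurable]: "?l \<in> borel_measurable borel" .
  have "(\<integral>\<^sup>+r. indicator {0<..} r * ext_inverse_density r t \<partial>lborel) = emeasure (inverse_law t) UNIV"
    by (simp add: inverse_law_density[OF t] emeasure_density)
  then have "(\<integral>\<^sup>+r. indicator {0<..} r * ext_inverse_density r t \<partial>lborel) \<noteq> \<infinity>" using inverse_law_exp_finite[of 0 t] by (auto simp: top_unique)
  then have "AE r in lborel. indicator {0<..} r * ext_inverse_density r t \<noteq> \<infinity>" by (intro nn_integral_PInf_AE) auto
  \<comment> \<open>For almost every r the extended density is finite, so the two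
    \<open>enn2real\<close> conversions are exact; the separately defined value at r = 0 is
    negligible.\<close>
  then have AE: "AE r in lborel. ennreal (?l r) = indicator {0<..} r * ext_inverse_density r t"
    using AE_lborel_singleton[of 0]
  proof eventually_elim
    case (elim r)
    show ?case
    proof (cases "0 < r")
      case True
      then have fin: "ext_inverse_density r t \<noteq> \<infinity>" using elim by simp
      then have I: "ennreal (enn2real (?I r)) = ?I r" by (simp add: ext_inverse_density_def less_top)
      have "ennreal (b * sub_density r t) = ennreal b * ext_density r t"
      proof (cases "b = 0")
        case False
        then have "ext_density r t < \<infinity>" using fin b_nonneg by (auto simp: ext_inverse_density_def less_top ennreal_mult_eq_top_iff)
        then show ?thesis using b_nonneg by (simp add: sub_density_def ennreal_mult)
      qed simp
      then have "ennreal (?l r) = ext_inverse_density r t"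
        using True I m0[of r] b_nonneg by (subst l_eq) (simp add: ext_inverse_density_def)
      then show ?thesis using True by simp
    next
      case False
      then have "r < 0" using elim by simp
      then show ?thesis by (subst l_eq) simp
    qed
  qed
  have "density lborel (\<lambda>r. ennreal (?l r)) = density lborel (\<lambda>r. indicator {0<..} r * ext_inverse_density r t)"
    by (rule density_cong) (use AE in auto)
  then show ?thesis
    using nn inverse_law_density[OF t] by (subst finite_part_density_iff) (auto simp: inverse_law_def)
qed

end

section \<open>Initial and boundary values\<close>

lemma integral_finite_part_density:
  assumes X [measurable]: "X \<in> borel_measurable M" and u: "finite_part_density M X u"
    and [measurable]: "\<phi> \<in> borel_measurable borel"
  shows "(LINT x|lborel. \<phi> x * u x) = (LINT \<omega>|M. (if X \<omega> < \<infinity> then \<phi> (enn2real (X \<omega>)) else 0 :: real))"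
proof -
  from u have u0: "\<And>x. 0 \<le> u x" and [measurable]: "u \<in> borel_measurable borel"
    and l: "finite_law M X = density lborel (\<lambda>x. ennreal (u x))"
    by (auto simp: finite_part_density_iff[OF X])
  have "(LINT x|lborel. \<phi> x * u x) = (LINT x|density lborel (\<lambda>x. ennreal (u x)). \<phi> x)"
    using u0 by (subst integral_density) (auto simp: mult.commute)
  also have "\<dots> = (LINT x|finite_law M X. \<phi> x)" by (simp add: l)
  also have "\<dots> = (LINT \<omega>|restrict_space M {\<omega>\<in>space M. X \<omega> < \<infinity>}. \<phi> (enn2real (X \<omega>)))"
    unfolding finite_law_def by (rule integral_distr) (auto intro: measurable_restrict_space1)
  also have "\<dots> = (LINT \<omega>|M. indicator {\<omega>\<in>space M. X \<omega> < \<infinity>} \<omega> *\<^sub>R \<phi> (enn2real (X \<omega>)))"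
    by (rule integral_restrict_space) measurable
  also have "\<dots> = (LINT \<omega>|M. (if X \<omega> < \<infinity> then \<phi> (enn2real (X \<omega>)) else 0))"
    by (intro Bochner_Integration.integral_cong refl) (auto split: split_indicator)
  finally show ?thesis .
qed

text \<open>Almost sure convergence to 0 makes the variables eventually finite, so the mass lost to
  infinity disappears in the limit and bounded convergence applies.\<close>

lemma finite_part_density_tendsto:
  assumes M: "prob_space M" and X [measurable]: "\<And>n. X n \<in> borel_measurable M"
    and u: "\<And>n. finite_part_density M (X n) (u n)"
    and lim: "AE \<omega> in M. (\<lambda>n. X n \<omega>) \<longlonglongrightarrow> 0"
    and \<phi>: "continuous_on UNIV \<phi>" "bounded (range \<phi>)"
  shows "(\<lambda>n. LINT x|lborel. \<phi> x * u n x) \<longlonglongrightarrow> (\<phi> 0 :: real)"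
proof -
  interpret prob_space M by fact
  have [measurable]: "\<phi> \<in> borel_measurable borel" using \<phi>(1) by (rule borel_measurable_continuous_onI)
  obtain B where B: "\<And>x. \<bar>\<phi> x\<bar> \<le> B" using \<phi>(2) by (auto simp: bounded_iff)
  have B0: "0 \<le> B" using B[of 0] by linarith
  have "(\<lambda>n. LINT \<omega>|M. (if X n \<omega> < \<infinity> then \<phi> (enn2real (X n \<omega>)) else 0)) \<longlonglongrightarrow> (LINT \<omega>|M. \<phi> 0)"
  proof (rule integral_dominated_convergence[where w="\<lambda>_. B"])
    show "AE \<omega> in M. (\<lambda>n. if X n \<omega> < \<infinity> then \<phi> (enn2real (X n \<omega>)) else 0) \<longlonglongrightarrow> \<phi> 0"
      using lim
    proof eventually_elim
      case (elim \<omega>)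
      then have "(\<lambda>n. X n \<omega>) \<longlonglongrightarrow> ennreal 0" by simp
      then have "(\<lambda>n. enn2real (X n \<omega>)) \<longlonglongrightarrow> 0" by (rule tendsto_enn2real) simp
      then have "(\<lambda>n. \<phi> (enn2real (X n \<omega>))) \<longlonglongrightarrow> \<phi> 0"
        using \<phi>(1) by (intro isCont_tendsto_compose[of 0 \<phi>]) (auto simp: continuous_on_eq_continuous_at)
      moreover have "\<forall>\<^sub>F n in sequentially. \<phi> (enn2real (X n \<omega>)) = (if X n \<omega> < \<infinity> then \<phi> (enn2real (X n \<omega>)) else 0)"
        using order_tendstoD(2)[OF elim, of \<infinity>] by (auto elim: eventually_mono)
      ultimately show ?case by (rule Lim_transform_eventually)
    qed
    show "AE \<omega> in M. norm (if X n \<omega> < \<infinity> then \<phi> (enn2real (X n \<omega>)) else 0) \<le> B" for n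
      using B B0 by auto
  qed auto
  then show ?thesis
    by (simp add: integral_finite_part_density[OF X u] prob_space)
qed

lemma LBINT_greaterThan_eq:
  fixes \<phi> u :: "real \<Rightarrow> real"
  assumes [measurable]: "\<phi> \<in> borel_measurable borel" "u \<in> borel_measurable borel"
    and AE: "AE x in lborel. x \<le> c \<longrightarrow> u x = 0"
  shows "(LBINT x:{c<..}. \<phi> x * u x) = (LINT x|lborel. \<phi> x * u x)"
  unfolding set_lebesgue_integral_def
proof (rule integral_cong_AE)
  show "AE x in lborel. indicat_real {c<..} x *\<^sub>R (\<phi> x * u x) = \<phi> x * u x"
    using AE by eventually_elim (auto split: split_indicator)
qed measurable

lemma laplace_density_set_integrable:
  assumes u: "laplace_density u F"
  shows "set_integrable lborel {..d} u"
  unfolding set_integrable_def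
proof (rule Bochner_Integration.integrable_bound)
  note [measurable] = laplace_densityD(1)[OF u]
  show "integrable lborel (\<lambda>x. exp d * (exp (- 1 * x) * u x))"
    by (intro integrable_mult_right laplace_density_exp[OF u]) simp
  show "(\<lambda>x. indicat_real {..d} x *\<^sub>R u x) \<in> borel_measurable lborel" by measurable
  show "AE x in lborel. norm (indicat_real {..d} x *\<^sub>R u x) \<le> norm (exp d * (exp (- 1 * x) * u x))"
  proof (rule AE_I2)
    fix x
    have "1 * u x \<le> exp (d - x) * u x" if "x \<le> d"
      using that laplace_densityD(2)[OF u] by (intro mult_right_mono) auto
    then show "norm (indicat_real {..d} x *\<^sub>R u x) \<le> norm (exp d * (exp (- 1 * x) * u x))"
      using laplace_densityD(2)[OF u, of x] by (auto simp: exp_diff exp_minus field_simps split: split_indicator)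
  qed
qed

section \<open>The equations with their initial and boundary data\<close>

context subordinator_process
begin

text \<open>The weak equation sees each \<open>\<mu> t\<close> through integrals only, and the
  classical one is deduced from it, so the choice of versions is immaterial.\<close>

lemma density_equation_any_version:
  assumes \<mu>: "\<And>t. 0 < t \<Longrightarrow> finite_part_density M (\<sigma> t) (\<mu> t)"
  shows "density_equation b \<nu> \<mu>"
  unfolding density_equation_def evolution_def
proof
  note d = density_laplace[OF _ \<mu>]
  show weak: "weak_evolution b \<nu> (\<lambda>t. b * t) \<mu>"
    by (rule weak_evolution_laplace[where \<tau>="\<lambda>_. 1"]) (use d b_nonneg in auto)
  show "classical_evolution b \<nu> (\<lambda>t. b * t) \<mu>"
    by (rule weak_imp_classical_evolution[OF weak])
       (use d(1) laplace_densityD(1) laplace_density_set_integrable in blast)+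
qed

lemma inverse_density_laplace:
  assumes r: "0 < r" and \<mu>: "finite_part_density M (\<sigma> r) (\<mu> r)"
  shows "laplace_density (\<lambda>t. inverse_density b \<nu> \<mu> t r) (\<lambda>z. f z / z * exp (- r * f z))"
    and "AE t in lborel. t \<le> b * r \<longrightarrow> inverse_density b \<nu> \<mu> t r = 0"
proof -
  note d = density_laplace[OF r \<mu>]
  have c: "0 \<le> (0::real)" "0 \<le> b * r" using r b_nonneg by auto
  show "laplace_density (\<lambda>t. inverse_density b \<nu> \<mu> t r) (\<lambda>z. f z / z * exp (- r * f z))"
    unfolding inverse_density_eq(1)[where \<mu>=\<mu>, OF r \<mu>] by (rule conv_primitive_laplace(1)[OF d(1) c d(2)])
  show "AE t in lborel. t \<le> b * r \<longrightarrow> inverse_density b \<nu> \<mu> t r = 0"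
    unfolding inverse_density_eq(1)[where \<mu>=\<mu>, OF r \<mu>] by (rule conv_primitive_laplace(2)[OF d(1) c d(2)])
qed

lemma inverse_equation_any_version:
  assumes \<mu>: "\<And>t. 0 < t \<Longrightarrow> finite_part_density M (\<sigma> t) (\<mu> t)"
  shows "inverse_equation b \<nu> (inverse_density b \<nu> \<mu>)"
  unfolding inverse_equation_def evolution_def
proof
  note d = inverse_density_laplace[where \<mu>=\<mu>, OF _ \<mu>]
  show weak: "weak_evolution b \<nu> (\<lambda>x. 0) (\<lambda>x t. inverse_density b \<nu> \<mu> t x)"
    by (rule weak_evolution_laplace[where \<tau>="\<lambda>z. f z / z"]) (use d b_nonneg in auto)
  show "classical_evolution b \<nu> (\<lambda>x. 0) (\<lambda>x t. inverse_density b \<nu> \<mu> t x)"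
    by (rule weak_imp_classical_evolution[OF weak])
       (use d(1) laplace_densityD(1) laplace_density_set_integrable in blast)+
qed

lemma AE_\<sigma>_pos: assumes t: "0 < t" shows "AE \<omega> in M. 0 < \<sigma> t \<omega>"
proof -
  have [measurable]: "\<sigma> t \<in> borel_measurable M" using t by (intro \<sigma>_measurable) auto
  have "0 \<le> b * t" using b_nonneg t by simp
  then have "emeasure (law t) {..0} \<le> emeasure (law t) {..b * t}" by (intro emeasure_mono) auto
  then have "(\<integral>\<^sup>+y. indicator {..0} y \<partial>law t) = 0" using law_Iic_drift[OF t] by simp
  then have "(\<integral>\<^sup>+\<omega>. (if \<sigma> t \<omega> < \<infinity> then indicator {..0} (enn2real (\<sigma> t \<omega>)) else 0) \<partial>M) = 0"
    using t unfolding law_eq[OF less_imp_le[OF t]] by (subst (asm) nn_integral_finite_law) auto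
  then have "AE \<omega> in M. (if \<sigma> t \<omega> < \<infinity> then indicator {..0} (enn2real (\<sigma> t \<omega>)) else 0 :: ennreal) = 0"
    by (subst (asm) nn_integral_0_iff_AE) auto
  then show ?thesis
    by eventually_elim (auto simp: zero_less_iff_neq_zero split: if_splits)
qed

text \<open>Almost surely the subordinator is positive at all times 1 / (n + 1), hence passes level
  0 immediately. This includes b = 0, where the positivity is due to the infinite mass of
  \<open>N\<close>.\<close>

lemma AE_L_0: "AE \<omega> in M. L 0 \<omega> = 0"
proof -
  have "AE \<omega> in M. \<forall>n::nat. 0 < \<sigma> (1 / (real n + 1)) \<omega>"
    by (subst AE_all_countable) (intro allI AE_\<sigma>_pos, simp)
  then show ?thesis
  proof eventually_elim
    case (elim \<omega>)
    have "L 0 \<omega> \<le> 0 + ennreal e" if e: "0 < e" for e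
    proof -
      obtain n where "1 / e \<le> real n" using real_arch_simple by blast
      then have "1 / e < real n + 1" by simp
      then have n: "1 / (real n + 1) < e" using e by (simp add: field_simps)
      have "L 0 \<omega> \<le> ennreal (1 / (real n + 1))" using elim by (intro L_le) auto
      also have "\<dots> \<le> ennreal e" using n by (intro ennreal_leI) simp
      finally show ?thesis by simp
    qed
    then have "L 0 \<omega> \<le> 0" by (rule ennreal_le_epsilon) auto
    then show ?case by simp
  qed
qed

lemma distr_\<sigma>_0: "distr M borel (\<sigma> 0) = return borel 0"
proof -
  have "distr M borel (\<sigma> 0) = distr M borel (\<lambda>_. 0)"
    by (rule distr_cong) (auto simp: \<sigma>_0)
  then show ?thesis by (simp add: PM.distr_const)
qed

lemma distr_L_0: "distr M borel (L 0) = return borel 0"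
proof -
  have "distr M borel (L 0) = distr M borel (\<lambda>_. 0)"
    by (rule distr_cong_AE) (auto simp: AE_L_0)
  then show ?thesis by (simp add: PM.distr_const)
qed

lemma sub_density_zero: "x \<le> b * t \<Longrightarrow> sub_density t x = 0"
  by (simp add: sub_density_def ext_density_def)

lemma density_initial:
  assumes \<phi>: "continuous_on UNIV \<phi>" "bounded (range \<phi>)"
  shows "((\<lambda>t. LBINT x:{b * t<..}. \<phi> x * sub_density t x) \<longlongrightarrow> \<phi> 0) (at_right 0)"
proof (rule tendsto_at_right_sequentially[of 0 1])
  fix S :: "nat \<Rightarrow> real" assume S: "\<And>n. 0 < S n" "S \<longlonglongrightarrow> 0"
  have [measurable]: "\<phi> \<in> borel_measurable borel" using \<phi>(1) by (rule borel_measurable_continuous_onI)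
  have "(LBINT x:{b * S n<..}. \<phi> x * sub_density (S n) x) = (LINT x|lborel. \<phi> x * sub_density (S n) x)" for n
    by (rule LBINT_greaterThan_eq)
       (use laplace_densityD(1)[OF density_laplace(1)[OF S(1) sub_density_finite_part_density[OF S(1)]]] sub_density_zero in auto)
  moreover have "(\<lambda>n. LINT x|lborel. \<phi> x * sub_density (S n) x) \<longlonglongrightarrow> \<phi> 0"
  proof (rule finite_part_density_tendsto[where X="\<lambda>n. \<sigma> (S n)", OF prob_space_M _ sub_density_finite_part_density[OF S(1)] _ \<phi>])
    show "\<sigma> (S n) \<in> borel_measurable M" for n using S(1)[of n] by (intro \<sigma>_measurable) auto
    show "AE \<omega> in M. (\<lambda>n. \<sigma> (S n) \<omega>) \<longlonglongrightarrow> 0"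
    proof (rule AE_I2)
      fix \<omega> assume \<omega>: "\<omega> \<in> space M"
      have "((\<lambda>r. \<sigma> r \<omega>) \<longlongrightarrow> \<sigma> 0 \<omega>) (at_right 0)"
        using \<sigma>_right_cont[OF \<omega>, of 0] by (simp add: continuous_within)
      moreover have "filterlim S (at_right 0) sequentially"
        using S by (auto simp: filterlim_at less_imp_neq[symmetric] intro!: always_eventually)
      ultimately show "(\<lambda>n. \<sigma> (S n) \<omega>) \<longlonglongrightarrow> 0"
        using \<sigma>_0[OF \<omega>] by (auto dest: filterlim_compose)
    qed
  qed
  ultimately show "(\<lambda>n. LBINT x:{b * S n<..}. \<phi> x * sub_density (S n) x) \<longlonglongrightarrow> \<phi> 0" by simp
qed simp

lemma inverse_initial:
  assumes \<phi>: "continuous_on UNIV \<phi>" "bounded (range \<phi>)"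
  shows "((\<lambda>t. LBINT x:{0<..}. \<phi> x * inverse_density b \<nu> sub_density t x) \<longlongrightarrow> \<phi> 0) (at_right 0)"
proof (rule tendsto_at_right_sequentially[of 0 1])
  fix S :: "nat \<Rightarrow> real" assume S: "\<And>n. 0 < S n" "S \<longlonglongrightarrow> 0"
  have [measurable]: "\<phi> \<in> borel_measurable borel" using \<phi>(1) by (rule borel_measurable_continuous_onI)
  note l = inverse_finite_part_density[OF S(1)]
  have "(LBINT x:{0<..}. \<phi> x * inverse_density b \<nu> sub_density (S n) x) = (LINT x|lborel. \<phi> x * inverse_density b \<nu> sub_density (S n) x)" for n
  proof (rule LBINT_greaterThan_eq)
    show "inverse_density b \<nu> sub_density (S n) \<in> borel_measurable borel"
      using l[of n] finite_part_density_iff[OF L_measurable] by blast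
    show "AE x in lborel. x \<le> 0 \<longrightarrow> inverse_density b \<nu> sub_density (S n) x = 0"
      using AE_lborel_singleton[of 0] by eventually_elim (simp add: inverse_density_def)
  qed measurable
  moreover have "(\<lambda>n. LINT x|lborel. \<phi> x * inverse_density b \<nu> sub_density (S n) x) \<longlonglongrightarrow> \<phi> 0"
  proof (rule finite_part_density_tendsto[OF prob_space_M L_measurable l _ \<phi>])
    show "AE \<omega> in M. (\<lambda>n. L (S n) \<omega>) \<longlonglongrightarrow> 0"
      using AE_L_0
    proof eventually_elim
      case (elim \<omega>)
      show ?case using L_right_continuous[OF S(2), of \<omega>] S(1) elim by (auto intro: less_imp_le)
    qed
  qed
  ultimately show "(\<lambda>n. LBINT x:{0<..}. \<phi> x * inverse_density b \<nu> sub_density (S n) x) \<longlonglongrightarrow> \<phi> 0" by simp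
qed simp

lemma tail_laplace_density: "laplace_density (\<lambda>s. if 0 < s then \<nu> s else 0) (\<lambda>z. f z / z - b)"
proof -
  have eq: "(if 0 < s then \<nu> s else 0) = enn2real (tail_ext s)" for s
    using tail_nonneg[of s] by (simp add: tail_ext_def)
  have "tail_ext s = ennreal (enn2real (tail_ext s))" for s by (simp add: tail_ext_def)
  then show ?thesis
    unfolding laplace_density_def eq
  proof (intro conjI allI impI)
    show "AE s in lborel. s \<le> 0 \<longrightarrow> enn2real (tail_ext s) = 0" by (auto simp: tail_ext_def)
    fix z :: real assume z: "0 < z"
    show "0 \<le> f z / z - b" using f_ge[OF z] z by (simp add: field_simps)
    show "(\<integral>\<^sup>+s. ennreal (exp (- z * s)) * ennreal (enn2real (tail_ext s)) \<partial>lborel) = ennreal (f z / z - b)"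
      using tail_ext_laplace[OF z] by (simp only: \<open>\<And>s. tail_ext s = ennreal (enn2real (tail_ext s))\<close>[symmetric])
  qed simp_all
qed

text \<open>As x decreases to 0 the transforms tend to \<open>f z / z\<close>, which belongs to b
  times the Dirac mass at 0 plus the tail. The Dirac part is invisible because the test function
  vanishes at 0; for its approximants this holds up to a small error.\<close>

lemma inverse_boundary_limit:
  assumes \<psi>: "continuous_on UNIV \<psi>" and K: "compact K" "K \<subseteq> {0<..}" "\<And>t. t \<notin> K \<Longrightarrow> \<psi> t = 0"
  shows "((\<lambda>x. LBINT t:{b * x<..}. \<psi> t * inverse_density b \<nu> sub_density t x) \<longlongrightarrow> (LBINT t:{0<..}. \<psi> t * \<nu> t)) (at_right 0)"
proof -
  have [measurable]: "\<psi> \<in> borel_measurable borel" using \<psi> by (rule borel_measurable_continuous_onI)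
  obtain T where T: "\<And>x. x \<in> K \<Longrightarrow> norm x \<le> T" using compact_imp_bounded[OF K(1)] by (auto simp: bounded_iff)
  have zero: "\<psi> y = 0" if "T + 1 \<le> y" for y using T[of y] K(3)[of y] that by fastforce
  have \<psi>0: "\<psi> 0 = 0" using K by auto
  have cont: "continuous_on {0..} \<psi>" using \<psi> by (rule continuous_on_subset) simp
  obtain C where C: "\<And>y. 0 \<le> y \<Longrightarrow> \<bar>\<psi> y\<bar> \<le> C * exp (- y)"
    using compact_support_exp_bound[OF cont zero] by metis
  define I where "I x = (LINT t|lborel. \<psi> t * inverse_density b \<nu> sub_density t x)" for x
  define J where "J = (LINT t|lborel. \<psi> t * (if 0 < t then \<nu> t else 0))"
  have J: "(LBINT t:{0<..}. \<psi> t * \<nu> t) = J"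
    unfolding J_def set_lebesgue_integral_def
    by (intro Bochner_Integration.integral_cong refl) (auto split: split_indicator)
  have I: "(LBINT t:{b * x<..}. \<psi> t * inverse_density b \<nu> sub_density t x) = I x" if x: "0 < x" for x
    unfolding I_def
    by (rule LBINT_greaterThan_eq[OF _ laplace_densityD(1)[OF inverse_density_laplace(1)]])
       (use x inverse_density_laplace(2) sub_density_finite_part_density in auto)
  have f1: "0 \<le> f 1" "b \<le> f 1" using f_nonneg[of 1] f_ge[of 1] by auto
  have "(I \<longlongrightarrow> J) (at_right 0)"
  proof (rule tendstoI)
    fix d :: real assume d: "0 < d"
    \<comment> \<open>Two approximation errors \<open>e * f 1\<close> and the drift error
      \<open>e * b\<close> must sum to less than \<open>d\<close>; the excess in the denominator
      makes it positive and the inequality strict.\<close>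
    define e where "e = d / (3 * f 1 + b + 1)"
    have den: "0 < 3 * f 1 + b + 1" using f1 b_nonneg by linarith
    have e: "0 < e" using d den by (simp add: e_def)
    have ed: "e * (2 * f 1 + b) < d"
    proof -
      have "e * (2 * f 1 + b) < e * (3 * f 1 + b + 1)" using e f1 by (intro mult_strict_left_mono) auto
      also have "\<dots> = d" using den by (simp add: e_def)
      finally show ?thesis .
    qed
    obtain c n where c: "\<And>y. 0 \<le> y \<Longrightarrow> \<bar>\<psi> y - (\<Sum>j<n. c j * exp (- (real j + 1) * y))\<bar> \<le> e * exp (- y)"
    proof (rule exp_poly_approx[OF cont zero e])
      fix c :: "nat \<Rightarrow> real" and n
      assume "\<And>y. 0 \<le> y \<Longrightarrow> \<bar>\<psi> y - (\<Sum>j<n. c j * exp (- (real j + 1) * y))\<bar> \<le> e * exp (- y)"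
      then show thesis by (rule that)
    qed
    define F where "F x = (\<Sum>j<n. c j * (f (real j + 1) / (real j + 1) * exp (- x * f (real j + 1))))" for x
    \<comment> \<open>The value at 0 of the exponential polynomial, of size at most \<open>e\<close>
      since \<open>\<psi> 0 = 0\<close>. The product \<open>b * s\<close> is the contribution of the
      Dirac part, which separates \<open>F 0\<close> from the integral against the tail
      alone.\<close>
    define s where "s = (\<Sum>j<n. c j)"
    have s: "\<bar>s\<bar> \<le> e" using c[of 0] \<psi>0 by (simp add: s_def)
    have J_le: "\<bar>J - (F 0 - b * s)\<bar> \<le> e * f 1"
    proof -
      have "\<bar>J - (\<Sum>j<n. c j * (f (real j + 1) / (real j + 1) - b))\<bar> \<le> e * (f 1 / 1 - b)"
        unfolding J_def by (rule laplace_density_approx[OF tail_laplace_density _ C c]) auto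
      also have "(\<Sum>j<n. c j * (f (real j + 1) / (real j + 1) - b)) = F 0 - b * s"
        by (simp add: F_def s_def right_diff_distrib sum_subtractf sum_distrib_left mult.commute)
      also have "e * (f 1 / 1 - b) \<le> e * f 1" using e b_nonneg by (intro mult_left_mono) auto
      finally show ?thesis .
    qed
    have I_le: "\<bar>I x - F x\<bar> \<le> e * f 1" if x: "0 < x" for x
    proof -
      have "\<bar>I x - F x\<bar> \<le> e * (f 1 / 1 * exp (- x * f 1))"
        unfolding I_def F_def
        by (rule laplace_density_approx[OF inverse_density_laplace(1)[where \<mu>=sub_density, OF x sub_density_finite_part_density[OF x]] _ C c]) auto
      also have "\<dots> \<le> e * f 1" using e f1 x by (intro mult_left_mono) (auto intro!: mult_left_le)
      finally show ?thesis .
    qed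
    have "(F \<longlongrightarrow> F 0) (at_right 0)"
      unfolding F_def by (intro tendsto_intros)
    from tendstoD[OF this, of "d - e * (2 * f 1 + b)"]
    have "\<forall>\<^sub>F x in at_right 0. \<bar>F x - F 0\<bar> < d - e * (2 * f 1 + b)"
      using ed by (simp add: dist_real_def)
    moreover have "\<forall>\<^sub>F x in at_right (0::real). 0 < x" by (rule eventually_at_right_less)
    ultimately show "\<forall>\<^sub>F x in at_right 0. dist (I x) J < d"
    proof eventually_elim
      case (elim x)
      have "\<bar>b * s\<bar> \<le> e * b" using s b_nonneg by (simp add: abs_mult mult.commute mult_left_mono)
      moreover have "\<bar>I x - J\<bar> \<le> \<bar>I x - F x\<bar> + \<bar>F x - F 0\<bar> + \<bar>b * s\<bar> + \<bar>J - (F 0 - b * s)\<bar>" by linarith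
      moreover have "e * (2 * f 1 + b) = e * f 1 + e * f 1 + e * b" by (simp add: algebra_simps)
      ultimately show ?case using elim I_le[of x] J_le unfolding dist_real_def by linarith
    qed
  qed
  moreover have "\<forall>\<^sub>F x in at_right 0. I x = (LBINT t:{b * x<..}. \<psi> t * inverse_density b \<nu> sub_density t x)"
    using eventually_at_right_less[of 0] by eventually_elim (simp add: I)
  ultimately show ?thesis unfolding J by (rule Lim_transform_eventually)
qed

lemma inverse_density_boundary:
  assumes t: "0 < t" and b: "0 < b"
  shows "inverse_density b \<nu> sub_density t (t / b) = 0"
proof -
  \<comment> \<open>The argument \<open>t - z\<close> lies below \<open>b * (t / b) = t\<close>,
    where the chosen version is identically 0, so the convolution vanishes along with the drift
    term.\<close>
  have "sub_density (t / b) (t - z) * \<nu> z = 0" if "z \<in> {0<..<t}" for z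
    using that b by (simp add: sub_density_zero)
  then have "(LBINT z:{0<..<t}. sub_density (t / b) (t - z) * \<nu> z) = (LBINT z:{0<..<t}. 0)"
    by (intro set_lebesgue_integral_cong) auto
  then show ?thesis
    using t b sub_density_zero[of t "t / b"] by (simp add: inverse_density_def)
qed

lemma inverse_density_0: assumes t: "0 < t" shows "inverse_density b \<nu> \<mu> t 0 = \<nu> t"
proof -
  have eq: "(\<lambda>y. indicat_real {0..<t} y *\<^sub>R \<nu> (t - y)) = (\<lambda>y. indicat_real {0..<t} y * enn2real (tail_ext (t - y)))"
    using tail_nonneg by (auto simp: fun_eq_iff tail_ext_def split: split_indicator)
  \<comment> \<open>The interval is closed at 0, so the point charged by the Dirac mass is included;
    \<open>tail_ext\<close> supplies the measurability that evaluation at this point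
    requires.\<close>
  have "(LINT y|return borel 0. indicat_real {0..<t} y *\<^sub>R \<nu> (t - y)) = indicat_real {0..<t} 0 * enn2real (tail_ext (t - 0))"
    unfolding eq by (rule integral_return) auto
  then show ?thesis
    using t tail_nonneg[of t] by (simp add: inverse_density_def set_lebesgue_integral_def tail_ext_def)
qed

lemma density_problem_sub_density: "density_problem b \<nu> sub_density"
  unfolding density_problem_def
  using density_equation_any_version[OF sub_density_finite_part_density] sub_density_zero density_initial by auto

lemma inverse_problem_sub_density: "inverse_problem b \<nu> (inverse_density b \<nu> sub_density)"
  unfolding inverse_problem_def
proof (intro conjI allI impI)
  show "inverse_equation b \<nu> (inverse_density b \<nu> sub_density)"
    by (rule inverse_equation_any_version[OF sub_density_finite_part_density])
  show "inverse_density b \<nu> sub_density t (t / b) = 0" if "0 < b" "0 < t" for t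
    by (rule inverse_density_boundary) fact+
  show "inverse_density b \<nu> sub_density t 0 = \<nu> t" if "0 < t" for t
    by (rule inverse_density_0) fact
next
  fix \<psi> :: "real \<Rightarrow> real"
  assume "continuous_on UNIV \<psi> \<and> (\<exists>K. compact K \<and> K \<subseteq> {0<..} \<and> (\<forall>t. t \<notin> K \<longrightarrow> \<psi> t = 0))"
  then obtain K where "continuous_on UNIV \<psi>" "compact K" "K \<subseteq> {0<..}" "\<And>t. t \<notin> K \<Longrightarrow> \<psi> t = 0" by blast
  then show "((\<lambda>x. LBINT t:{b * x<..}. \<psi> t * inverse_density b \<nu> sub_density t x) \<longlongrightarrow> (LBINT t:{0<..}. \<psi> t * \<nu> t)) (at_right 0)"
    by (rule inverse_boundary_limit)
next
  fix \<phi> :: "real \<Rightarrow> real"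
  assume "continuous_on UNIV \<phi> \<and> bounded (range \<phi>)"
  then show "((\<lambda>t. LBINT x:{0<..}. \<phi> x * inverse_density b \<nu> sub_density t x) \<longlongrightarrow> \<phi> 0) (at_right 0)"
    by (intro inverse_initial) auto
qed

end

theorem theorem4p1:
  fixes M :: "'w measure" and \<sigma> :: "real \<Rightarrow> 'w \<Rightarrow> ennreal"
    and a b :: real and N :: "real measure"
  assumes "levy_triple a b N"
    and "subordinator M (bernstein a b N) \<sigma>"
    and "emeasure N {0<..} = \<infinity>"
    and "\<And>c d. 0 < c \<Longrightarrow> c \<le> d \<Longrightarrow> abs_cont_on_interval c d (levy_tail a N)"
  shows
    "distr M borel (\<sigma> 0) = return borel 0 \<and>
     distr M borel (inverse_subordinator \<sigma> 0) = return borel 0 \<and>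
     (\<exists>\<mu>. (\<forall>t>0. finite_part_density M (\<sigma> t) (\<mu> t)) \<and>
          (\<forall>t>0. finite_part_density M (inverse_subordinator \<sigma> t)
                   (inverse_density b (levy_tail a N) \<mu> t)) \<and>
          density_problem b (levy_tail a N) \<mu> \<and>
          inverse_problem b (levy_tail a N) (inverse_density b (levy_tail a N) \<mu>)) \<and>
     (\<forall>\<mu>. (\<forall>t>0. finite_part_density M (\<sigma> t) (\<mu> t)) \<longrightarrow>
          density_equation b (levy_tail a N) \<mu> \<and>
          inverse_equation b (levy_tail a N) (inverse_density b (levy_tail a N) \<mu>))"
proof -
  interpret subordinator_process a b N M \<sigma>
    by unfold_locales (use assms in auto)
  show ?thesis
  proof (intro conjI)
    show "\<exists>\<mu>. (\<forall>t>0. finite_part_density M (\<sigma> t) (\<mu> t)) \<and>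
          (\<forall>t>0. finite_part_density M (inverse_subordinator \<sigma> t)
                   (inverse_density b (levy_tail a N) \<mu> t)) \<and>
          density_problem b (levy_tail a N) \<mu> \<and>
          inverse_problem b (levy_tail a N) (inverse_density b (levy_tail a N) \<mu>)"
      using sub_density_finite_part_density inverse_finite_part_density density_problem_sub_density inverse_problem_sub_density
      by (intro exI[of _ sub_density]) blast
    show "\<forall>\<mu>. (\<forall>t>0. finite_part_density M (\<sigma> t) (\<mu> t)) \<longrightarrow>
          density_equation b (levy_tail a N) \<mu> \<and>
          inverse_equation b (levy_tail a N) (inverse_density b (levy_tail a N) \<mu>)"
      using density_equation_any_version inverse_equation_any_version by blast
  qed (rule distr_\<sigma>_0 distr_L_0)+
qed

end
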